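(* For every integer $d\ge 2$ there exist an integer $d\times 2d$ matrix $A_d$ of full rank $d$ and a parameter $\beta_d\in\mathbb{C}^d$ such that $$\operatorname{rank}(H_{A_d}(\beta_d))-\operatorname{vol}(A_d)\ \ge\ d-1 .$$
   Context: Let $A=(a_{i,j})$ be an integer $d\times n$ matrix of full rank $d$ and $\beta\in\mathbb{C}^d$. Write $\partial_j=\partial/\partial x_j$ and use multi-index notation. For $u\in\mathbb{Z}^n$ write $u=u_+-u_-$ with $(u_+)_i=\max\{u_i,0\}$, $(u_-)_i=\max\{-u_i,0\}$. Let $\ker_{\mathbb{Z}}(A)=\{u\in\mathbb{Z}^n: Au=0\}$. The $A$-hypergeometric system $H_A(\beta)$ is the system of linear partial differential equations for a function $\varphi=\varphi(x_1,\dots,x_n)$ consisting of the homogeneity equations $\sum_{j=1}^n a_{i,j}x_j\partial_j\varphi=\beta_i\varphi$ for $i=1,\dots,d$, and the toric equations $\partial^{u_+}\varphi=\partial^{u_-}\varphi$ for all $u\in\ker_{\mathbb{Z}}(A)$. The rank $\operatorname{rank}(H_A(\beta))$ is the dimension of the complex vector space of holomorphic solutions of $H_A(\beta)$ on a nonempty simply connected open subset of $\mathbb{C}^n$ avoiding the singular locus of the system. (There is a nonzero polynomial $h$ in $x_1,\dots,x_n$ such that this dimension is finite and the same for all nonempty simply connected open subsets of $\{h\ne 0\}$; the rank is this common value.) The simplicial (normalized) volume $\operatorname{vol}(A)$ is $d!$ times the Euclidean volume of the convex hull in $\mathbb{R}^d$ of the origin and the columns of $A$. *)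

theory Defs
  imports "HOL-Analysis.Analysis" "HOL-Library.Function_Algebras"
begin

section \<open>Holomorphic functions of several variables\<close>

text \<open>
  The derivative supplied by \<^const>\<open>has_derivative\<close> on \<open>complex ^ 'n\<close> is only real-linear, so complex
  linearity is required explicitly.
\<close>

definition multi_holomorphic_on ::
    "(complex ^ 'n::finite \<Rightarrow> complex) \<Rightarrow> (complex ^ 'n) set \<Rightarrow> bool" where
  "multi_holomorphic_on f U \<longleftrightarrow>
     (\<forall>x\<in>U. \<exists>D. (f has_derivative D) (at x) \<and> (\<forall>c v. D (c *s v) = c * D v))"

definition pderiv_at ::
    "'n::finite \<Rightarrow> (complex ^ 'n \<Rightarrow> complex) \<Rightarrow> complex ^ 'n \<Rightarrow> complex" where
  "pderiv_at j f x = deriv (\<lambda>t. f (x + t *s axis j 1)) 0"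

text \<open>
  A finite index type carries no canonical order, so the multi-index derivative applies the partial
  derivatives along an arbitrary enumeration of the index type.  On an open set where \<open>f\<close> is
  holomorphic they commute, and the result does not depend on the enumeration.
\<close>

definition multi_pderiv ::
    "('n::finite \<Rightarrow> nat) \<Rightarrow> (complex ^ 'n \<Rightarrow> complex) \<Rightarrow> complex ^ 'n \<Rightarrow> complex" where
  "multi_pderiv u f =
     foldr (\<lambda>j. pderiv_at j ^^ u j) (SOME js. distinct js \<and> set js = (UNIV :: 'n set)) f"

section \<open>The hypergeometric system of an integer matrix\<close>

definition ker_int :: "int ^ 'n::finite ^ 'd::finite \<Rightarrow> (int ^ 'n) set" where
  "ker_int A = {u. A *v u = 0}"

definition pos_part :: "int ^ 'n::finite \<Rightarrow> 'n \<Rightarrow> nat" where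
  "pos_part u i = nat (u $ i)"

definition neg_part :: "int ^ 'n::finite \<Rightarrow> 'n \<Rightarrow> nat" where
  "neg_part u i = nat (- (u $ i))"

definition solves_hypergeom ::
    "int ^ 'n::finite ^ 'd::finite \<Rightarrow> complex ^ 'd \<Rightarrow> (complex ^ 'n) set
      \<Rightarrow> (complex ^ 'n \<Rightarrow> complex) \<Rightarrow> bool" where
  "solves_hypergeom A \<beta> U f \<longleftrightarrow>
     (\<forall>x\<in>U. \<forall>i. (\<Sum>j\<in>UNIV. of_int (A $ i $ j) * x $ j * pderiv_at j f x) = \<beta> $ i * f x) \<and>
     (\<forall>u\<in>ker_int A. \<forall>x\<in>U. multi_pderiv (pos_part u) f x = multi_pderiv (neg_part u) f x)"

text \<open>
  A function on \<open>U\<close> is represented by its extension by zero, so that solutions that agree on \<open>U\<close>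
  are equal.
\<close>

definition solution_space ::
    "int ^ 'n::finite ^ 'd::finite \<Rightarrow> complex ^ 'd \<Rightarrow> (complex ^ 'n) set
      \<Rightarrow> (complex ^ 'n \<Rightarrow> complex) set" where
  "solution_space A \<beta> U =
     {f. multi_holomorphic_on f U \<and> solves_hypergeom A \<beta> U f \<and> (\<forall>x. x \<notin> U \<longrightarrow> f x = 0)}"

interpretation cfun: vector_space "\<lambda>(c::complex) (f :: 'a \<Rightarrow> complex) x. c * f x"
  by unfold_locales (auto simp: fun_eq_iff algebra_simps)

section \<open>Rank and volume\<close>

text \<open>
  Over the complex numbers a polynomial is nonzero iff the function it induces is nonzero, so
  polynomials in several variables are represented by the functions they induce.
\<close>

definition nonzero_polynomial :: "(complex ^ 'n::finite \<Rightarrow> complex) \<Rightarrow> bool" where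
  "nonzero_polynomial h \<longleftrightarrow>
     (\<exists>M c. finite M \<and> h = (\<lambda>x. \<Sum>m\<in>M. c m * (\<Prod>i\<in>UNIV. x $ i ^ m i))) \<and> (\<exists>x. h x \<noteq> 0)"

text \<open>
  The library's \<open>dim\<close> is \<open>0\<close> on a space of infinite dimension, so finite dimensionality is required
  separately.
\<close>

definition hypergeom_rank ::
    "int ^ 'n::finite ^ 'd::finite \<Rightarrow> complex ^ 'd \<Rightarrow> nat" where
  "hypergeom_rank A \<beta> =
     (THE r. \<exists>h. nonzero_polynomial h \<and>
        (\<forall>U. open U \<and> U \<noteq> {} \<and> simply_connected U \<and> U \<subseteq> {x. h x \<noteq> 0} \<longrightarrow>
           (\<exists>B. finite B \<and> solution_space A \<beta> U \<subseteq> cfun.span B) \<and>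
           cfun.dim (solution_space A \<beta> U) = r))"

definition simplicial_volume :: "int ^ 'n::finite ^ 'd::finite \<Rightarrow> real" where
  "simplicial_volume A =
     fact CARD('d) * measure lborel (convex hull (insert 0 (columns (map_matrix real_of_int A))))"

end

theory Submission
  imports Defs "HOL-Complex_Analysis.Cauchy_Integral_Formula"
begin

text \<open>
  Fix an index \<open>d0\<close> and let \<open>e\<close> be the unit vector at \<open>d0\<close>.  The matrix has the columns \<open>2e\<close>, \<open>3e\<close> and,
  for every other index \<open>j\<close>, the columns \<open>e\<^sub>j\<close> and \<open>e + e\<^sub>j\<close>.  The semigroup generated by the columns
  consists of all vectors of natural numbers except \<open>e\<close>, and the parameter \<open>\<beta> = e\<close> is this hole.
  With \<open>d\<close> rows the simplicial volume is at most \<open>d + 2\<close>, whereas the rank turns out to be \<open>2d + 1\<close>.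

  Let \<open>x\<close>, \<open>y\<close>, \<open>z\<^sub>j\<close>, \<open>w\<^sub>j\<close> be the variables of the columns \<open>2e\<close>, \<open>3e\<close>, \<open>e\<^sub>j\<close>, \<open>e + e\<^sub>j\<close>, and put
  \<open>s\<^sub>j = - z\<^sub>j / w\<^sub>j\<close>, the zero of \<open>z\<^sub>j + w\<^sub>j s\<close>.  Solutions can be thought of as integrals of
  \<open>s\<^sup>-\<^sup>2 exp (x s\<^sup>2 + y s\<^sup>3)\<close> whose end points are the points \<open>s\<^sub>j\<close> or directions at infinity.  The Laurent
  expansion of the integrand at \<open>0\<close> has no term in \<open>1/s\<close>, which reflects the hole.  Hence there is a
  single-valued primitive, and its value at \<open>s\<^sub>j\<close> is a solution for each \<open>j\<close>
  (\<open>endpoint_value_solution\<close>).  Its polar part \<open>1/s\<^sub>j\<close> is a solution by itself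
  (\<open>laurent_solution\<close>), and these \<open>d - 1\<close> Laurent monomials make up the rank jump.
  Three more solutions depend on \<open>x\<close> and \<open>y\<close> only.  They have the form \<open>y\<^sup>1\<^sup>/\<^sup>3 g (x y\<^sup>-\<^sup>2\<^sup>/\<^sup>3)\<close>, where \<open>g\<close> runs
  through the entire solutions of a linear equation of third order (\<open>airy_fundamental_system\<close>,
  \<open>airy_type_basis\<close>).

  There are no further solutions on a connected open set where all variables other than \<open>x\<close> are
  nonzero.  For a solution \<open>f\<close> the quadratic toric equations and the homogeneity equations give a closed
  system for the derivative of \<open>f\<close> in \<open>z\<^sub>j\<close>, and two explicit expressions in it have vanishing
  differential.  The resulting two constants are the coefficients of the two solutions attached to \<open>j\<close>
  (\<open>residue_constants\<close>).  After subtraction a function of \<open>x\<close> and \<open>y\<close> remains, and Cramer's rule with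
  Wronskians expresses it by the three functions above (\<open>airy_type_span\<close>).  Together with the linear
  independence of these \<open>2 (d - 1) + 3\<close> functions this determines the dimension on every simply connected
  open set that avoids the coordinate hyperplanes other than \<open>x = 0\<close>; simple connectedness is used for
  the cube root of \<open>y\<close>.

  The toric equations of the explicit solutions are verified for all vectors of the kernel at once: it
  suffices to place a function in a family, indexed by degrees, on which each partial derivative acts by
  adding the corresponding column to the degree (\<open>toric_equation_family\<close>).
\<close>

section \<open>Complex differentiable functions of several variables\<close>

text \<open>
  Complex differentiability at one point.  In this pointwise form it can serve as a side condition of the
  rewrite rules for partial derivatives below.
\<close>

definition cdiff :: "(complex ^ 'n::finite \<Rightarrow> complex) \<Rightarrow> complex ^ 'n \<Rightarrow> bool" where
  "cdiff f x \<longleftrightarrow> (\<exists>D. (f has_derivative D) (at x) \<and> (\<forall>c v. D (c *s v) = c * D v))"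

lemma multi_holomorphic_on_iff: "multi_holomorphic_on f U \<longleftrightarrow> (\<forall>x\<in>U. cdiff f x)"
  by (simp add: multi_holomorphic_on_def cdiff_def)

lemma cdiffI:
  assumes "(f has_derivative D) (at x)" "\<And>c v. D (c *s v) = c * D v"
  shows "cdiff f x"
  using assms by (auto simp: cdiff_def)

lemma has_derivative_complex_line:
  fixes v :: "complex ^ 'n::finite"
  shows "((\<lambda>t. x + t *s v) has_derivative (\<lambda>h. h *s v)) (at t0)"
proof -
  have "bounded_linear (\<lambda>h. h *s v)"
    by (simp add: linear_conv_bounded_linear[symmetric] linear_iff vec_eq_iff algebra_simps)
  from has_derivative_add[OF has_derivative_const bounded_linear.has_derivative[OF this has_derivative_ident]]
  show ?thesis by simp
qed

lemma derivative_along_axis: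
  fixes f :: "complex ^ 'n::finite \<Rightarrow> complex"
  assumes D: "(f has_derivative D) (at (x + t0 *s axis j 1))" and lin: "\<And>c v. D (c *s v) = c * D v"
  shows "((\<lambda>t. f (x + t *s axis j 1)) has_field_derivative D (axis j 1)) (at t0)"
proof -
  have "((\<lambda>t. f (x + t *s axis j 1)) has_derivative (\<lambda>h. D (h *s axis j 1))) (at t0)"
    using has_derivative_compose[where f = "\<lambda>t. x + t *s axis j 1" and x = t0 and s = UNIV and g = f and g' = D,
        OF has_derivative_complex_line D] .
  moreover have "(\<lambda>h. D (h *s axis j 1)) = (*) (D (axis j 1))" by (auto simp: lin mult.commute)
  ultimately show ?thesis by (simp add: has_field_derivative_def)
qed

lemma pderiv_at_eq:
  fixes f :: "complex ^ 'n::finite \<Rightarrow> complex"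
  assumes D: "(f has_derivative D) (at x)" and lin: "\<And>c v. D (c *s v) = c * D v"
  shows "pderiv_at j f x = D (axis j 1)"
  using derivative_along_axis[of f D x 0 j] assms by (simp add: pderiv_at_def DERIV_imp_deriv)

lemma cdiff_slice:
  assumes "cdiff f (x + t0 *s axis j 1)"
  shows "((\<lambda>t. f (x + t *s axis j 1)) has_field_derivative pderiv_at j f (x + t0 *s axis j 1)) (at t0)"
proof -
  obtain D where "(f has_derivative D) (at (x + t0 *s axis j 1))" "\<And>c v. D (c *s v) = c * D v"
    using assms by (auto simp: cdiff_def)
  then show ?thesis using derivative_along_axis pderiv_at_eq by metis
qed

lemma cdiff_slice0:
  assumes "cdiff f x"
  shows "((\<lambda>t. f (x + t *s axis j 1)) has_field_derivative pderiv_at j f x) (at 0)"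
  using cdiff_slice[of f x 0 j] assms by simp

lemma cdiff_has_derivative:
  assumes "cdiff f x"
  shows "(f has_derivative (\<lambda>v. \<Sum>j\<in>UNIV. v $ j * pderiv_at j f x)) (at x)"
proof -
  obtain D where D: "(f has_derivative D) (at x)" "\<And>c v. D (c *s v) = c * D v"
    using assms by (auto simp: cdiff_def)
  have "D v = (\<Sum>j\<in>UNIV. v $ j * pderiv_at j f x)" for v
  proof -
    have "D v = D (\<Sum>j\<in>UNIV. v $ j *s axis j 1)" by (simp add: basis_expansion)
    also have "\<dots> = (\<Sum>j\<in>UNIV. D (v $ j *s axis j 1))"
      using linear_sum[OF has_derivative_linear[OF D(1)]] .
    finally show ?thesis using D pderiv_at_eq[OF D] by simp
  qed
  then have "D = (\<lambda>v. \<Sum>j\<in>UNIV. v $ j * pderiv_at j f x)" by blast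
  then show ?thesis using D(1) by simp
qed

lemma cdiff_continuous: "cdiff f x \<Longrightarrow> isCont f x"
  using cdiff_has_derivative has_derivative_continuous by blast

lemma cdiff_cong:
  assumes "cdiff f x" "open U" "x \<in> U" "\<And>y. y \<in> U \<Longrightarrow> f y = g y"
  shows "cdiff g x"
  using assms unfolding cdiff_def by (meson has_derivative_transform_within_open)

lemma pderiv_at_cong:
  assumes "open U" "x \<in> U" "\<And>y. y \<in> U \<Longrightarrow> f y = g y"
  shows "pderiv_at j f x = pderiv_at j g x"
proof -
  have "isCont (\<lambda>t. x + t *s axis j 1) 0"
    using has_derivative_complex_line has_derivative_continuous by blast
  then have "((\<lambda>t. x + t *s axis j 1) \<longlongrightarrow> x) (at 0)" by (simp add: isCont_def)
  then have "\<forall>\<^sub>F t in at 0. x + t *s axis j 1 \<in> U"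
    using assms(1,2) by (simp add: topological_tendstoD)
  then have "\<forall>\<^sub>F t in nhds 0. x + t *s axis j 1 \<in> U"
    using assms(2) by (simp add: eventually_nhds_conv_at)
  then have "\<forall>\<^sub>F t in nhds 0. f (x + t *s axis j 1) = g (x + t *s axis j 1)"
    by eventually_elim (use assms(3) in auto)
  then show ?thesis unfolding pderiv_at_def by (rule deriv_cong_ev) simp
qed

lemma cdiff_const [simp]: "cdiff (\<lambda>_. c) x"
  by (rule cdiffI[of _ "\<lambda>_. 0"]) auto

lemma pderiv_const [simp]: "pderiv_at j (\<lambda>_. c) x = 0"
  by (simp add: pderiv_at_def)

lemma cdiff_coord [simp]: "cdiff (\<lambda>x. x $ k) x"
  by (rule cdiffI[of _ "\<lambda>v. v $ k"]) (auto intro: bounded_linear_imp_has_derivative)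

lemma pderiv_coord [simp]: "pderiv_at j (\<lambda>x. x $ k) x = (if j = k then 1 else 0)"
  by (subst pderiv_at_eq[of _ "\<lambda>v. v $ k"])
     (auto intro: bounded_linear_imp_has_derivative simp: axis_def)

lemma cdiff_add [simp]: "cdiff f x \<Longrightarrow> cdiff g x \<Longrightarrow> cdiff (\<lambda>x. f x + g x) x"
  by (rule cdiffI[OF has_derivative_add[OF cdiff_has_derivative cdiff_has_derivative]])
     (auto simp: algebra_simps sum_distrib_left)

lemma cdiff_mult [simp]: "cdiff f x \<Longrightarrow> cdiff g x \<Longrightarrow> cdiff (\<lambda>x. f x * g x) x"
  by (rule cdiffI[OF has_derivative_mult[OF cdiff_has_derivative cdiff_has_derivative]])
     (auto simp: algebra_simps sum_distrib_left)

lemma cdiff_compose: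
  assumes "cdiff f x" "(h has_field_derivative h') (at (f x))"
  shows "cdiff (\<lambda>x. h (f x)) x"
  by (rule cdiffI[OF has_derivative_compose[OF cdiff_has_derivative[OF assms(1)]
        assms(2)[unfolded has_field_derivative_def]]])
     (auto simp: algebra_simps sum_distrib_left)

lemma pderiv_compose:
  assumes "cdiff f x" "(h has_field_derivative h') (at (f x))"
  shows "pderiv_at j (\<lambda>x. h (f x)) x = h' * pderiv_at j f x"
proof -
  have "((\<lambda>t. h (f (x + t *s axis j 1))) has_field_derivative h' * pderiv_at j f x) (at 0)"
    using DERIV_chain2[of h h' "\<lambda>t. f (x + t *s axis j 1)" 0] cdiff_slice0[OF assms(1)] assms(2) by simp
  then show ?thesis by (simp add: pderiv_at_def DERIV_imp_deriv)
qed

lemma pderiv_add [simp]: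
  assumes "cdiff f x" "cdiff g x"
  shows "pderiv_at j (\<lambda>x. f x + g x) x = pderiv_at j f x + pderiv_at j g x"
  using DERIV_add[OF cdiff_slice0[OF assms(1)] cdiff_slice0[OF assms(2)]]
  by (simp add: pderiv_at_def[of _ "\<lambda>x. f x + g x"] DERIV_imp_deriv)

lemma pderiv_mult [simp]:
  assumes "cdiff f x" "cdiff g x"
  shows "pderiv_at j (\<lambda>x. f x * g x) x = f x * pderiv_at j g x + pderiv_at j f x * g x"
  using DERIV_mult[OF cdiff_slice0[OF assms(1)] cdiff_slice0[OF assms(2)]]
  by (simp add: pderiv_at_def[of _ "\<lambda>x. f x * g x"] DERIV_imp_deriv algebra_simps)

lemma cdiff_minus [simp]: "cdiff f x \<Longrightarrow> cdiff (\<lambda>x. - f x) x"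
  using cdiff_mult[of "\<lambda>_. -1" x f] by simp

lemma pderiv_minus [simp]: "cdiff f x \<Longrightarrow> pderiv_at j (\<lambda>x. - f x) x = - pderiv_at j f x"
  using pderiv_mult[of "\<lambda>_. -1" x f] by simp

lemma cdiff_diff [simp]: "cdiff f x \<Longrightarrow> cdiff g x \<Longrightarrow> cdiff (\<lambda>x. f x - g x) x"
  using cdiff_add[of f x "\<lambda>x. - g x"] by simp

lemma pderiv_diff [simp]:
  "cdiff f x \<Longrightarrow> cdiff g x \<Longrightarrow> pderiv_at j (\<lambda>x. f x - g x) x = pderiv_at j f x - pderiv_at j g x"
  using pderiv_add[of f x "\<lambda>x. - g x"] by simp

lemma cdiff_sum [simp]: "(\<And>i. i \<in> I \<Longrightarrow> cdiff (f i) x) \<Longrightarrow> cdiff (\<lambda>x. \<Sum>i\<in>I. f i x) x"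
  by (induction I rule: infinite_finite_induct) auto

lemma pderiv_sum [simp]:
  "(\<And>i. i \<in> I \<Longrightarrow> cdiff (f i) x) \<Longrightarrow> pderiv_at j (\<lambda>x. \<Sum>i\<in>I. f i x) x = (\<Sum>i\<in>I. pderiv_at j (f i) x)"
  by (induction I rule: infinite_finite_induct) auto

lemma cdiff_power [simp]: "cdiff f x \<Longrightarrow> cdiff (\<lambda>x. f x ^ n) x"
  by (induction n) auto

lemma pderiv_power [simp]:
  "cdiff f x \<Longrightarrow> pderiv_at j (\<lambda>x. f x ^ n) x = of_nat n * f x ^ (n - 1) * pderiv_at j f x"
  by (rule pderiv_compose[of f x "\<lambda>z. z ^ n"]) (auto intro!: derivative_eq_intros)

lemma cdiff_exp [simp]: "cdiff f x \<Longrightarrow> cdiff (\<lambda>x. exp (f x)) x"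
  by (rule cdiff_compose[OF _ DERIV_exp])

lemma pderiv_exp [simp]: "cdiff f x \<Longrightarrow> pderiv_at j (\<lambda>x. exp (f x)) x = exp (f x) * pderiv_at j f x"
  by (rule pderiv_compose[OF _ DERIV_exp])

lemma cdiff_divide [simp]: "cdiff f x \<Longrightarrow> cdiff g x \<Longrightarrow> g x \<noteq> 0 \<Longrightarrow> cdiff (\<lambda>x. f x / g x) x"
  using cdiff_mult[of f x "\<lambda>x. inverse (g x)"] cdiff_compose[OF _ DERIV_inverse, of g x]
  by (simp add: divide_inverse)

lemma pderiv_divide [simp]:
  assumes "cdiff f x" "cdiff g x" "g x \<noteq> 0"
  shows "pderiv_at j (\<lambda>x. f x / g x) x = (pderiv_at j f x * g x - f x * pderiv_at j g x) / (g x)\<^sup>2"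
proof -
  have i: "cdiff (\<lambda>x. inverse (g x)) x" using cdiff_compose[OF _ DERIV_inverse, of g x] assms by simp
  have "pderiv_at j (\<lambda>x. inverse (g x)) x = - (inverse (g x) ^ Suc (Suc 0)) * pderiv_at j g x"
    by (rule pderiv_compose[OF assms(2) DERIV_inverse[OF assms(3)]])
  then have "pderiv_at j (\<lambda>x. f x * inverse (g x)) x
      = f x * (- (inverse (g x) ^ Suc (Suc 0)) * pderiv_at j g x) + pderiv_at j f x * inverse (g x)"
    using pderiv_mult[OF assms(1) i, of j] by simp
  also have "\<dots> = (pderiv_at j f x * g x - f x * pderiv_at j g x) / (g x)\<^sup>2"
    using assms(3) by (simp add: power2_eq_square field_simps)
  finally show ?thesis by (simp add: divide_inverse)
qed

lemma cdiff_zero_constant: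
  assumes "open U" "connected U" "\<And>x. x \<in> U \<Longrightarrow> cdiff f x"
    and 0: "\<And>x j. x \<in> U \<Longrightarrow> pderiv_at j f x = 0"
  obtains c where "\<And>x. x \<in> U \<Longrightarrow> f x = c"
proof -
  have "f constant_on U"
  proof (rule has_derivative_zero_connected_constant_on[of U "{}"])
    show "continuous_on U f"
      using assms(3) cdiff_continuous by (auto intro: continuous_at_imp_continuous_on)
    show "\<forall>x\<in>U - {}. (f has_derivative (\<lambda>h. 0)) (at x within U)"
      using cdiff_has_derivative assms(3) 0 has_derivative_at_withinI by fastforce
  qed (use assms in auto)
  then show ?thesis using that by (auto simp: constant_on_def)
qed

lemma bounded_linear_of_complex_coords:
  "bounded_linear (\<lambda>v::complex ^ 'n::finite. \<Sum>j\<in>UNIV. v $ j * c j)"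
  by (simp add: linear_conv_bounded_linear[symmetric] linear_iff sum.distrib algebra_simps scaleR_sum_right)

text \<open>
  The complex-linear form with coefficients \<open>c\<close>, packaged as a bounded linear map because differentiation
  under the integral sign asks for continuity in the operator norm.
\<close>

definition coord_blinfun :: "('n::finite \<Rightarrow> complex) \<Rightarrow> (complex ^ 'n) \<Rightarrow>\<^sub>L complex" where
  "coord_blinfun c = Blinfun (\<lambda>v. \<Sum>j\<in>UNIV. v $ j * c j)"

lemma coord_blinfun_apply [simp]: "blinfun_apply (coord_blinfun c) v = (\<Sum>j\<in>UNIV. v $ j * c j)"
  by (simp add: coord_blinfun_def bounded_linear_Blinfun_apply[OF bounded_linear_of_complex_coords])

text \<open>
  Cauchy's formula on a circle in the direction of the coordinate \<open>j\<close>, parametrised over the unit interval.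
  It turns a derivative into an integral of values, so that a derivative inherits the regularity of the
  function.
\<close>

lemma pderiv_at_cauchy:
  assumes "0 < r" and U: "open U" "\<And>y. y \<in> U \<Longrightarrow> cdiff f y" "\<And>t. norm t \<le> r \<Longrightarrow> x + t *s axis j 1 \<in> U"
  shows "pderiv_at j f x =
     integral (cbox 0 1) (\<lambda>\<theta>. f (x + (r * exp (2 * of_real pi * \<i> * of_real \<theta>)) *s axis j 1)
        / (r * exp (2 * of_real pi * \<i> * of_real \<theta>)))"
proof -
  let ?e = "\<lambda>\<theta>::real. r * exp (2 * of_real pi * \<i> * of_real \<theta>)"
  define F where "F = (\<lambda>t. f (x + t *s axis j 1))"
  have D: "(F has_field_derivative pderiv_at j f (x + t *s axis j 1)) (at t)" if "norm t \<le> r" for t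
    unfolding F_def by (rule cdiff_slice) (use U that in auto)
  have "continuous_on (cball 0 r) F"
    by (rule DERIV_continuous_on[where D = "\<lambda>t. pderiv_at j f (x + t *s axis j 1)"])
       (auto intro: has_field_derivative_at_within D)
  moreover have "F holomorphic_on ball 0 r"
    by (rule holomorphic_onI, rule field_differentiable_at_within)
       (use D in \<open>force simp: field_differentiable_def\<close>)
  ultimately have "(F has_field_derivative (1 / (2 * of_real pi * \<i>) * contour_integral (circlepath 0 r) (\<lambda>u. F u / (u - 0)^2))) (at 0)"
    using Cauchy_derivative_integral_circlepath(2)[of 0 r F 0] \<open>0 < r\<close> by auto
  then have "pderiv_at j f x = 1 / (2 * of_real pi * \<i>) * contour_integral (circlepath 0 r) (\<lambda>u. F u / u^2)"
    using D[of 0] \<open>0 < r\<close> DERIV_unique by fastforce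
  also have "contour_integral (circlepath 0 r) (\<lambda>u. F u / u^2) =
     integral {0..1} (\<lambda>\<theta>. 2 * of_real pi * \<i> * (F (?e \<theta>) / (?e \<theta>)))"
    unfolding contour_integral_integral
    by (rule integral_cong) (use \<open>0 < r\<close> in \<open>simp only: vector_derivative_circlepath, simp add: circlepath power2_eq_square\<close>)
  also have "\<dots> = 2 * of_real pi * \<i> * integral {0..1} (\<lambda>\<theta>. (F (?e \<theta>) / (?e \<theta>)))"
    by (rule integral_mult_right)
  finally show ?thesis by (simp add: F_def)
qed

lemma norm_complex_axis [simp]: "norm (t *s axis j 1 :: complex ^ 'n::finite) = norm t"
proof -
  have "(norm ((t *s axis j 1 :: complex ^ 'n) $ i))\<^sup>2 = (if i = j then (norm t)\<^sup>2 else 0)" for i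
    by (auto simp: axis_def)
  then show ?thesis by (simp add: norm_vec_def L2_set_def)
qed

lemma coord_blinfun_eta: "blinfun_apply (coord_blinfun c) = (\<lambda>v. \<Sum>j\<in>UNIV. v $ j * c j)"
  by auto

text \<open>
  Near \<open>x0\<close> the same circle can be used for all base points and all functions, so that the formula may be
  differentiated with respect to the base point.
\<close>

lemma local_cauchy_formula:
  fixes U :: "(complex ^ 'n::finite) set"
  assumes "open U" "x0 \<in> U"
  obtains r and e :: "real \<Rightarrow> complex" where "0 < r" "continuous_on UNIV e" "\<forall>\<theta>. e \<theta> \<noteq> 0"
    "\<forall>x\<in>ball x0 r. \<forall>\<theta>. x + e \<theta> *s axis j 1 \<in> U"
    "\<forall>g x. (\<forall>y\<in>U. cdiff g y) \<longrightarrow> x \<in> ball x0 r \<longrightarrow>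
       pderiv_at j g x = integral (cbox 0 1) (\<lambda>\<theta>. g (x + e \<theta> *s axis j 1) / e \<theta>)"
proof -
  obtain R where R: "R > 0" "ball x0 R \<subseteq> U" using assms openE by blast
  define r where "r = R / 2"
  have r: "0 < r" using R by (simp add: r_def)
  have in_U: "x + t *s axis j 1 \<in> U" if "x \<in> ball x0 r" "norm t \<le> r" for x t
  proof -
    have "dist x0 (x + t *s axis j 1) \<le> dist x0 x + norm (t *s axis j 1 :: complex ^ 'n)"
      by (metis add_diff_cancel_left' dist_commute dist_norm dist_triangle)
    also have "\<dots> = dist x0 x + norm t" by (simp only: norm_complex_axis)
    also have "\<dots> < R" using that by (simp add: r_def)
    finally show ?thesis using R by auto
  qed
  define e where "e = (\<lambda>\<theta>. r * exp (2 * of_real pi * \<i> * complex_of_real \<theta>))"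
  have norm_e: "norm (e \<theta>) = r" for \<theta> using r by (simp add: e_def norm_mult)
  have "continuous_on UNIV e" unfolding e_def by (intro continuous_intros)
  moreover have "e \<theta> \<noteq> 0" for \<theta> using norm_e[of \<theta>] r by auto
  moreover have "pderiv_at j g x = integral (cbox 0 1) (\<lambda>\<theta>. g (x + e \<theta> *s axis j 1) / e \<theta>)"
    if "\<And>y. y \<in> U \<Longrightarrow> cdiff g y" "x \<in> ball x0 r" for g x
    unfolding e_def by (rule pderiv_at_cauchy[OF r assms(1)]) (use in_U that in auto)
  moreover have "x + e \<theta> *s axis j 1 \<in> U" if "x \<in> ball x0 r" for x \<theta>
    using in_U[OF that] norm_e by simp
  ultimately show ?thesis using that[of r e] r by blast
qed

lemma continuous_on_cauchy_kernel:
  fixes U :: "(complex ^ 'n::finite) set" and e :: "real \<Rightarrow> complex"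
  assumes "continuous_on U g" "continuous_on UNIV e" "\<And>\<theta>. e \<theta> \<noteq> 0"
    and in_U: "\<And>x \<theta>. x \<in> B \<Longrightarrow> x + e \<theta> *s axis j 1 \<in> U"
  shows "continuous_on (B \<times> T) (\<lambda>z. g (fst z + e (snd z) *s axis j 1) / e (snd z))"
proof -
  have cont_e: "continuous_on (B \<times> T) (\<lambda>z. e (snd z))"
    by (rule continuous_on_compose2[OF assms(2)]) (auto intro: continuous_intros)
  have "continuous_on (B \<times> T) (\<lambda>z. g (fst z + e (snd z) *s axis j 1))"
  proof (rule continuous_on_compose2[OF assms(1)])
    show "continuous_on (B \<times> T) (\<lambda>z. fst z + e (snd z) *s axis j 1)"
      unfolding vector_scalar_mult_def by (intro continuous_intros cont_e)
    show "(\<lambda>z. fst z + e (snd z) *s axis j 1) ` (B \<times> T) \<subseteq> U"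
      using in_U by auto
  qed
  then show ?thesis by (rule continuous_on_divide[OF _ cont_e]) (use assms(3) in auto)
qed

lemma pderiv_at_continuous:
  fixes U :: "(complex ^ 'n::finite) set"
  assumes U: "open U" "\<And>y. y \<in> U \<Longrightarrow> cdiff f y"
  shows "continuous_on U (pderiv_at j f)"
proof (rule continuous_at_imp_continuous_on, rule ballI)
  fix x0 assume "x0 \<in> U"
  with U(1) obtain r and e :: "real \<Rightarrow> complex" where r: "0 < r" and e: "continuous_on UNIV e" "\<forall>\<theta>. e \<theta> \<noteq> 0"
    "\<forall>x\<in>ball x0 r. \<forall>\<theta>. x + e \<theta> *s axis j 1 \<in> U"
    and eq: "\<forall>g x. (\<forall>y\<in>U. cdiff g y) \<longrightarrow> x \<in> ball x0 r \<longrightarrow>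
       pderiv_at j g x = integral (cbox 0 1) (\<lambda>\<theta>. g (x + e \<theta> *s axis j 1) / e \<theta>)"
    by (rule local_cauchy_formula[where j = j])
  note e = e(1) e(2)[rule_format] e(3)[rule_format]
  have "continuous_on U f" using U cdiff_continuous by (auto intro: continuous_at_imp_continuous_on)
  then have "continuous_on (ball x0 r) (\<lambda>x. integral (cbox 0 1) (\<lambda>\<theta>. f (x + e \<theta> *s axis j 1) / e \<theta>))"
    by (intro integral_continuous_on_param, unfold case_prod_unfold)
       (rule continuous_on_cauchy_kernel[OF _ e])
  then have "continuous_on (ball x0 r) (pderiv_at j f)"
    by (rule continuous_on_eq) (use eq U in auto)
  then show "isCont (pderiv_at j f) x0"
    using r by (simp add: continuous_on_eq_continuous_at)
qed

text \<open>
  Differentiating Cauchy's formula under the integral sign shows that a partial derivative is differentiable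
  in the Frechet sense.  The coefficient \<open>c k\<close> is the Cauchy integral of the derivative in direction \<open>k\<close>, and
  therefore the derivative in direction \<open>j\<close> of the latter; this is the symmetry of second derivatives.
\<close>

lemma pderiv_at_has_derivative:
  fixes U :: "(complex ^ 'n::finite) set"
  assumes U: "open U" "\<And>y. y \<in> U \<Longrightarrow> cdiff f y" and "x0 \<in> U"
  obtains c where "(pderiv_at j f has_derivative (\<lambda>v. \<Sum>k\<in>UNIV. v $ k * c k)) (at x0)"
    "\<forall>k. (\<forall>y\<in>U. cdiff (pderiv_at k f) y) \<longrightarrow> c k = pderiv_at j (pderiv_at k f) x0"
proof -
  from U(1) \<open>x0 \<in> U\<close> obtain r and e :: "real \<Rightarrow> complex" where r: "0 < r"
    and e: "continuous_on UNIV e" "\<forall>\<theta>. e \<theta> \<noteq> 0"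
    "\<forall>x\<in>ball x0 r. \<forall>\<theta>. x + e \<theta> *s axis j 1 \<in> U"
    and eq: "\<forall>g x. (\<forall>y\<in>U. cdiff g y) \<longrightarrow> x \<in> ball x0 r \<longrightarrow>
       pderiv_at j g x = integral (cbox 0 1) (\<lambda>\<theta>. g (x + e \<theta> *s axis j 1) / e \<theta>)"
    by (rule local_cauchy_formula[where j = j])
  note e = e(1) e(2)[rule_format] e(3)[rule_format]
  define D where "D = (\<lambda>x \<theta>. coord_blinfun (\<lambda>k. pderiv_at k f (x + e \<theta> *s axis j 1) / e \<theta>))"
  define c where "c = (\<lambda>k. integral (cbox 0 1) (\<lambda>\<theta>. pderiv_at k f (x0 + e \<theta> *s axis j 1) / e \<theta>))"
  have x0: "x0 \<in> ball x0 r" using r by simp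
  have contf: "continuous_on U f" using U cdiff_continuous by (auto intro: continuous_at_imp_continuous_on)
  have cont1: "continuous_on T (\<lambda>\<theta>. g (x + e \<theta> *s axis j 1) / e \<theta>)"
    if "continuous_on U g" "x \<in> ball x0 r" for g :: "complex ^ 'n \<Rightarrow> complex" and x and T :: "real set"
  proof -
    have k: "continuous_on (ball x0 r \<times> T) (\<lambda>z. g (fst z + e (snd z) *s axis j 1) / e (snd z))"
      by (rule continuous_on_cauchy_kernel[OF that(1) e])
    have "continuous_on T (\<lambda>\<theta>. g (fst (x, \<theta>) + e (snd (x, \<theta>)) *s axis j 1) / e (snd (x, \<theta>)))"
      by (rule continuous_on_compose2[OF k]) (use that(2) in \<open>auto intro!: continuous_intros\<close>)
    then show ?thesis by simp
  qed
  have contD: "continuous_on (ball x0 r \<times> T) (\<lambda>(x, t). D x t)" for T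
    unfolding case_prod_unfold D_def
    by (rule continuous_on_blinfun_componentwise, unfold coord_blinfun_apply)
       (intro continuous_on_sum continuous_on_mult continuous_on_const
          continuous_on_cauchy_kernel[OF pderiv_at_continuous[OF U] e])
  have "((\<lambda>x. integral (cbox 0 1) (\<lambda>\<theta>. f (x + e \<theta> *s axis j 1) / e \<theta>)) has_derivative
      blinfun_apply (integral (cbox 0 1) (D x0))) (at x0 within ball x0 r)"
  proof (rule leibniz_rule[OF _ _ contD x0 convex_ball])
    fix x t assume x: "x \<in> ball x0 r"
    show "((\<lambda>x. f (x + e t *s axis j 1) / e t) has_derivative blinfun_apply (D x t)) (at x within ball x0 r)"
    proof -
      have "((\<lambda>x. f (x + e t *s axis j 1)) has_derivative
          (\<lambda>v. \<Sum>k\<in>UNIV. v $ k * pderiv_at k f (x + e t *s axis j 1))) (at x)"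
        by (rule has_derivative_compose[where f = "\<lambda>x. x + e t *s axis j 1" and x = x and s = UNIV and g = f
            and f' = "\<lambda>h. h",
            OF _ cdiff_has_derivative[OF U(2)[OF e(3)[OF x]]]])
           (auto intro!: derivative_eq_intros)
      from has_derivative_divide'[OF this has_derivative_const, of "e t"] e(2)[of t]
      have "((\<lambda>x. f (x + e t *s axis j 1) / e t) has_derivative blinfun_apply (D x t)) (at x)"
        by (simp add: D_def coord_blinfun_apply sum_divide_distrib[symmetric] power2_eq_square)
           (simp add: sum_divide_distrib coord_blinfun_eta)
      then show ?thesis by (rule has_derivative_at_withinI)
    qed
  next
    fix x assume "x \<in> ball x0 r"
    then show "(\<lambda>\<theta>. f (x + e \<theta> *s axis j 1) / e \<theta>) integrable_on cbox 0 1"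
      by (intro integrable_continuous cont1 contf)
  qed
  then have "((\<lambda>x. integral (cbox 0 1) (\<lambda>\<theta>. f (x + e \<theta> *s axis j 1) / e \<theta>)) has_derivative
      blinfun_apply (integral (cbox 0 1) (D x0))) (at x0)"
    using at_within_open[OF x0 open_ball] by simp
  then have h1: "(pderiv_at j f has_derivative blinfun_apply (integral (cbox 0 1) (D x0))) (at x0)"
    by (rule has_derivative_transform_within_open[OF _ open_ball x0]) (use eq U in auto)
  have h2: "blinfun_apply (integral (cbox 0 1) (D x0)) = (\<lambda>v. \<Sum>k\<in>UNIV. v $ k * c k)"
  proof
    fix v
    have "continuous_on (cbox 0 1) (\<lambda>t. (\<lambda>(x, t). D x t) (x0, t))"
      by (rule continuous_on_compose2[OF contD[of UNIV]]) (use x0 in \<open>auto intro!: continuous_intros\<close>)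
    then have i: "D x0 integrable_on cbox 0 1" by (intro integrable_continuous) simp
    have ik: "(\<lambda>\<theta>. pderiv_at k f (x0 + e \<theta> *s axis j 1) / e \<theta>) integrable_on cbox 0 1" for k
      by (intro integrable_continuous cont1 x0 pderiv_at_continuous U)
    have ik2: "(\<lambda>\<theta>. v $ k * (pderiv_at k f (x0 + e \<theta> *s axis j 1) / e \<theta>)) integrable_on cbox 0 1" for k
      by (rule integrable_on_mult_right) (rule ik)
    have "integral (cbox 0 1) ((\<lambda>B. blinfun_apply B v) \<circ> D x0) = blinfun_apply (integral (cbox 0 1) (D x0)) v"
      by (rule integral_linear[OF i]) (rule blinfun.bounded_linear_left)
    then have "blinfun_apply (integral (cbox 0 1) (D x0)) v =
       integral (cbox 0 1) (\<lambda>\<theta>. \<Sum>k\<in>UNIV. v $ k * (pderiv_at k f (x0 + e \<theta> *s axis j 1) / e \<theta>))"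
      by (simp add: o_def D_def)
    also have "\<dots> = (\<Sum>k\<in>UNIV. integral (cbox 0 1) (\<lambda>\<theta>. v $ k * (pderiv_at k f (x0 + e \<theta> *s axis j 1) / e \<theta>)))"
      by (rule integral_sum) (simp_all only: finite ik2)
    finally show "blinfun_apply (integral (cbox 0 1) (D x0)) v = (\<Sum>k\<in>UNIV. v $ k * c k)"
      unfolding c_def by (simp only: integral_mult_right)
  qed
  have "(pderiv_at j f has_derivative (\<lambda>v. \<Sum>k\<in>UNIV. v $ k * c k)) (at x0)"
    by (rule has_derivative_eq_rhs[OF h1 h2])
  moreover have "c k = pderiv_at j (pderiv_at k f) x0" if "\<forall>y\<in>U. cdiff (pderiv_at k f) y" for k
    unfolding c_def by (rule eq[rule_format, symmetric]) (use that x0 in auto)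
  ultimately show ?thesis using that[of c] by blast
qed

lemma cdiff_pderiv:
  assumes U: "open U" "\<And>y. y \<in> U \<Longrightarrow> cdiff f y" and "x \<in> U"
  shows "cdiff (pderiv_at j f) x"
proof -
  obtain c where "(pderiv_at j f has_derivative (\<lambda>v. \<Sum>k\<in>UNIV. v $ k * c k)) (at x)"
    by (rule pderiv_at_has_derivative[OF assms, where j = j])
  then show ?thesis by (rule cdiffI) (simp add: sum_distrib_left mult.assoc)
qed

lemma pderiv_commute:
  assumes U: "open U" "\<And>y. y \<in> U \<Longrightarrow> cdiff f y" and "x \<in> U"
  shows "pderiv_at i (pderiv_at j f) x = pderiv_at j (pderiv_at i f) x"
proof -
  obtain c where c: "(pderiv_at j f has_derivative (\<lambda>v. \<Sum>k\<in>UNIV. v $ k * c k)) (at x)"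
      "\<forall>k. (\<forall>y\<in>U. cdiff (pderiv_at k f) y) \<longrightarrow> c k = pderiv_at j (pderiv_at k f) x"
    by (rule pderiv_at_has_derivative[OF assms, where j = j])
  have "pderiv_at i (pderiv_at j f) x = (\<Sum>k\<in>UNIV. axis i 1 $ k * c k)"
    using pderiv_at_eq[OF c(1)] by (simp add: sum_distrib_left mult.assoc)
  also have "\<dots> = c i" by (simp add: axis_def if_distrib[of "\<lambda>z. z * _"] cong: if_cong)
  finally show ?thesis using c(2) cdiff_pderiv[OF U] by simp
qed

section \<open>Multi-index derivatives and toric equations\<close>

lemma pderiv_iter_cong:
  assumes "open U" "\<And>x. x \<in> U \<Longrightarrow> f x = g x" "x \<in> U"
  shows "(pderiv_at j ^^ n) f x = (pderiv_at j ^^ n) g x"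
  using assms(3)
proof (induction n arbitrary: x)
  case (Suc n)
  then show ?case using pderiv_at_cong[OF assms(1) Suc.prems Suc.IH] by simp
qed (use assms in simp)

lemma cdiff_pderiv_iter:
  assumes "open U" "\<And>x. x \<in> U \<Longrightarrow> cdiff f x" "x \<in> U"
  shows "cdiff ((pderiv_at j ^^ n) f) x"
  using assms(3)
  by (induction n arbitrary: x) (use assms(2) cdiff_pderiv[OF assms(1)] in auto)

lemma pderiv_iter_commute:
  assumes "open U" "\<And>x. x \<in> U \<Longrightarrow> cdiff f x" "x \<in> U"
  shows "pderiv_at k ((pderiv_at j ^^ n) f) x = (pderiv_at j ^^ n) (pderiv_at k f) x"
  using assms(3)
proof (induction n arbitrary: x)
  case (Suc n)
  have "pderiv_at k ((pderiv_at j ^^ Suc n) f) x = pderiv_at j (pderiv_at k ((pderiv_at j ^^ n) f)) x"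
    using pderiv_commute[OF assms(1) _ Suc.prems] cdiff_pderiv_iter[OF assms(1,2)] by simp
  also have "\<dots> = pderiv_at j ((pderiv_at j ^^ n) (pderiv_at k f)) x"
    by (rule pderiv_at_cong[OF assms(1) Suc.prems Suc.IH])
  finally show ?case by simp
qed simp

lemma enumeration_properties:
  defines "js \<equiv> (SOME js. distinct js \<and> set js = (UNIV :: 'n::finite set))"
  shows "distinct js" "set js = UNIV"
proof -
  have "\<exists>js. distinct js \<and> set js = (UNIV :: 'n set)"
    using finite_distinct_list[OF finite, of UNIV] by blast
  from someI_ex[OF this] show "distinct js" "set js = UNIV" by (simp_all add: js_def)
qed

lemma multi_pderiv_0 [simp]: "multi_pderiv (\<lambda>_. 0) f = f"
proof -
  have "foldr (\<lambda>j. pderiv_at j ^^ 0) js f = f" for js by (induction js) auto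
  then show ?thesis by (simp add: multi_pderiv_def)
qed

lemma foldr_pderiv_cdiff:
  assumes "open U" "\<And>x. x \<in> U \<Longrightarrow> cdiff f x" "x \<in> U"
  shows "cdiff (foldr (\<lambda>j. pderiv_at j ^^ u j) js f) x"
  using assms(3)
  by (induction js arbitrary: x) (auto intro: cdiff_pderiv_iter[OF assms(1)] assms(2))

lemma foldr_pderiv_Suc:
  assumes "open U" "\<And>x. x \<in> U \<Longrightarrow> cdiff f x" "x \<in> U" "distinct js" "k \<in> set js"
  shows "foldr (\<lambda>j. pderiv_at j ^^ (u(k := Suc (u k))) j) js f x
       = pderiv_at k (foldr (\<lambda>j. pderiv_at j ^^ u j) js f) x"
  using assms(3,4,5)
proof (induction js arbitrary: x)
  case (Cons j js)
  let ?F = "\<lambda>u. foldr (\<lambda>j. pderiv_at j ^^ u j) js f"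
  have same: "?F (u(k := Suc (u k))) = ?F u" if "k \<notin> set js"
    using that by (intro foldr_cong) auto
  show ?case
  proof (cases "k = j")
    case True
    then show ?thesis using Cons.prems same by (simp del: fun_upd_apply) simp
  next
    case False
    have "(pderiv_at j ^^ u j) (?F (u(k := Suc (u k)))) x = (pderiv_at j ^^ u j) (pderiv_at k (?F u)) x"
      by (rule pderiv_iter_cong[OF assms(1) Cons.IH]) (use Cons.prems False in auto)
    also have "\<dots> = pderiv_at k ((pderiv_at j ^^ u j) (?F u)) x"
      by (rule pderiv_iter_commute[symmetric, OF assms(1) foldr_pderiv_cdiff[OF assms(1,2)]])
         (use Cons.prems in auto)
    finally show ?thesis using False by simp
  qed
qed simp

text \<open>
  As partial derivatives commute, an additional derivative can be taken last, wherever its index stands in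
  the enumeration.
\<close>

lemma multi_pderiv_Suc:
  assumes "open U" "\<And>x. x \<in> U \<Longrightarrow> cdiff f x" "x \<in> U"
  shows "multi_pderiv (u(k := Suc (u k))) f x = pderiv_at k (multi_pderiv u f) x"
  unfolding multi_pderiv_def
  by (rule foldr_pderiv_Suc[OF assms]) (simp_all add: enumeration_properties)

text \<open>
  If the derivative in direction \<open>k\<close> takes the member of degree \<open>e\<close> to the member of degree \<open>e + a k\<close>, then a
  multi-index derivative depends on the multi-index through its degree only.  The predicate \<open>Q\<close> stands for
  the degrees that can be reached; the others need not carry a sensible function.
\<close>

lemma multi_pderiv_family:
  fixes a :: "'n::finite \<Rightarrow> 'd \<Rightarrow> nat" and \<Psi> :: "('d \<Rightarrow> nat) \<Rightarrow> complex ^ 'n \<Rightarrow> complex"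
  assumes "open U"
    and Q: "\<And>e k. Q e \<Longrightarrow> Q (\<lambda>i. e i + a k i)"
    and step: "\<And>e k x. Q e \<Longrightarrow> x \<in> U \<Longrightarrow> pderiv_at k (\<Psi> e) x = \<Psi> (\<lambda>i. e i + a k i) x"
    and "Q (\<lambda>_. 0)" and f: "\<And>x. x \<in> U \<Longrightarrow> f x = \<Psi> (\<lambda>_. 0) x" and "x \<in> U"
  shows "multi_pderiv u f x = \<Psi> (\<lambda>i. \<Sum>k\<in>UNIV. u k * a k i) x"
proof -
  have iter: "Q (\<lambda>i. e i + n * a k i) \<and> (\<forall>x\<in>U. (pderiv_at k ^^ n) g x = \<Psi> (\<lambda>i. e i + n * a k i) x)"
    if "Q e" "\<forall>x\<in>U. g x = \<Psi> e x" for e g k n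
  proof (induction n)
    case (Suc n)
    have e: "(\<lambda>i. (e i + n * a k i) + a k i) = (\<lambda>i. e i + Suc n * a k i)" by (auto simp: algebra_simps)
    have "(pderiv_at k ^^ Suc n) g x = \<Psi> (\<lambda>i. e i + Suc n * a k i) x" if "x \<in> U" for x
    proof -
      have "(pderiv_at k ^^ Suc n) g x = pderiv_at k (\<Psi> (\<lambda>i. e i + n * a k i)) x"
        using pderiv_at_cong[OF assms(1) that, of "(pderiv_at k ^^ n) g"] Suc by simp
      then show ?thesis using step[of "\<lambda>i. e i + n * a k i" x k] Suc that unfolding e by simp
    qed
    moreover have "Q (\<lambda>i. e i + Suc n * a k i)" using Q[of "\<lambda>i. e i + n * a k i" k] Suc unfolding e by simp
    ultimately show ?case by blast
  qed (use that in auto)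
  have "Q (\<lambda>i. \<Sum>k\<leftarrow>js. u k * a k i) \<and>
      (\<forall>x\<in>U. foldr (\<lambda>j. pderiv_at j ^^ u j) js f x = \<Psi> (\<lambda>i. \<Sum>k\<leftarrow>js. u k * a k i) x)" for js
  proof (induction js)
    case (Cons k js)
    have e: "(\<lambda>i. (\<Sum>k\<leftarrow>js. u k * a k i) + u k * a k i) = (\<lambda>i. \<Sum>k\<leftarrow>k # js. u k * a k i)"
      by (auto simp: algebra_simps)
    show ?case using iter[where e = "\<lambda>i. \<Sum>k\<leftarrow>js. u k * a k i" and k = k and n = "u k", OF conjunct1[OF Cons.IH] conjunct2[OF Cons.IH]]
      unfolding e by simp
  qed (use assms in auto)
  then have "multi_pderiv u f x = \<Psi> (\<lambda>i. \<Sum>k\<leftarrow>(SOME js. distinct js \<and> set js = UNIV). u k * a k i) x"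
    using \<open>x \<in> U\<close> by (simp add: multi_pderiv_def)
  then show ?thesis
    using enumeration_properties[where 'n = 'n] by (simp add: sum_list_distinct_conv_sum_set)
qed

text \<open>
  The positive and the negative part of a vector in the kernel have the same degree.
\<close>

lemma toric_equation_family:
  fixes A :: "int ^ 'n::finite ^ 'd::finite" and \<Psi> :: "('d \<Rightarrow> nat) \<Rightarrow> complex ^ 'n \<Rightarrow> complex"
  assumes A: "\<And>i k. A $ i $ k \<ge> 0" and "open U"
    and Q: "\<And>e k. Q e \<Longrightarrow> Q (\<lambda>i. e i + nat (A $ i $ k))"
    and step: "\<And>e k x. Q e \<Longrightarrow> x \<in> U \<Longrightarrow> pderiv_at k (\<Psi> e) x = \<Psi> (\<lambda>i. e i + nat (A $ i $ k)) x"
    and "Q (\<lambda>_. 0)" and f: "\<And>x. x \<in> U \<Longrightarrow> f x = \<Psi> (\<lambda>_. 0) x" and "x \<in> U" and "u \<in> ker_int A"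
  shows "multi_pderiv (pos_part u) f x = multi_pderiv (neg_part u) f x"
proof -
  note m = multi_pderiv_family[of U Q "\<lambda>k i. nat (A $ i $ k)" \<Psi> f x, OF assms(2) Q step assms(5,6,7)]
  have "(\<Sum>k\<in>UNIV. pos_part u k * nat (A $ i $ k)) = (\<Sum>k\<in>UNIV. neg_part u k * nat (A $ i $ k))" for i
  proof -
    have "(\<Sum>k\<in>UNIV. A $ i $ k * u $ k) = 0"
      using \<open>u \<in> ker_int A\<close> by (simp add: ker_int_def vec_eq_iff matrix_vector_mult_def)
    moreover have "A $ i $ k * u $ k = int (pos_part u k * nat (A $ i $ k)) - int (neg_part u k * nat (A $ i $ k))" for k
      using A[of i k] by (auto simp: pos_part_def neg_part_def)
    ultimately have "int (\<Sum>k\<in>UNIV. pos_part u k * nat (A $ i $ k)) = int (\<Sum>k\<in>UNIV. neg_part u k * nat (A $ i $ k))"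
      by (simp add: sum_subtractf del: of_nat_mult)
    then show ?thesis by linarith
  qed
  then show ?thesis by (simp add: m)
qed

text \<open>
  With \<open>e\<close> for the unit vector at \<open>d0\<close>, the indices \<open>Inl d0\<close> and \<open>Inr d0\<close> stand for the columns \<open>2e\<close> and \<open>3e\<close>.
  For \<open>j \<noteq> d0\<close> the indices \<open>Inl j\<close> and \<open>Inr j\<close> stand for \<open>e\<^sub>j\<close> and \<open>e + e\<^sub>j\<close>.  In comments the variables with
  the indices \<open>Inl d0\<close>, \<open>Inr d0\<close>, \<open>Inl j\<close>, \<open>Inr j\<close> are called \<open>x\<close>, \<open>y\<close>, \<open>z\<^sub>j\<close>, \<open>w\<^sub>j\<close>.
\<close>

definition hole_matrix :: "'d::finite \<Rightarrow> int ^ ('d + 'd) ^ 'd" where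
  "hole_matrix d0 = (\<chi> i k. case k of
      Inl j \<Rightarrow> (if j = i then (if j = d0 then 2 else 1) else 0)
    | Inr j \<Rightarrow> (if j = i then (if j = d0 then 3 else 1) else if i = d0 then 1 else 0))"

lemma hole_matrix_Inl: "hole_matrix d0 $ i $ Inl j = (if j = i then (if j = d0 then 2 else 1) else 0)"
  and hole_matrix_Inr: "hole_matrix d0 $ i $ Inr j =
    (if j = i then (if j = d0 then 3 else 1) else if i = d0 then 1 else 0)"
  by (simp_all add: hole_matrix_def)

text \<open>
  A family as above for a function that involves only \<open>x\<close>, \<open>y\<close> and one pair \<open>z\<^sub>j\<close>, \<open>w\<^sub>j\<close>.  The function \<open>T m\<close>
  belongs to the degree \<open>m e\<close>, and \<open>R m\<close> to \<open>m e + e\<^sub>j\<close>; in degree \<open>m e + n e\<^sub>j\<close> with \<open>n > 1\<close> the member is an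
  iterated derivative of \<open>R m\<close> in \<open>z\<^sub>j\<close>.  The degree \<open>e\<close> is the hole of the semigroup, so \<open>T 1\<close> is arbitrary.
\<close>

lemma toric_tower:
  fixes T R :: "nat \<Rightarrow> complex ^ ('d::finite + 'd) \<Rightarrow> complex" and d0 j :: 'd
  assumes "open U" "j \<noteq> d0" and fT: "\<And>x. x \<in> U \<Longrightarrow> f x = T 0 x"
    and cR: "\<And>m x. x \<in> U \<Longrightarrow> cdiff (R m) x"
    and T: "\<And>m x. m \<noteq> 1 \<Longrightarrow> x \<in> U \<Longrightarrow> pderiv_at (Inl d0) (T m) x = T (m + 2) x"
      "\<And>m x. m \<noteq> 1 \<Longrightarrow> x \<in> U \<Longrightarrow> pderiv_at (Inr d0) (T m) x = T (m + 3) x"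
      "\<And>m x. m \<noteq> 1 \<Longrightarrow> x \<in> U \<Longrightarrow> pderiv_at (Inl j) (T m) x = R m x"
      "\<And>m x. m \<noteq> 1 \<Longrightarrow> x \<in> U \<Longrightarrow> pderiv_at (Inr j) (T m) x = R (m + 1) x"
      "\<And>m x i. m \<noteq> 1 \<Longrightarrow> x \<in> U \<Longrightarrow> i \<noteq> d0 \<Longrightarrow> i \<noteq> j \<Longrightarrow> pderiv_at (Inl i) (T m) x = 0"
      "\<And>m x i. m \<noteq> 1 \<Longrightarrow> x \<in> U \<Longrightarrow> i \<noteq> d0 \<Longrightarrow> i \<noteq> j \<Longrightarrow> pderiv_at (Inr i) (T m) x = 0"
    and R: "\<And>m x. x \<in> U \<Longrightarrow> pderiv_at (Inl d0) (R m) x = R (m + 2) x"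
      "\<And>m x. x \<in> U \<Longrightarrow> pderiv_at (Inr d0) (R m) x = R (m + 3) x"
      "\<And>m x. x \<in> U \<Longrightarrow> pderiv_at (Inr j) (R m) x = pderiv_at (Inl j) (R (m + 1)) x"
      "\<And>m x i. x \<in> U \<Longrightarrow> i \<noteq> d0 \<Longrightarrow> i \<noteq> j \<Longrightarrow> pderiv_at (Inl i) (R m) x = 0"
      "\<And>m x i. x \<in> U \<Longrightarrow> i \<noteq> d0 \<Longrightarrow> i \<noteq> j \<Longrightarrow> pderiv_at (Inr i) (R m) x = 0"
    and x: "x \<in> U" and u: "u \<in> ker_int (hole_matrix d0)"
  shows "multi_pderiv (pos_part u) f x = multi_pderiv (neg_part u) f x"
proof -
  let ?Z = "pderiv_at (Inl j) :: (complex ^ ('d + 'd) \<Rightarrow> complex) \<Rightarrow> _"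
  \<comment> \<open>the hole is the one degree that no derivative reaches\<close>
  define Q :: "('d \<Rightarrow> nat) \<Rightarrow> bool" where "Q = (\<lambda>e. \<not> (e d0 = 1 \<and> (\<forall>i. i \<noteq> d0 \<longrightarrow> e i = 0)))"
  define \<Psi> :: "('d \<Rightarrow> nat) \<Rightarrow> complex ^ ('d + 'd) \<Rightarrow> complex" where
    "\<Psi> = (\<lambda>e. if \<exists>i. i \<noteq> d0 \<and> i \<noteq> j \<and> e i \<noteq> 0 then (\<lambda>_. 0)
        else if e j = 0 then T (e d0) else (?Z ^^ (e j - 1)) (R (e d0)))"
  have "?Z (\<lambda>_. 0) = (\<lambda>_::complex ^ ('d + 'd). 0)" by auto
  then have iter0: "(?Z ^^ n) (\<lambda>_. 0) = (\<lambda>_::complex ^ ('d + 'd). 0)" for n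
    by (induction n) auto
  have commR: "pderiv_at k ((?Z ^^ n) (R m)) x = (?Z ^^ n) g x"
    if "x \<in> U" "\<And>y. y \<in> U \<Longrightarrow> pderiv_at k (R m) y = g y" for k n m g x
    using pderiv_iter_commute[OF \<open>open U\<close> cR that(1)] pderiv_iter_cong[OF \<open>open U\<close> that(2,1)] by simp
  have Qstep: "Q (\<lambda>i. e i + nat (hole_matrix d0 $ i $ k))" if Q: "Q e" for e k
  proof (cases k)
    case (Inl i)
    then show ?thesis
      using Q by (cases "i = d0") (auto simp: Q_def hole_matrix_Inl)
  next
    case (Inr i)
    then show ?thesis
      using Q by (cases "i = d0") (auto simp: Q_def hole_matrix_Inr)
  qed
  have step: "pderiv_at k (\<Psi> e) x = \<Psi> (\<lambda>i. e i + nat (hole_matrix d0 $ i $ k)) x" if Q: "Q e" and x: "x \<in> U" for e k x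
  proof (cases "\<exists>i. i \<noteq> d0 \<and> i \<noteq> j \<and> e i \<noteq> 0")
    case True
    then have "\<exists>i. i \<noteq> d0 \<and> i \<noteq> j \<and> e i + nat (hole_matrix d0 $ i $ k) \<noteq> 0" by auto
    then have "\<Psi> (\<lambda>i. e i + nat (hole_matrix d0 $ i $ k)) = (\<lambda>_. 0)" unfolding \<Psi>_def by (rule if_P)
    moreover have "\<Psi> e = (\<lambda>_. 0)" using True unfolding \<Psi>_def by (rule if_P)
    ultimately show ?thesis by simp
  next
    case False
    then have m: "e j = 0 \<Longrightarrow> e d0 \<noteq> 1" using Q by (auto simp: Q_def)
    let ?e = "\<lambda>i. e i + nat (hole_matrix d0 $ i $ k)"
    have \<Psi>e: "\<Psi> e = (if e j = 0 then T (e d0) else (?Z ^^ (e j - 1)) (R (e d0)))"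
      using False by (auto simp: \<Psi>_def)
    consider "k = Inl d0" | "k = Inr d0" | "k = Inl j" | "k = Inr j"
      | "\<exists>i. i \<noteq> d0 \<and> i \<noteq> j \<and> (k = Inl i \<or> k = Inr i)"
      by (cases k) auto
    then show ?thesis
    proof cases
      case 1
      then have "\<Psi> ?e =
          (if e j = 0 then T (e d0 + 2) else (?Z ^^ (e j - 1)) (R (e d0 + 2)))"
        using False \<open>j \<noteq> d0\<close> by (auto simp: \<Psi>_def hole_matrix_Inl)
      then show ?thesis using 1 T(1)[OF m x] commR[OF x R(1)] by (auto simp: \<Psi>e)
    next
      case 2
      then have "\<Psi> ?e =
          (if e j = 0 then T (e d0 + 3) else (?Z ^^ (e j - 1)) (R (e d0 + 3)))"
        using False \<open>j \<noteq> d0\<close> by (auto simp: \<Psi>_def hole_matrix_Inr)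
      then show ?thesis using 2 T(2)[OF m x] commR[OF x R(2)] by (auto simp: \<Psi>e)
    next
      case 3
      then have "\<Psi> ?e = (?Z ^^ (e j)) (R (e d0))"
        using False \<open>j \<noteq> d0\<close> by (auto simp: \<Psi>_def hole_matrix_Inl)
      then show ?thesis using 3 T(3)[OF m x] by (cases "e j") (auto simp: \<Psi>e)
    next
      case 4
      then have "\<Psi> ?e = (?Z ^^ (e j)) (R (e d0 + 1))"
        using False \<open>j \<noteq> d0\<close> by (auto simp: \<Psi>_def hole_matrix_Inr)
      moreover have "pderiv_at (Inr j) ((?Z ^^ (e j - 1)) (R (e d0))) x
          = (?Z ^^ (Suc (e j - 1))) (R (e d0 + 1)) x"
        using commR[OF x R(3)] by (simp add: funpow_swap1)
      ultimately show ?thesis using 4 T(4)[OF m x] by (cases "e j") (auto simp: \<Psi>e)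
    next
      case 5
      then obtain i where i: "i \<noteq> d0" "i \<noteq> j" "k = Inl i \<or> k = Inr i" by blast
      have h1: "\<Psi> ?e = (\<lambda>_. 0)"
      proof -
        have "hole_matrix d0 $ i $ k = 1" using i by (auto simp: hole_matrix_Inl hole_matrix_Inr)
        then have "\<exists>i. i \<noteq> d0 \<and> i \<noteq> j \<and> e i + nat (hole_matrix d0 $ i $ k) \<noteq> 0"
          using i by (intro exI[of _ i]) simp
        then show ?thesis unfolding \<Psi>_def by (rule if_P)
      qed
      have h2: "pderiv_at k (\<Psi> e) x = 0"
      proof (cases "e j = 0")
        case True
        have "pderiv_at k (T (e d0)) x = 0" using i T(5,6)[OF m[OF True] x i(1,2)] by blast
        then show ?thesis using True by (simp only: \<Psi>e if_True simp_thms)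
      next
        case False
        have "pderiv_at k (R m) y = 0" if "y \<in> U" for m y using i R(4,5)[OF that i(1,2)] by blast
        then have "pderiv_at k ((?Z ^^ (e j - 1)) (R (e d0))) x = (?Z ^^ (e j - 1)) (\<lambda>_. 0) x"
          by (rule commR[OF x])
        then show ?thesis using False by (simp only: \<Psi>e iter0 if_False simp_thms)
      qed
      show ?thesis by (rule trans[OF h2 sym[OF fun_cong[OF h1]]])
    qed
  qed
  show ?thesis
  proof (rule toric_equation_family[where Q = Q and \<Psi> = \<Psi> and A = "hole_matrix d0" and U = U])
    show "Q (\<lambda>i. e i + nat (hole_matrix d0 $ i $ k))" if "Q e" for e k by (rule Qstep[OF that])
    show "pderiv_at k (\<Psi> e) x = \<Psi> (\<lambda>i. e i + nat (hole_matrix d0 $ i $ k)) x" if "Q e" "x \<in> U" for e k x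
      by (rule step[OF that])
    show "hole_matrix d0 $ i $ k \<ge> 0" for i k by (cases k) (auto simp: hole_matrix_Inl hole_matrix_Inr)
  qed (use x u \<open>open U\<close> in \<open>auto simp: Q_def \<Psi>_def fT\<close>)
qed

section \<open>Integrals of the exponential of a cubic\<close>

text \<open>
  Substituting \<open>\<sigma> = s t\<close> in the integral of \<open>\<sigma>\<^sup>k exp (x \<sigma>\<^sup>2 + y \<sigma>\<^sup>3)\<close> from \<open>0\<close> to \<open>s\<close> leads to a fixed interval of
  integration and to the parameters \<open>\<alpha> = x s\<^sup>2\<close> and \<open>\<beta> = y s\<^sup>3\<close>.
\<close>

definition exp_moment :: "nat \<Rightarrow> complex \<Rightarrow> complex \<Rightarrow> complex" where
  "exp_moment k \<alpha> \<beta> = integral (cbox 0 1) (\<lambda>t. of_real t ^ k * exp (\<alpha> * of_real t ^ 2 + \<beta> * of_real t ^ 3))"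

lemma exp_moment_integrand_integrable:
  "(\<lambda>t::real. of_real t ^ k * exp (\<alpha> * of_real t ^ 2 + \<beta> * of_real t ^ 3 :: complex)) integrable_on cbox 0 1"
  by (intro integrable_continuous continuous_intros)

definition pair_blinfun :: "complex \<Rightarrow> complex \<Rightarrow> (complex \<times> complex) \<Rightarrow>\<^sub>L complex" where
  "pair_blinfun c d = Blinfun (\<lambda>h. c * fst h + d * snd h)"

lemma pair_blinfun_apply [simp]: "blinfun_apply (pair_blinfun c d) h = c * fst h + d * snd h"
proof -
  have "bounded_linear (\<lambda>h::complex \<times> complex. c * fst h + d * snd h)"
    by (intro bounded_linear_add bounded_linear_const_mult bounded_linear_fst bounded_linear_snd)
  then show ?thesis by (simp add: pair_blinfun_def bounded_linear_Blinfun_apply)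
qed

lemma exp_moment_has_derivative:
  "((\<lambda>z. exp_moment k (fst z) (snd z)) has_derivative
     (\<lambda>h. exp_moment (k + 2) \<alpha> \<beta> * fst h + exp_moment (k + 3) \<alpha> \<beta> * snd h)) (at (\<alpha>, \<beta>))"
proof -
  define E :: "complex \<times> complex \<Rightarrow> real \<Rightarrow> complex" where
    "E = (\<lambda>z t. exp (fst z * of_real t ^ 2 + snd z * of_real t ^ 3))"
  define D where "D = (\<lambda>z t. pair_blinfun (of_real t ^ (k + 2) * E z t) (of_real t ^ (k + 3) * E z t))"
  have contD: "continuous_on (UNIV \<times> cbox 0 1) (\<lambda>(z, t). D z t)"
    unfolding case_prod_unfold D_def E_def
    by (rule continuous_on_blinfun_componentwise, unfold pair_blinfun_apply) (intro continuous_intros)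
  have der: "((\<lambda>z. of_real t ^ k * E z t) has_derivative blinfun_apply (D z t)) (at z within UNIV)" for z t
  proof -
    have "((\<lambda>z. fst z * of_real t ^ 2 + snd z * of_real t ^ 3) has_derivative
        (\<lambda>h. fst h * of_real t ^ 2 + snd h * of_real t ^ 3 :: complex)) (at z)"
      by (auto intro!: derivative_eq_intros)
    from has_derivative_mult_right[OF has_derivative_compose[OF this DERIV_exp[unfolded has_field_derivative_def]],
        of "of_real t ^ k"]
    show ?thesis unfolding E_def by (rule has_derivative_eq_rhs)
      (auto simp: fun_eq_iff D_def E_def algebra_simps power_add power2_eq_square power3_eq_cube)
  qed
  have "((\<lambda>z. integral (cbox 0 1) (\<lambda>t. of_real t ^ k * E z t)) has_derivative
      blinfun_apply (integral (cbox 0 1) (D (\<alpha>, \<beta>)))) (at (\<alpha>, \<beta>) within UNIV)"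
    by (rule leibniz_rule[OF der _ contD])
       (auto simp: E_def intro!: integrable_continuous_real continuous_intros)
  moreover have "blinfun_apply (integral (cbox 0 1) (D (\<alpha>, \<beta>))) h = exp_moment (k + 2) \<alpha> \<beta> * fst h + exp_moment (k + 3) \<alpha> \<beta> * snd h" for h
  proof -
    have "continuous_on (cbox 0 1) (\<lambda>t. (\<lambda>(x, t). D x t) ((\<alpha>, \<beta>), t))"
      by (rule continuous_on_compose2[OF contD]) (auto intro!: continuous_intros)
    then have i: "D (\<alpha>, \<beta>) integrable_on cbox 0 1" by (intro integrable_continuous) simp
    have "integral (cbox 0 1) ((\<lambda>B. blinfun_apply B h) \<circ> D (\<alpha>, \<beta>)) = blinfun_apply (integral (cbox 0 1) (D (\<alpha>, \<beta>))) h"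
      by (rule integral_linear[OF i]) (rule blinfun.bounded_linear_left)
    then have "blinfun_apply (integral (cbox 0 1) (D (\<alpha>, \<beta>))) h = integral (cbox 0 1) (\<lambda>t.
       (of_real t ^ (k + 2) * exp (\<alpha> * of_real t ^ 2 + \<beta> * of_real t ^ 3)) * fst h
       + (of_real t ^ (k + 3) * exp (\<alpha> * of_real t ^ 2 + \<beta> * of_real t ^ 3)) * snd h)"
      by (simp only: o_def D_def E_def pair_blinfun_apply fst_conv snd_conv)
    also have "\<dots> = integral (cbox 0 1) (\<lambda>t.
       (of_real t ^ (k + 2) * exp (\<alpha> * of_real t ^ 2 + \<beta> * of_real t ^ 3)) * fst h)
       + integral (cbox 0 1) (\<lambda>t. (of_real t ^ (k + 3) * exp (\<alpha> * of_real t ^ 2 + \<beta> * of_real t ^ 3)) * snd h)"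
      by (intro integral_add integrable_on_mult_left exp_moment_integrand_integrable)
    finally show ?thesis by (simp only: integral_mult_left exp_moment_def)
  qed
  then have "blinfun_apply (integral (cbox 0 1) (D (\<alpha>, \<beta>))) = (\<lambda>h. exp_moment (k + 2) \<alpha> \<beta> * fst h + exp_moment (k + 3) \<alpha> \<beta> * snd h)"
    by (rule ext)
  ultimately show ?thesis unfolding exp_moment_def[of k] E_def by (rule has_derivative_eq_rhs)
qed

lemma cdiff_exp_moment [simp]:
  assumes "cdiff a x" "cdiff b x"
  shows "cdiff (\<lambda>x. exp_moment k (a x) (b x)) x"
    and pderiv_exp_moment: "pderiv_at j (\<lambda>x. exp_moment k (a x) (b x)) x
      = exp_moment (k + 2) (a x) (b x) * pderiv_at j a x + exp_moment (k + 3) (a x) (b x) * pderiv_at j b x"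
proof -
  let ?D = "\<lambda>v. exp_moment (k + 2) (a x) (b x) * (\<Sum>j\<in>UNIV. v $ j * pderiv_at j a x)
      + exp_moment (k + 3) (a x) (b x) * (\<Sum>j\<in>UNIV. v $ j * pderiv_at j b x)"
  have "((\<lambda>x. exp_moment k (fst (a x, b x)) (snd (a x, b x))) has_derivative (\<lambda>v.
      exp_moment (k + 2) (a x) (b x) * fst (\<Sum>j\<in>UNIV. v $ j * pderiv_at j a x, \<Sum>j\<in>UNIV. v $ j * pderiv_at j b x) +
      exp_moment (k + 3) (a x) (b x) * snd (\<Sum>j\<in>UNIV. v $ j * pderiv_at j a x, \<Sum>j\<in>UNIV. v $ j * pderiv_at j b x))) (at x)"
    by (rule has_derivative_compose[OF has_derivative_Pair[OF cdiff_has_derivative[OF assms(1)]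
          cdiff_has_derivative[OF assms(2)]] exp_moment_has_derivative])
  then have D: "((\<lambda>x. exp_moment k (a x) (b x)) has_derivative ?D) (at x)" by (simp only: fst_conv snd_conv)
  have ax: "(\<Sum>i\<in>UNIV. axis j 1 $ i * c i) = c j" for c :: "'a \<Rightarrow> complex"
    by (simp add: axis_def if_distrib[of "\<lambda>z. z * _"] cong: if_cong)
  have lin: "?D (c *s v) = c * ?D v" for c v by (simp add: sum_distrib_left algebra_simps)
  show "cdiff (\<lambda>x. exp_moment k (a x) (b x)) x"
    by (rule cdiffI[OF D lin])
  show "pderiv_at j (\<lambda>x. exp_moment k (a x) (b x)) x
      = exp_moment (k + 2) (a x) (b x) * pderiv_at j a x + exp_moment (k + 3) (a x) (b x) * pderiv_at j b x"
    using pderiv_at_eq[OF D lin, of j] by (simp add: ax)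
qed

text \<open>
  The left-hand side is the integral of the derivative of \<open>t\<^sup>k\<^sup>+\<^sup>1 exp (\<alpha> t\<^sup>2 + \<beta> t\<^sup>3)\<close>.
\<close>

lemma exp_moment_by_parts: "(of_nat k + 1) * exp_moment k \<alpha> \<beta> + 2 * \<alpha> * exp_moment (k + 2) \<alpha> \<beta> + 3 * \<beta> * exp_moment (k + 3) \<alpha> \<beta> = exp (\<alpha> + \<beta>)"
proof -
  define E :: "real \<Rightarrow> complex" where "E = (\<lambda>t. exp (\<alpha> * of_real t ^ 2 + \<beta> * of_real t ^ 3))"
  have moment_E: "exp_moment m \<alpha> \<beta> = integral (cbox 0 1) (\<lambda>t. of_real t ^ m * E t)" for m by (simp add: exp_moment_def E_def)
  have i: "(\<lambda>t. c * (of_real t ^ m * E t)) integrable_on cbox 0 1" for m c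
    unfolding E_def by (intro integrable_on_mult_right exp_moment_integrand_integrable)
  have i': "(\<lambda>t. c * (of_real t ^ m * E t) + c' * (of_real t ^ m' * E t)) integrable_on cbox 0 1" for m c m' c'
    by (intro integrable_add i)
  have "((\<lambda>t. of_real t ^ (k + 1) * E t) has_vector_derivative
      ((of_nat k + 1) * (of_real t ^ k * E t) + 2 * \<alpha> * (of_real t ^ (k + 2) * E t) + 3 * \<beta> * (of_real t ^ (k + 3) * E t)))
      (at t within {0..1})" for t
  proof -
    have "((\<lambda>z. z ^ (k + 1) * exp (\<alpha> * z ^ 2 + \<beta> * z ^ 3)) has_field_derivative
      ((of_nat k + 1) * (of_real t ^ k * E t) + 2 * \<alpha> * (of_real t ^ (k + 2) * E t) + 3 * \<beta> * (of_real t ^ (k + 3) * E t)))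
      (at (of_real t))"
      unfolding E_def
      by (rule derivative_eq_intros refl | simp)+ (simp add: algebra_simps power_add power2_eq_square power3_eq_cube)
    from has_vector_derivative_real_field[OF this] show ?thesis unfolding E_def by simp
  qed
  then have "((\<lambda>t. (of_nat k + 1) * (of_real t ^ k * E t) + 2 * \<alpha> * (of_real t ^ (k + 2) * E t) + 3 * \<beta> * (of_real t ^ (k + 3) * E t))
     has_integral (of_real 1 ^ (k + 1) * E 1 - of_real 0 ^ (k + 1) * E 0)) {0..1}"
    by (intro fundamental_theorem_of_calculus) auto
  then have "integral (cbox 0 1) (\<lambda>t. (of_nat k + 1) * (of_real t ^ k * E t) + 2 * \<alpha> * (of_real t ^ (k + 2) * E t) + 3 * \<beta> * (of_real t ^ (k + 3) * E t)) = E 1"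
    by (simp add: integral_unique)
  also have "integral (cbox 0 1) (\<lambda>t. (of_nat k + 1) * (of_real t ^ k * E t) + 2 * \<alpha> * (of_real t ^ (k + 2) * E t) + 3 * \<beta> * (of_real t ^ (k + 3) * E t))
    = (of_nat k + 1) * exp_moment k \<alpha> \<beta> + 2 * \<alpha> * exp_moment (k + 2) \<alpha> \<beta> + 3 * \<beta> * exp_moment (k + 3) \<alpha> \<beta>"
    by (simp only: integral_add i i' integral_mult_right moment_E)
  finally show ?thesis by (simp add: E_def)
qed

text \<open>
  The integral of \<open>\<sigma>\<^sup>k exp (x \<sigma>\<^sup>2 + y \<sigma>\<^sup>3)\<close> along the segment from \<open>0\<close> to \<open>s\<close>.
\<close>

definition exp_integral :: "nat \<Rightarrow> complex \<Rightarrow> complex \<Rightarrow> complex \<Rightarrow> complex" where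
  "exp_integral k x y s = s ^ (k + 1) * exp_moment k (x * s ^ 2) (y * s ^ 3)"

lemma exp_integral_by_parts: "(of_nat k + 1) * exp_integral k x y s + 2 * x * exp_integral (k + 2) x y s + 3 * y * exp_integral (k + 3) x y s
    = s ^ (k + 1) * exp (x * s ^ 2 + y * s ^ 3)"
  unfolding exp_moment_by_parts[of k, symmetric] exp_integral_def
  by (simp add: algebra_simps power_add power2_eq_square power3_eq_cube power4_eq_xxxx)

lemma cdiff_exp_integral [simp]:
  assumes "cdiff a p" "cdiff b p" "cdiff s p"
  shows "cdiff (\<lambda>p. exp_integral k (a p) (b p) (s p)) p"
  unfolding exp_integral_def using assms by simp

lemma pderiv_exp_integral [simp]:
  assumes "cdiff a p" "cdiff b p" "cdiff s p"
  shows "pderiv_at j (\<lambda>p. exp_integral k (a p) (b p) (s p)) p =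
     exp_integral (k + 2) (a p) (b p) (s p) * pderiv_at j a p + exp_integral (k + 3) (a p) (b p) (s p) * pderiv_at j b p
     + s p ^ k * exp (a p * s p ^ 2 + b p * s p ^ 3) * pderiv_at j s p"
  unfolding exp_moment_by_parts[of k, symmetric] unfolding exp_integral_def
  by (simp only: pderiv_mult pderiv_power pderiv_exp_moment cdiff_mult cdiff_power cdiff_exp_moment assms
      add_diff_cancel_right' of_nat_add of_nat_1)
     (simp add: algebra_simps power_add power2_eq_square power3_eq_cube power4_eq_xxxx)

section \<open>An entire differential equation of third order\<close>

definition everywhere_summable :: "(nat \<Rightarrow> complex) \<Rightarrow> bool" where
  "everywhere_summable c \<longleftrightarrow> (\<forall>z. summable (\<lambda>n. c n * z ^ n))"

definition pow_series :: "(nat \<Rightarrow> complex) \<Rightarrow> complex \<Rightarrow> complex" where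
  "pow_series c z = (\<Sum>n. c n * z ^ n)"

lemma everywhere_summable_diffs: "everywhere_summable c \<Longrightarrow> everywhere_summable (diffs c)"
  unfolding everywhere_summable_def using termdiff_converges_all by blast

lemma pow_series_DERIV:
  "everywhere_summable c \<Longrightarrow> (pow_series c has_field_derivative pow_series (diffs c) z) (at z)"
  using termdiffs_strong_converges_everywhere[of c z]
  by (simp add: everywhere_summable_def pow_series_def[abs_def])

lemma pow_series_sums: "everywhere_summable c \<Longrightarrow> (\<lambda>n. c n * z ^ n) sums pow_series c z"
  by (simp add: everywhere_summable_def pow_series_def summable_sums)

lemma pow_series_euler_sums:
  assumes "everywhere_summable c"
  shows "(\<lambda>n. (of_nat n * c n) * z ^ n) sums (z * pow_series (diffs c) z)"
proof -
  have "(\<lambda>n. of_nat n * c n * z ^ (n - Suc 0)) sums pow_series (diffs c) z"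
    using diffs_equiv[of c z] everywhere_summable_diffs[OF assms]
    by (simp add: everywhere_summable_def pow_series_def)
  from sums_mult[OF this, of z] show ?thesis
  proof (rule sums_cong[THEN iffD1, rotated])
    fix n show "z * (of_nat n * c n * z ^ (n - Suc 0)) = of_nat n * c n * z ^ n"
      by (cases n) auto
  qed
qed

lemma pow_series_euler:
  assumes "everywhere_summable c"
  shows "everywhere_summable (\<lambda>n. of_nat n * c n)"
    and "pow_series (\<lambda>n. of_nat n * c n) z = z * pow_series (diffs c) z"
  using pow_series_euler_sums[OF assms]
  by (auto simp: everywhere_summable_def pow_series_def sums_iff)

text \<open>
  For \<open>a < 3\<close> these are the coefficients of the solution \<open>v\<^sup>a + O(v\<^sup>3)\<close> of \<open>9 g''' = 4 v\<^sup>2 g'' + 6 v g' - 2 g\<close>.  A function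
  \<open>y\<^sup>1\<^sup>/\<^sup>3 g (x y\<^sup>-\<^sup>2\<^sup>/\<^sup>3)\<close> has equal third derivative in \<open>x\<close> and second derivative in \<open>y\<close> exactly if \<open>g\<close> satisfies this equation.
\<close>

fun airy_coeff :: "nat \<Rightarrow> nat \<Rightarrow> complex" where
  "airy_coeff a n = (if n < 3 then (if n = a then 1 else 0)
     else 2 * (2 * of_nat (n - 3) - 1) / (9 * of_nat n * of_nat (n - 1)) * airy_coeff a (n - 3))"

declare airy_coeff.simps [simp del]

lemma airy_coeff_step:
  "9 * (of_nat n + 3) * (of_nat n + 2) * airy_coeff a (n + 3) = 2 * (2 * of_nat n - 1) * airy_coeff a n"
proof -
  define k where "k = 9 * of_nat (n + 3) * (of_nat (n + 2) :: complex)"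
  have "k \<noteq> 0" unfolding k_def by (simp only: mult_eq_0_iff of_nat_eq_0_iff) simp
  moreover have "airy_coeff a (n + 3) = 2 * (2 * of_nat n - 1) / k * airy_coeff a n"
    unfolding k_def by (subst airy_coeff.simps) (simp add: numeral_3_eq_3)
  ultimately have "k * airy_coeff a (n + 3) = 2 * (2 * of_nat n - 1) * airy_coeff a n" by simp
  then show ?thesis by (simp add: k_def algebra_simps)
qed

lemma airy_coeff_decay: "norm (airy_coeff a (n + 3)) \<le> norm (airy_coeff a n) / (real n + 1)"
proof -
  have p: "norm (of_nat n + 3 :: complex) = real n + 3" "norm (of_nat n + 2 :: complex) = real n + 2"
    by (metis norm_of_nat of_nat_add of_nat_numeral)+
  have "norm (2 * of_nat n - 1 :: complex) \<le> norm (2 * of_nat n :: complex) + norm (1 :: complex)"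
    by (rule norm_triangle_ineq4)
  then have q: "norm (2 * of_nat n - 1 :: complex) \<le> 2 * real n + 1" by (simp add: norm_mult)
  have "9 * (real n + 3) * (real n + 2) * norm (airy_coeff a (n + 3)) = norm (9 * (of_nat n + 3) * (of_nat n + 2) * airy_coeff a (n + 3))"
    by (simp only: norm_mult p norm_numeral)
  also have "\<dots> = 2 * norm (2 * of_nat n - 1 :: complex) * norm (airy_coeff a n)"
    unfolding airy_coeff_step by (simp only: norm_mult norm_numeral)
  also have "\<dots> \<le> 2 * (2 * real n + 1) * norm (airy_coeff a n)"
    using q by (intro mult_right_mono mult_left_mono) auto
  finally have h: "9 * (real n + 3) * (real n + 2) * norm (airy_coeff a (n + 3)) \<le> 2 * (2 * real n + 1) * norm (airy_coeff a n)" .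
  have k: "2 * (2 * real n + 1) * (real n + 1) \<le> 9 * (real n + 3) * (real n + 2)" by (simp add: algebra_simps)
  then have "norm (airy_coeff a (n + 3)) * (real n + 1) * (2 * (2 * real n + 1)) \<le> norm (airy_coeff a (n + 3)) * (9 * (real n + 3) * (real n + 2))"
    using mult_left_mono[OF k, of "norm (airy_coeff a (n + 3))"] by (simp add: mult_ac)
  also have "\<dots> \<le> norm (airy_coeff a n) * (2 * (2 * real n + 1))" using h by (simp add: mult_ac)
  finally have "norm (airy_coeff a (n + 3)) * (real n + 1) \<le> norm (airy_coeff a n)"
    by (rule mult_right_le_imp_le) simp
  then show ?thesis by (simp add: pos_le_divide_eq)
qed

text \<open>
  The factors \<open>1 / (n + 1)\<close> of the recursion eventually fall below \<open>r\<^sup>3\<close>, so the coefficients decay faster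
  than every geometric sequence and the series converge everywhere.
\<close>

lemma airy_coeff_bound:
  assumes "0 < (r::real)"
  obtains M where "\<And>n. norm (airy_coeff a n) \<le> M * r ^ n"
proof -
  obtain N :: nat where N: "1 / r ^ 3 < real N" using reals_Archimedean2 by blast
  define M where "M = (\<Sum>n<N + 3. norm (airy_coeff a n) / r ^ n)"
  have "norm (airy_coeff a n) \<le> M * r ^ n" for n
  proof (induction n rule: less_induct)
    case (less n)
    show ?case
    proof (cases "n < N + 3")
      case True
      have "norm (airy_coeff a n) / r ^ n \<le> M"
        unfolding M_def using True assms by (intro member_le_sum) auto
      then show ?thesis using assms by (simp add: field_simps)
    next
      case False
      define m where "m = n - 3"
      have n: "n = m + 3" and "N \<le> m" using False by (auto simp: m_def)
      then have "1 / r ^ 3 < real m + 1" using N by simp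
      then have k: "1 / (real m + 1) \<le> r ^ 3" using assms by (simp add: field_simps)
      have "norm (airy_coeff a n) \<le> norm (airy_coeff a m) * (1 / (real m + 1))"
        using airy_coeff_decay[of a m] n by simp
      also have "\<dots> \<le> (M * r ^ m) * r ^ 3"
        using less.IH[of m] n k by (intro mult_mono) (auto intro: order_trans[OF norm_ge_zero])
      finally show ?thesis by (simp add: n power_add mult.assoc)
    qed
  qed
  then show ?thesis using that by blast
qed

lemma airy_coeff_summable: "everywhere_summable (airy_coeff a)"
  unfolding everywhere_summable_def
proof
  fix z :: complex
  define r where "r = 1 / (2 * (norm z + 1))"
  have r: "0 < r" "r * norm z \<le> 1 / 2" by (auto simp: r_def field_simps add_pos_nonneg)
  obtain M where M: "\<And>n. norm (airy_coeff a n) \<le> M * r ^ n" using airy_coeff_bound[OF r(1)] by blast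
  have "M \<ge> 0" using order_trans[OF norm_ge_zero M[of 0]] by simp
  show "summable (\<lambda>n. airy_coeff a n * z ^ n)"
  proof (rule summable_comparison_test'[where g = "\<lambda>n. M * (1 / 2) ^ n" and N = 0])
    show "summable (\<lambda>n. M * (1 / 2 :: real) ^ n)" by (intro summable_mult summable_geometric) simp
    fix n
    have "norm (airy_coeff a n * z ^ n) \<le> M * r ^ n * norm z ^ n"
      using M[of n] by (simp add: norm_mult norm_power mult_right_mono)
    also have "\<dots> = M * (r * norm z) ^ n" by (simp add: power_mult_distrib)
    also have "\<dots> \<le> M * (1 / 2) ^ n" using r \<open>M \<ge> 0\<close> by (intro mult_left_mono power_mono) auto
    finally show "norm (airy_coeff a n * z ^ n) \<le> M * (1 / 2) ^ n" .
  qed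
qed

text \<open>
  In terms of coefficients, \<open>4 v\<^sup>2 g'' + 6 v g' - 2 g\<close> multiplies the coefficient of \<open>v\<^sup>n\<close> by \<open>4 n\<^sup>2 + 2 n - 2 = 2 (2 n - 1) (n + 1)\<close>,
  and \<open>9 g'''\<close> has the coefficients \<open>9 (n + 3) (n + 2) (n + 1) c\<^sub>n\<^sub>+\<^sub>3\<close>; cancelling \<open>n + 1\<close> leaves the recursion of \<open>airy_coeff\<close>.
\<close>

lemma airy_ode:
  fixes a :: nat and v :: complex
  defines "c \<equiv> airy_coeff a"
  shows "9 * pow_series (diffs (diffs (diffs c))) v =
    4 * v\<^sup>2 * pow_series (diffs (diffs c)) v + 6 * v * pow_series (diffs c) v - 2 * pow_series c v"
proof -
  have s: "everywhere_summable c" unfolding c_def by (rule airy_coeff_summable)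
  note s1 = everywhere_summable_diffs[OF s]
  note s2 = everywhere_summable_diffs[OF s1]
  note s3 = everywhere_summable_diffs[OF s2]
  note e1 = pow_series_euler[OF s]
  have "((\<lambda>z. z * pow_series (diffs c) z) has_field_derivative
      (v * pow_series (diffs (diffs c)) v + pow_series (diffs c) v)) (at v)"
    by (rule derivative_eq_intros pow_series_DERIV[OF s1] refl)+ simp
  then have "((\<lambda>z. pow_series (\<lambda>n. of_nat n * c n) z) has_field_derivative
      (v * pow_series (diffs (diffs c)) v + pow_series (diffs c) v)) (at v)"
    by (simp add: e1(2))
  then have d: "pow_series (diffs (\<lambda>n. of_nat n * c n)) v = v * pow_series (diffs (diffs c)) v + pow_series (diffs c) v"
    using pow_series_DERIV[OF e1(1)] DERIV_unique by blast
  have "(\<lambda>n. 4 * ((of_nat n * (of_nat n * c n)) * v ^ n) + 2 * ((of_nat n * c n) * v ^ n) - 2 * (c n * v ^ n)) sums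
     (4 * (v * pow_series (diffs (\<lambda>n. of_nat n * c n)) v) + 2 * (v * pow_series (diffs c) v) - 2 * pow_series c v)"
    by (intro sums_add sums_diff sums_mult pow_series_euler_sums[OF e1(1)] pow_series_euler_sums[OF s] pow_series_sums[OF s])
  moreover have "4 * ((of_nat n * (of_nat n * c n)) * v ^ n) + 2 * ((of_nat n * c n) * v ^ n) - 2 * (c n * v ^ n)
      = 9 * (diffs (diffs (diffs c)) n * v ^ n)" for n
  proof -
    have "9 * diffs (diffs (diffs c)) n = (of_nat n + 1) * (9 * (of_nat n + 3) * (of_nat n + 2) * c (n + 3))"
      by (simp add: diffs_def algebra_simps numeral_3_eq_3)
    also have "\<dots> = (of_nat n + 1) * (2 * (2 * of_nat n - 1) * c n)"
      unfolding c_def airy_coeff_step ..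
    finally have "9 * (diffs (diffs (diffs c)) n * v ^ n) = (of_nat n + 1) * (2 * (2 * of_nat n - 1) * c n) * v ^ n"
      by (simp only: mult.assoc[symmetric])
    then show ?thesis by (simp add: algebra_simps)
  qed
  ultimately have "(\<lambda>n. 9 * (diffs (diffs (diffs c)) n * v ^ n)) sums
     (4 * (v * (v * pow_series (diffs (diffs c)) v + pow_series (diffs c) v)) + 2 * (v * pow_series (diffs c) v) - 2 * pow_series c v)"
    by (simp add: d)
  from sums_unique2[OF this sums_mult[OF pow_series_sums[OF s3]]]
  show ?thesis by (simp add: algebra_simps power2_eq_square)
qed

definition det3 :: "complex \<Rightarrow> complex \<Rightarrow> complex \<Rightarrow> complex \<Rightarrow> complex \<Rightarrow> complex \<Rightarrow> complex \<Rightarrow> complex \<Rightarrow> complex \<Rightarrow> complex" where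
  "det3 a0 a1 a2 b0 b1 b2 c0 c1 c2 = a0 * (b1 * c2 - b2 * c1) - a1 * (b0 * c2 - b2 * c0) + a2 * (b0 * c1 - b1 * c0)"

text \<open>
  By Abel's identity the Wronskian equals its value \<open>2\<close> at \<open>0\<close> times \<open>exp (4 v\<^sup>3 / 27)\<close>.
\<close>

lemma airy_fundamental_system:
  obtains g g1 g2 :: "nat \<Rightarrow> complex \<Rightarrow> complex"
  where "\<And>a v. (g a has_field_derivative g1 a v) (at v)"
    "\<And>a v. (g1 a has_field_derivative g2 a v) (at v)"
    "\<And>a v. (g2 a has_field_derivative (4 * v\<^sup>2 * g2 a v + 6 * v * g1 a v - 2 * g a v) / 9) (at v)"
    "\<And>v. det3 (g 0 v) (g1 0 v) (g2 0 v) (g 1 v) (g1 1 v) (g2 1 v) (g 2 v) (g1 2 v) (g2 2 v) \<noteq> 0"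
proof -
  define g where "g = (\<lambda>a. pow_series (airy_coeff a))"
  define g1 where "g1 = (\<lambda>a. pow_series (diffs (airy_coeff a)))"
  define g2 where "g2 = (\<lambda>a. pow_series (diffs (diffs (airy_coeff a))))"
  note s = airy_coeff_summable
  note s1 = everywhere_summable_diffs[OF s]
  note s2 = everywhere_summable_diffs[OF s1]
  have D: "(g a has_field_derivative g1 a v) (at v)" for a v unfolding g_def g1_def by (rule pow_series_DERIV[OF s])
  have D1: "(g1 a has_field_derivative g2 a v) (at v)" for a v unfolding g2_def g1_def by (rule pow_series_DERIV[OF s1])
  have D2: "(g2 a has_field_derivative (4 * v\<^sup>2 * g2 a v + 6 * v * g1 a v - 2 * g a v) / 9) (at v)" for a v
  proof -
    have eq: "pow_series (diffs (diffs (diffs (airy_coeff a)))) v = (4 * v\<^sup>2 * g2 a v + 6 * v * g1 a v - 2 * g a v) / 9"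
      unfolding g_def g1_def g2_def airy_ode[symmetric] by simp
    have "(g2 a has_field_derivative pow_series (diffs (diffs (diffs (airy_coeff a)))) v) (at v)"
      unfolding g2_def by (rule pow_series_DERIV[OF s2])
    then show ?thesis by (simp only: eq)
  qed
  define W where "W = (\<lambda>v. det3 (g 0 v) (g1 0 v) (g2 0 v) (g 1 v) (g1 1 v) (g2 1 v) (g 2 v) (g1 2 v) (g2 2 v))"
  have DW: "(W has_field_derivative (4 / 9 * v\<^sup>2 * W v)) (at v)" for v
    unfolding W_def det3_def
    by (rule derivative_eq_intros D D1 D2 refl)+ (simp add: field_simps)
  \<comment> \<open>Abel's identity in integrated form\<close>
  define V where "V = (\<lambda>v. W v * exp (- (4 / 27 * v ^ 3)))"
  have DV: "(V has_field_derivative 0) (at v)" for v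
    unfolding V_def
    by (rule derivative_eq_intros DW refl)+ (simp add: field_simps)
  have "pow_series c 0 = c 0" for c by (simp add: pow_series_def powser_zero)
  then have "W 0 = 2"
    by (simp add: W_def det3_def g_def g1_def g2_def diffs_def airy_coeff.simps numeral_2_eq_2)
  have "V v = V 0" for v
    using has_field_derivative_zero_constant[of UNIV V] DV by fastforce
  then have "W v \<noteq> 0" for v using \<open>W 0 = 2\<close> unfolding V_def by (metis exp_not_eq_zero mult_eq_0_iff zero_neq_numeral)
  then show ?thesis using that[of g g1 g2] D D1 D2 unfolding W_def by blast
qed

section \<open>The volume\<close>

text \<open>
  The slice where the coordinate \<open>b0\<close> equals \<open>s\<close> is a simplex of dimension \<open>m = DIM('a) - 1\<close> and size
  \<open>min 1 ((3 - s) / 2)\<close>.  Its volume is constant for \<open>s \<le> 1\<close> and decreases like a power for \<open>s\<close> between \<open>1\<close> and \<open>3\<close>,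
  which adds up to \<open>(1 + 2 / (m + 1)) / m!\<close>.
\<close>

lemma truncated_simplex_emeasure_le:
  fixes b0 :: "'a::euclidean_space"
  assumes b0: "b0 \<in> Basis"
  defines "K \<equiv> {x::'a. (\<forall>b\<in>Basis. 0 \<le> x \<bullet> b) \<and> (\<Sum>b\<in>Basis - {b0}. x \<bullet> b) \<le> 1
      \<and> x \<bullet> b0 + 2 * (\<Sum>b\<in>Basis - {b0}. x \<bullet> b) \<le> 3}"
  shows "emeasure lborel K \<le> ennreal ((real DIM('a) + 2) / fact DIM('a))"
proof -
  define A where "A = Basis - {b0}"
  define m where "m = card A"
  have A: "finite A" "b0 \<notin> A" "insert b0 A = Basis" using b0 by (auto simp: A_def)
  have dim: "DIM('a) = m + 1"
    using A(1,2) by (simp add: A(3)[symmetric] m_def)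
  let ?M = "\<lambda>A. Pi\<^sub>M A (\<lambda>_::'a. lborel :: real measure)"
  define L where "L = {y::'a \<Rightarrow> real. (\<forall>b\<in>insert b0 A. 0 \<le> y b) \<and> sum y A \<le> 1 \<and> y b0 + 2 * sum y A \<le> 3}"
  define S where "S = (\<lambda>t. {y::'a \<Rightarrow> real. (\<forall>b\<in>A. 0 \<le> y b) \<and> sum y A \<le> t})"
  interpret product_sigma_finite "\<lambda>_::'a. lborel :: real measure" by standard
  have [measurable]: "S t \<inter> space (?M A) \<in> sets (?M A)" for t
  proof -
    have "S t \<inter> space (?M A) = Pi\<^sub>E A (\<lambda>_. {0..}) \<inter> (\<lambda>x. sum x A) -` {..t} \<inter> space (?M A)"
      by (auto simp: S_def space_PiM)
    also have "\<dots> \<in> sets (?M A)" using \<open>finite A\<close> by measurable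
    finally show ?thesis .
  qed
  have L_sets: "L \<inter> space (?M (insert b0 A)) \<in> sets (?M (insert b0 A))"
  proof -
    have "L \<inter> space (?M (insert b0 A)) = Pi\<^sub>E (insert b0 A) (\<lambda>_. {0..}) \<inter> (\<lambda>x. sum x A) -` {..1}
        \<inter> (\<lambda>x. x b0 + 2 * sum x A) -` {..3} \<inter> space (?M (insert b0 A))"
      by (auto simp: L_def space_PiM)
    also have "\<dots> = Pi\<^sub>E (insert b0 A) (\<lambda>_. {0..}) \<inter> ((\<lambda>x. sum x A) -` {..1} \<inter> space (?M (insert b0 A)))
        \<inter> ((\<lambda>x. x b0 + 2 * sum x A) -` {..3} \<inter> space (?M (insert b0 A)))" by auto
    also have "\<dots> \<in> sets (?M (insert b0 A))"
      using \<open>finite A\<close> by (intro sets.Int sets_PiM_I_finite measurable_sets[where A = borel]) measurable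
    finally show ?thesis .
  qed
  have simplex: "emeasure (?M A) (S t \<inter> space (?M A)) = ennreal (t ^ m / fact m)" if "t \<ge> 0" for t
    unfolding S_def m_def using emeasure_std_simplex_aux[OF \<open>finite A\<close> that] .
  have fibre: "indicator (L \<inter> space (?M (insert b0 A))) (x(b0 := s)) =
      (indicator {0..3} s * indicator (S (min 1 ((3 - s) / 2)) \<inter> space (?M A)) x :: ennreal)"
    if "x \<in> space (?M A)" for x s
  proof -
    have "sum (x(b0 := s)) A = sum x A" using A(2) by (intro sum.cong) auto
    moreover have "x(b0 := s) \<in> space (?M (insert b0 A))" using that A(2) by (auto simp: space_PiM PiE_def extensional_def)
    moreover have "sum x A \<ge> 0" if "\<forall>b\<in>A. 0 \<le> x b" using that by (intro sum_nonneg) auto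
    ultimately show ?thesis using that A(2) by (auto simp: L_def S_def indicator_def)
  qed
  have "emeasure lborel K = emeasure (distr (?M Basis) borel (\<lambda>f. \<Sum>b\<in>Basis. f b *\<^sub>R b)) K"
    by (subst lborel_eq) simp
  also have "\<dots> = emeasure (?M Basis) (L \<inter> space (?M Basis))"
  proof (subst emeasure_distr)
    show "K \<in> sets borel" unfolding K_def by measurable
    show "emeasure (?M Basis) ((\<lambda>f. \<Sum>b\<in>Basis. f b *\<^sub>R b) -` K \<inter> space (?M Basis)) = emeasure (?M Basis) (L \<inter> space (?M Basis))"
    proof -
      have "(\<lambda>f. \<Sum>b\<in>Basis. f b *\<^sub>R b) -` K = L"
        using b0 unfolding K_def L_def A(3) by (auto simp: A_def)
      then show ?thesis by simp
    qed
  qed auto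
  also have "\<dots> = emeasure (?M (insert b0 A)) (L \<inter> space (?M (insert b0 A)))" by (simp only: A(3))
  also have "\<dots> = (\<integral>\<^sup>+x. indicator (L \<inter> space (?M (insert b0 A))) x \<partial>?M (insert b0 A))"
    by (rule nn_integral_indicator[symmetric]) (rule L_sets)
  also have "\<dots> = (\<integral>\<^sup>+ s. \<integral>\<^sup>+ x. indicator (L \<inter> space (?M (insert b0 A))) (x(b0 := s)) \<partial>?M A \<partial>lborel)"
    using A L_sets by (intro product_nn_integral_insert_rev) auto
  also have "\<dots> = (\<integral>\<^sup>+ s. \<integral>\<^sup>+ x. indicator {0..3} s * indicator (S (min 1 ((3 - s) / 2)) \<inter> space (?M A)) x \<partial>?M A \<partial>lborel)"
    by (intro nn_integral_cong fibre)
  also have "\<dots> = (\<integral>\<^sup>+ s. indicator {0..3} s * emeasure (?M A) (S (min 1 ((3 - s) / 2)) \<inter> space (?M A)) \<partial>lborel)"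
    by (subst nn_integral_cmult) auto
  also have "\<dots> \<le> (\<integral>\<^sup>+ s. ennreal (1 / fact m) * indicator {0..1} s + ennreal (((3 - s) / 2) ^ m / fact m) * indicator {1..3} s \<partial>lborel)"
  proof (rule nn_integral_mono)
    fix s :: real
    show "indicator {0..3} s * emeasure (?M A) (S (min 1 ((3 - s) / 2)) \<inter> space (?M A)) \<le>
        ennreal (1 / fact m) * indicator {0..1} s + ennreal (((3 - s) / 2) ^ m / fact m) * indicator {1..3} s"
      by (cases "s \<in> {0..3}"; cases "s \<le> 1") (auto simp: simplex min_def indicator_def)
  qed
  also have "\<dots> = ennreal (1 / fact m) + ennreal (2 / ((real m + 1) * fact m))"
  proof -
    define q where "q = (real m + 1) * fact m"
    have q: "q > 0" "(real m + 1) / q = 1 / fact m" by (simp_all add: q_def)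
    have "((\<lambda>s. - 2 / q * ((3 - s) / 2) ^ (m + 1)) has_real_derivative
        - 2 / q * ((real m + 1) * ((3 - s) / 2) ^ m * (- 1 / 2))) (at s)" for s
    proof -
      have "((\<lambda>s. (3 - s) / 2) has_real_derivative - 1 / 2) (at s)"
        by (rule derivative_eq_intros refl | simp)+
      from DERIV_cmult[OF DERIV_power[OF this, of "m + 1"], of "- 2 / q"]
      show ?thesis by (rule DERIV_cong) simp
    qed
    moreover have "- 2 / q * ((real m + 1) * ((3 - s) / 2) ^ m * (- 1 / 2)) = ((3 - s) / 2) ^ m * ((real m + 1) / q)" for s
      by simp
    ultimately have "((\<lambda>s. - 2 / q * ((3 - s) / 2) ^ (m + 1)) has_real_derivative ((3 - s) / 2) ^ m / fact m) (at s)" for s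
      by (simp only: q) simp
    then have "(\<integral>\<^sup>+ s. ennreal (((3 - s) / 2) ^ m / fact m) * indicator {1..3} s \<partial>lborel)
       = ennreal ((- 2 / q * ((3 - 3) / 2) ^ (m + 1)) - (- 2 / q * ((3 - 1) / 2) ^ (m + 1)))"
      by (intro nn_integral_FTC_Icc) auto
    then have "(\<integral>\<^sup>+ s. ennreal (((3 - s) / 2) ^ m / fact m) * indicator {1..3} s \<partial>lborel) = ennreal (2 / q)"
      by simp
    moreover have "(\<integral>\<^sup>+ s. ennreal (1 / fact m) * indicator {0..1::real} s \<partial>lborel) = ennreal (1 / fact m)"
      by (subst nn_integral_cmult_indicator) auto
    ultimately show ?thesis by (subst nn_integral_add) (auto simp: q_def)
  qed
  also have "\<dots> = ennreal (1 / fact m + 2 / ((real m + 1) * fact m))" by (rule ennreal_plus[symmetric]) auto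
  also have "1 / fact m + 2 / ((real m + 1) * fact m) = (real DIM('a) + 2) / fact DIM('a)"
  proof -
    have e: "1 / fact m = (real m + 1) / ((real m + 1) * fact m)" by simp
    have "1 / fact m + 2 / ((real m + 1) * fact m) = ((real m + 1) + 2) / ((real m + 1) * fact m)"
      by (simp only: e add_divide_distrib)
    then show ?thesis unfolding dim by (simp add: algebra_simps)
  qed
  finally show ?thesis .
qed

text \<open>
  The columns and the origin lie in the truncated simplex.
\<close>

lemma simplicial_volume_hole_matrix_le:
  "simplicial_volume (hole_matrix d0 :: int ^ ('d + 'd) ^ 'd::finite) \<le> real CARD('d) + 2"
proof -
  let ?A = "map_matrix real_of_int (hole_matrix d0)"
  let ?H = "convex hull (insert 0 (columns ?A))"
  define b0 where "b0 = (axis d0 1 :: real ^ 'd)"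
  define K where "K = {x::real ^ 'd. (\<forall>b\<in>Basis. 0 \<le> x \<bullet> b) \<and> (\<Sum>b\<in>Basis - {b0}. x \<bullet> b) \<le> 1
      \<and> x \<bullet> b0 + 2 * (\<Sum>b\<in>Basis - {b0}. x \<bullet> b) \<le> 3}"
  have Basis: "Basis = range (\<lambda>i. axis i 1 :: real ^ 'd)" by (auto simp: Basis_vec_def)
  have sum_eq: "(\<Sum>b\<in>Basis - {b0}. x \<bullet> b) = (\<Sum>i\<in>UNIV - {d0}. x $ i)" for x :: "real ^ 'd"
  proof -
    have "Basis - {b0} = (\<lambda>i. axis i 1 :: real ^ 'd) ` (UNIV - {d0})"
      by (auto simp: Basis b0_def axis_eq_axis)
    moreover have "inj_on (\<lambda>i. axis i 1 :: real ^ 'd) (UNIV - {d0})" by (auto simp: inj_on_def axis_eq_axis)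
    ultimately show ?thesis by (simp add: sum.reindex inner_axis)
  qed
  have K: "K = {x. (\<forall>i. 0 \<le> x $ i) \<and> (\<Sum>i\<in>UNIV - {d0}. x $ i) \<le> 1 \<and> x $ d0 + 2 * (\<Sum>i\<in>UNIV - {d0}. x $ i) \<le> 3}"
    unfolding K_def sum_eq by (auto simp: Basis inner_axis b0_def)
  have "b0 \<in> Basis" by (simp add: Basis b0_def)
  from truncated_simplex_emeasure_le[OF this]
  have em: "emeasure lborel K \<le> ennreal ((real CARD('d) + 2) / fact CARD('d))"
    unfolding K_def by simp
  have "?H \<subseteq> K"
  proof (rule hull_minimal)
    have "column k ?A \<in> K" for k
    proof (cases k)
      case (Inl j)
      then have "column k ?A $ i = (if i = j then (if j = d0 then 2 else 1) else 0)" for i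
        by (auto simp: column_def map_matrix_def hole_matrix_Inl)
      then show ?thesis by (auto simp: K sum.delta)
    next
      case (Inr j)
      then have c: "column k ?A $ i = (if i = j then (if j = d0 then 3 else 1) else if i = d0 then 1 else 0)" for i
        by (auto simp: column_def map_matrix_def hole_matrix_Inr)
      have "(\<Sum>i\<in>UNIV - {d0}. column k ?A $ i) = (\<Sum>i\<in>UNIV - {d0}. if i = j then (if j = d0 then 3 else 1) else 0)"
        by (intro sum.cong) (auto simp: c)
      also have "\<dots> = (if j = d0 then 0 else 1)" by (auto simp: sum.delta)
      finally show ?thesis by (auto simp: K c)
    qed
    then show "insert 0 (columns ?A) \<subseteq> K" by (auto simp: columns_def) (auto simp: K)
    show "convex K"
    proof (rule convexI)
      fix x y :: "real ^ 'd" and u v :: real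
      assume x: "x \<in> K" and y: "y \<in> K" and u: "0 \<le> u" "0 \<le> v" "u + v = 1"
      let ?s = "\<lambda>x :: real ^ 'd. \<Sum>i\<in>UNIV - {d0}. x $ i"
      have s: "?s (u *\<^sub>R x + v *\<^sub>R y) = u * ?s x + v * ?s y"
        by (simp add: sum.distrib sum_distrib_left)
      have "u * ?s x + v * ?s y \<le> u * 1 + v * 1"
        using x y u by (intro add_mono mult_left_mono) (auto simp: K)
      moreover have "u * (x $ d0 + 2 * ?s x) + v * (y $ d0 + 2 * ?s y) \<le> u * 3 + v * 3"
        using x y u by (intro add_mono mult_left_mono) (auto simp: K)
      ultimately have "?s (u *\<^sub>R x + v *\<^sub>R y) \<le> 1"
          "(u *\<^sub>R x + v *\<^sub>R y) $ d0 + 2 * ?s (u *\<^sub>R x + v *\<^sub>R y) \<le> 3"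
        unfolding s using u by (auto simp: algebra_simps)
      moreover have "0 \<le> (u *\<^sub>R x + v *\<^sub>R y) $ i" for i using x y u by (simp add: K)
      ultimately show "u *\<^sub>R x + v *\<^sub>R y \<in> K" unfolding K by blast
    qed
  qed
  moreover have "?H \<in> sets lborel"
  proof -
    have "finite (columns ?A)" by (simp add: columns_def full_SetCompr_eq)
    then have "compact ?H" by (intro finite_imp_compact_convex_hull) simp
    then show ?thesis by (simp add: borel_compact)
  qed
  ultimately have "emeasure lborel ?H \<le> emeasure lborel K"
    unfolding K_def by (intro emeasure_mono) measurable
  with em have "emeasure lborel ?H \<le> ennreal ((real CARD('d) + 2) / fact CARD('d))" by (rule order_trans[rotated])
  then have "measure lborel ?H \<le> (real CARD('d) + 2) / fact CARD('d)"
    unfolding measure_def by (intro enn2real_leI) auto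
  then show ?thesis by (simp add: simplicial_volume_def field_simps)
qed

section \<open>Incomplete integrals and Laurent monomials\<close>

text \<open>
  The zero of the linear polynomial \<open>z\<^sub>j + w\<^sub>j s\<close> in \<open>s\<close>.
\<close>

definition slope :: "'d::finite \<Rightarrow> complex ^ ('d + 'd) \<Rightarrow> complex" where
  "slope j p = - (p $ Inl j) / p $ Inr j"

lemma cdiff_slope [simp]: "p $ Inr j \<noteq> 0 \<Longrightarrow> cdiff (slope j) p"
  unfolding slope_def[abs_def] by simp

lemma pderiv_slope [simp]:
  "p $ Inr j \<noteq> 0 \<Longrightarrow> pderiv_at k (slope j) p =
     (if k = Inl j then - 1 / p $ Inr j else if k = Inr j then - slope j p / p $ Inr j else 0)"
  unfolding slope_def[abs_def] by (simp add: power2_eq_square)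

text \<open>
  A primitive in \<open>s\<close> of \<open>exp (x s\<^sup>2 + y s\<^sup>3) / s\<^sup>2\<close>.  One integration by parts replaces the pole at \<open>0\<close> by the
  boundary term and leaves integrals of entire functions.  No logarithm occurs because the residue of
  the integrand at \<open>0\<close> vanishes.
\<close>

definition regular_primitive :: "complex \<Rightarrow> complex \<Rightarrow> complex \<Rightarrow> complex" where
  "regular_primitive x y s = 2 * x * exp_integral 0 x y s + 3 * y * exp_integral 1 x y s - exp (x * s ^ 2 + y * s ^ 3) / s"

lemma cdiff_regular_primitive [simp]:
  "cdiff a p \<Longrightarrow> cdiff b p \<Longrightarrow> cdiff s p \<Longrightarrow> s p \<noteq> 0 \<Longrightarrow> cdiff (\<lambda>p. regular_primitive (a p) (b p) (s p)) p"
  unfolding regular_primitive_def by simp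

text \<open>
  The factors \<open>x\<close> and \<open>y\<close> in the definition disappear from the derivatives after integration by parts of
  the moments of order \<open>0\<close> and \<open>1\<close>.
\<close>

lemma pderiv_regular_primitive [simp]:
  assumes "cdiff a p" "cdiff b p" "cdiff s p" "s p \<noteq> 0"
  shows "pderiv_at k (\<lambda>p. regular_primitive (a p) (b p) (s p)) p =
    exp_integral 0 (a p) (b p) (s p) * pderiv_at k a p + exp_integral 1 (a p) (b p) (s p) * pderiv_at k b p
    + exp (a p * s p ^ 2 + b p * s p ^ 3) / (s p)\<^sup>2 * pderiv_at k s p"
proof -
  define x y t where "x = a p" and "y = b p" and "t = s p"
  define x' y' t' where "x' = pderiv_at k a p" and "y' = pderiv_at k b p" and "t' = pderiv_at k s p"
  define E where "E = exp (x * t ^ 2 + y * t ^ 3)"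
  have I0: "2 * x * exp_integral 2 x y t + 3 * y * exp_integral 3 x y t = t * E - exp_integral 0 x y t"
    using exp_integral_by_parts[of 0 x y t] by (simp add: E_def algebra_simps numeral_2_eq_2)
  have I1: "2 * x * exp_integral 3 x y t + 3 * y * exp_integral 4 x y t = t\<^sup>2 * E - 2 * exp_integral 1 x y t"
    using exp_integral_by_parts[of 1 x y t] by (simp add: E_def algebra_simps power2_eq_square flip: numeral_3_eq_3)
  have "t \<noteq> 0" using assms by (simp add: t_def)
  have "pderiv_at k (\<lambda>p. regular_primitive (a p) (b p) (s p)) p =
     2 * x' * exp_integral 0 x y t + 3 * y' * exp_integral 1 x y t + x' * (2 * x * exp_integral 2 x y t + 3 * y * exp_integral 3 x y t)
     + y' * (2 * x * exp_integral 3 x y t + 3 * y * exp_integral 4 x y t) + 2 * x * E * t' + 3 * y * (t * E) * t'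
     - (E * (x' * t ^ 2 + x * (2 * t * t') + y' * t ^ 3 + y * (3 * t ^ 2 * t')) * t - E * t') / t\<^sup>2"
    unfolding regular_primitive_def using assms
    by (simp add: x_def y_def t_def x'_def y'_def t'_def E_def algebra_simps
        flip: numeral_2_eq_2 numeral_3_eq_3)
  also have "\<dots> = exp_integral 0 x y t * x' + exp_integral 1 x y t * y' + E / t\<^sup>2 * t'"
    unfolding I0 I1 using \<open>t \<noteq> 0\<close> by (simp add: field_simps power2_eq_square power3_eq_cube)
  finally show ?thesis by (simp add: x_def y_def t_def x'_def y'_def t'_def E_def)
qed

definition endpoint_value :: "'d \<Rightarrow> 'd::finite \<Rightarrow> complex ^ ('d + 'd) \<Rightarrow> complex" where
  "endpoint_value d0 j p = regular_primitive (p $ Inl d0) (p $ Inr d0) (slope j p)"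

text \<open>
  The Laurent monomial \<open>- w\<^sub>j / z\<^sub>j\<close>.
\<close>

definition laurent :: "'d::finite \<Rightarrow> complex ^ ('d + 'd) \<Rightarrow> complex" where
  "laurent j p = 1 / slope j p"

text \<open>
  The explicit solutions have poles along \<open>z\<^sub>j = 0\<close> and \<open>w\<^sub>j = 0\<close> and branch along \<open>y = 0\<close>.
\<close>

locale hole_chart =
  fixes d0 :: "'d::finite" and U :: "(complex ^ ('d + 'd)) set"
  assumes open_U: "open U" and coord_nz: "\<And>p k. p \<in> U \<Longrightarrow> k \<noteq> Inl d0 \<Longrightarrow> p $ k \<noteq> 0"
begin

abbreviation "dx \<equiv> pderiv_at (Inl d0 :: 'd + 'd)"
abbreviation "dy \<equiv> pderiv_at (Inr d0 :: 'd + 'd)"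
abbreviation "dz j \<equiv> pderiv_at (Inl j :: 'd + 'd)"
abbreviation "dw j \<equiv> pderiv_at (Inr j :: 'd + 'd)"

definition holo :: "(complex ^ ('d + 'd) \<Rightarrow> complex) \<Rightarrow> bool" where
  "holo f \<longleftrightarrow> (\<forall>p\<in>U. cdiff f p)"

definition solution :: "(complex ^ ('d + 'd) \<Rightarrow> complex) \<Rightarrow> bool" where
  "solution f \<longleftrightarrow> holo f \<and> solves_hypergeom (hole_matrix d0) (axis d0 1) U f"

lemma slope_nz: "p \<in> U \<Longrightarrow> j \<noteq> d0 \<Longrightarrow> slope j p \<noteq> 0"
  using coord_nz[of p "Inl j"] coord_nz[of p "Inr j"] by (simp add: slope_def)

lemma euler_lhs:
  "(\<Sum>k\<in>UNIV. of_int (hole_matrix d0 $ i $ k) * p $ k * pderiv_at k f p) =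
    (if i = d0 then 2 * p $ Inl d0 * dx f p + 3 * p $ Inr d0 * dy f p
        + (\<Sum>j\<in>UNIV - {d0}. p $ Inr j * dw j f p)
     else p $ Inl i * dz i f p + p $ Inr i * dw i f p)"
proof -
  let ?g = "\<lambda>k. of_int (hole_matrix d0 $ i $ k) * p $ k * pderiv_at k f p"
  have "sum ?g UNIV = (\<Sum>j\<in>UNIV. ?g (Inl j)) + (\<Sum>j\<in>UNIV. ?g (Inr j))"
    by (subst UNIV_Plus_UNIV[symmetric], subst sum.Plus) (auto simp: o_def)
  also have "(\<Sum>j\<in>UNIV. ?g (Inl j)) = ?g (Inl i)"
    by (subst sum.remove[of _ i]) (auto simp: hole_matrix_Inl intro!: sum.neutral)
  also have "(\<Sum>j\<in>UNIV. ?g (Inr j)) = ?g (Inr i) + (\<Sum>j\<in>UNIV - {i}. ?g (Inr j))"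
    by (subst sum.remove[of _ i]) auto
  also have "(\<Sum>j\<in>UNIV - {i}. ?g (Inr j)) = (if i = d0 then (\<Sum>j\<in>UNIV - {d0}. p $ Inr j * dw j f p) else 0)"
    by (auto simp: hole_matrix_Inr intro!: sum.neutral sum.cong)
  finally show ?thesis by (simp add: hole_matrix_Inl hole_matrix_Inr)
qed

lemma solutionI:
  assumes "holo f"
    and "\<And>p. p \<in> U \<Longrightarrow> 2 * p $ Inl d0 * dx f p + 3 * p $ Inr d0 * dy f p
        + (\<Sum>j\<in>UNIV - {d0}. p $ Inr j * dw j f p) = f p"
    and "\<And>p i. p \<in> U \<Longrightarrow> i \<noteq> d0 \<Longrightarrow> p $ Inl i * dz i f p + p $ Inr i * dw i f p = 0"
    and "\<And>p u. p \<in> U \<Longrightarrow> u \<in> ker_int (hole_matrix d0) \<Longrightarrow> multi_pderiv (pos_part u) f p = multi_pderiv (neg_part u) f p"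
  shows "solution f"
  unfolding solution_def solves_hypergeom_def euler_lhs using assms by (auto simp: axis_def)

lemma solution_euler:
  assumes "solution f" "p \<in> U"
  shows "2 * p $ Inl d0 * dx f p + 3 * p $ Inr d0 * dy f p
        + (\<Sum>j\<in>UNIV - {d0}. p $ Inr j * dw j f p) = f p"
    and "i \<noteq> d0 \<Longrightarrow> p $ Inl i * dz i f p + p $ Inr i * dw i f p = 0"
proof -
  have *: "\<And>i. (\<Sum>k\<in>UNIV. of_int (hole_matrix d0 $ i $ k) * p $ k * pderiv_at k f p) = axis d0 1 $ i * f p"
    using assms unfolding solution_def solves_hypergeom_def by blast
  show "2 * p $ Inl d0 * dx f p + 3 * p $ Inr d0 * dy f p
        + (\<Sum>j\<in>UNIV - {d0}. p $ Inr j * dw j f p) = f p"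
    using *[of d0] unfolding euler_lhs by (simp add: axis_def)
  show "i \<noteq> d0 \<Longrightarrow> p $ Inl i * dz i f p + p $ Inr i * dw i f p = 0"
    using *[of i] unfolding euler_lhs by (simp add: axis_def)
qed

lemma endpoint_value_cdiff: "p \<in> U \<Longrightarrow> j \<noteq> d0 \<Longrightarrow> cdiff (endpoint_value d0 j) p"
  unfolding endpoint_value_def[abs_def] by (simp add: slope_nz coord_nz)

lemma endpoint_value_pderiv:
  assumes "p \<in> U" "j \<noteq> d0"
  shows "pderiv_at k (endpoint_value d0 j) p =
    (if k = Inl d0 then exp_integral 0 (p $ Inl d0) (p $ Inr d0) (slope j p)
     else if k = Inr d0 then exp_integral 1 (p $ Inl d0) (p $ Inr d0) (slope j p)
     else if k = Inl j then - exp (p $ Inl d0 * slope j p ^ 2 + p $ Inr d0 * slope j p ^ 3) / ((slope j p)\<^sup>2 * p $ Inr j)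
     else if k = Inr j then - exp (p $ Inl d0 * slope j p ^ 2 + p $ Inr d0 * slope j p ^ 3) / (slope j p * p $ Inr j)
     else 0)"
  unfolding endpoint_value_def[abs_def] using assms slope_nz[OF assms]
  by (simp add: coord_nz power2_eq_square)

lemma sum_only:
  assumes "j \<noteq> d0" "\<And>i. i \<noteq> d0 \<Longrightarrow> i \<noteq> j \<Longrightarrow> g i = 0"
  shows "(\<Sum>i\<in>UNIV - {d0}. g i) = (g j :: complex)"
  using assms by (subst sum.remove[of _ j]) (auto intro!: sum.neutral)

text \<open>
  The homogeneity equations hold by the definition of the primitive.  For the toric equations, a derivative
  in \<open>x\<close> or \<open>y\<close> multiplies the integrand by \<open>\<sigma>\<^sup>2\<close> or \<open>\<sigma>\<^sup>3\<close>, and a derivative in \<open>z\<^sub>j\<close> or \<open>w\<^sub>j\<close> evaluates the integrand at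
  the end point of integration.
\<close>

lemma endpoint_value_solution:
  assumes "j \<noteq> d0"
  shows "solution (endpoint_value d0 j)"
proof (rule solutionI)
  show "holo (endpoint_value d0 j)" unfolding holo_def using endpoint_value_cdiff[OF _ assms] by blast
  fix p assume p: "p \<in> U"
  show "2 * p $ Inl d0 * dx (endpoint_value d0 j) p + 3 * p $ Inr d0 * dy (endpoint_value d0 j) p
        + (\<Sum>i\<in>UNIV - {d0}. p $ Inr i * dw i (endpoint_value d0 j) p) = endpoint_value d0 j p"
    using assms slope_nz[OF p assms] coord_nz[OF p, of "Inr j"]
    by (subst sum_only[OF assms]) (auto simp: endpoint_value_pderiv p endpoint_value_def regular_primitive_def)
  show "p $ Inl i * dz i (endpoint_value d0 j) p + p $ Inr i * dw i (endpoint_value d0 j) p = 0" if "i \<noteq> d0" for i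
    using assms that slope_nz[OF p assms] coord_nz[OF p, of "Inr j"]
    by (auto simp: endpoint_value_pderiv p slope_def field_simps power2_eq_square)
next
  fix p u assume p: "p \<in> U" and u: "u \<in> ker_int (hole_matrix d0)"
  define T where "T = (\<lambda>m. if m = 0 then endpoint_value d0 j else (\<lambda>p. exp_integral (m - 2) (p $ Inl d0) (p $ Inr d0) (slope j p)))"
  define R where "R = (\<lambda>m p. - (slope j p ^ m * exp (p $ Inl d0 * slope j p ^ 2 + p $ Inr d0 * slope j p ^ 3)) / ((slope j p)\<^sup>2 * p $ Inr j))"
  show "multi_pderiv (pos_part u) (endpoint_value d0 j) p = multi_pderiv (neg_part u) (endpoint_value d0 j) p"
  proof (rule toric_tower[OF open_U assms, where T = T and R = R])
    show "u \<in> ker_int (hole_matrix d0)" "p \<in> U" by fact+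
    fix q assume q: "q \<in> U"
    note nz = slope_nz[OF q assms] coord_nz[OF q, of "Inr j"]
    show "endpoint_value d0 j q = T 0 q" by (simp add: T_def)
    show "cdiff (R m) q" for m unfolding R_def using nz by simp
    have R_pd: "pderiv_at k (R m) q = (if k = Inl d0 then R (m + 2) q else if k = Inr d0 then R (m + 3) q
       else if k = Inl j \<or> k = Inr j then pderiv_at k (R m) q else 0)" for k m
      unfolding R_def using nz assms by (auto simp: power_add field_simps power2_eq_square power3_eq_cube)
    show "dx (R m) q = R (m + 2) q" "dy (R m) q = R (m + 3) q" for m
      by (subst R_pd, simp)+
    show "dz i (R m) q = 0" "dw i (R m) q = 0" if "i \<noteq> d0" "i \<noteq> j" for i m
      by (subst R_pd, use that in simp)+
    show "dw j (R m) q = dz j (R (m + 1)) q" for m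
    proof -
      define N where "N = (\<lambda>m p. - (slope j p ^ m * exp (p $ Inl d0 * slope j p ^ 2 + p $ Inr d0 * slope j p ^ 3)))"
      define D where "D = (\<lambda>p. (slope j p)\<^sup>2 * p $ Inr j)"
      define x y w t where "x = q $ Inl d0" and "y = q $ Inr d0" and "w = q $ Inr j" and "t = slope j q"
      define E where "E = exp (x * t ^ 2 + y * t ^ 3)"
      have nz': "w \<noteq> 0" "t \<noteq> 0" using nz by (auto simp: w_def t_def)
      have N: "cdiff (N m) q" for m unfolding N_def using nz by simp
      have D: "cdiff D q" "D q \<noteq> 0" unfolding D_def using nz by simp_all
      have R: "pderiv_at k (R m) q = (pderiv_at k (N m) q * D q - N m q * pderiv_at k D q) / (D q)\<^sup>2" for k m
        using pderiv_divide[OF N D] by (simp add: R_def N_def D_def)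
      have N_pd: "pderiv_at k (N m) q = - (of_nat m * t ^ (m - 1) + t ^ m * (2 * x * t + 3 * y * t\<^sup>2)) * E * pderiv_at k (slope j) q"
        if "k = Inl j \<or> k = Inr j" for k m
        unfolding N_def using that nz assms by (auto simp: x_def y_def t_def E_def algebra_simps power2_eq_square)
      have D_pd: "pderiv_at k D q = 2 * t * w * pderiv_at k (slope j) q + (if k = Inr j then t\<^sup>2 else 0)" for k
        unfolding D_def using nz by (auto simp: w_def t_def)
      have t_pd: "dz j (slope j) q = - 1 / w" "dw j (slope j) q = - t / w"
        using nz by (simp_all add: w_def t_def)
      have N_q: "N m q = - (t ^ m * E)" and D_q: "D q = t\<^sup>2 * w" for m
        by (simp_all add: N_def D_def E_def x_def y_def t_def w_def)
      show ?thesis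
        unfolding R N_pd[OF disjI1[OF refl]] N_pd[OF disjI2[OF refl]] D_pd t_pd N_q D_q
        using nz' by (cases m) (simp_all add: field_simps power2_eq_square)
    qed
    have T_pd: "pderiv_at k (T m) q = (if k = Inl d0 then T (m + 2) q else if k = Inr d0 then T (m + 3) q
       else if k = Inl j then R m q else if k = Inr j then R (m + 1) q else 0)" if "m \<noteq> 1" for k m
    proof (cases "m = 0")
      case True
      then show ?thesis using nz assms by (auto simp: T_def R_def endpoint_value_pderiv q power2_eq_square)
    next
      case False
      with that have "m \<ge> 2" by simp
      then obtain n where n: "m = n + 2" using le_Suc_ex by (metis add.commute)
      show ?thesis unfolding n T_def R_def using nz assms by (auto simp: power_add power2_eq_square add.commute[of 3])
    qed
    fix m :: nat assume m: "m \<noteq> 1"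
    show "dx (T m) q = T (m + 2) q" "dy (T m) q = T (m + 3) q"
      "dz j (T m) q = R m q" "dw j (T m) q = R (m + 1) q"
      using assms by (simp_all add: T_pd[OF m])
    show "dz i (T m) q = 0" "dw i (T m) q = 0" if "i \<noteq> d0" "i \<noteq> j" for i
      using that by (simp_all add: T_pd[OF m])
  qed
qed

lemma laurent_cdiff: "p \<in> U \<Longrightarrow> j \<noteq> d0 \<Longrightarrow> cdiff (laurent j) p"
  unfolding laurent_def[abs_def] by (simp add: slope_nz coord_nz)

lemma laurent_pderiv:
  assumes "p \<in> U" "j \<noteq> d0"
  shows "pderiv_at k (laurent j) p =
    (if k = Inl j then 1 / ((slope j p)\<^sup>2 * p $ Inr j) else if k = Inr j then 1 / (slope j p * p $ Inr j) else 0)"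
  unfolding laurent_def[abs_def] using assms slope_nz[OF assms]
  by (simp add: coord_nz power2_eq_square)

text \<open>
  The second derivative in \<open>w\<^sub>j\<close> vanishes, so the family is supported in the degrees \<open>n e\<^sub>j\<close> and \<open>e + n e\<^sub>j\<close>.
\<close>

lemma laurent_solution:
  assumes "j \<noteq> d0"
  shows "solution (laurent j)"
proof (rule solutionI)
  show "holo (laurent j)" unfolding holo_def using laurent_cdiff[OF _ assms] by blast
  fix p assume p: "p \<in> U"
  show "2 * p $ Inl d0 * dx (laurent j) p + 3 * p $ Inr d0 * dy (laurent j) p
        + (\<Sum>i\<in>UNIV - {d0}. p $ Inr i * dw i (laurent j) p) = laurent j p"
    using assms slope_nz[OF p assms] coord_nz[OF p, of "Inr j"]
    by (subst sum_only[OF assms]) (auto simp: laurent_pderiv p laurent_def)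
  show "p $ Inl i * dz i (laurent j) p + p $ Inr i * dw i (laurent j) p = 0" if "i \<noteq> d0" for i
    using assms that slope_nz[OF p assms] coord_nz[OF p, of "Inr j"]
    by (auto simp: laurent_pderiv p slope_def field_simps power2_eq_square)
next
  fix p u assume p: "p \<in> U" and u: "u \<in> ker_int (hole_matrix d0)"
  define T where "T = (\<lambda>m::nat. if m = 0 then laurent j else (\<lambda>p. 0))"
  define R where "R = (\<lambda>m::nat. if m = 0 then (\<lambda>p. 1 / ((slope j p)\<^sup>2 * p $ Inr j))
     else if m = 1 then (\<lambda>p. 1 / (slope j p * p $ Inr j)) else (\<lambda>p. 0))"
  show "multi_pderiv (pos_part u) (laurent j) p = multi_pderiv (neg_part u) (laurent j) p"
  proof (rule toric_tower[OF open_U assms, where T = T and R = R])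
    show "u \<in> ker_int (hole_matrix d0)" "p \<in> U" by fact+
    fix q assume q: "q \<in> U"
    note nz = slope_nz[OF q assms] coord_nz[OF q, of "Inr j"]
    show "laurent j q = T 0 q" by (simp add: T_def)
    show "cdiff (R m) q" for m unfolding R_def using nz by auto
    have R_pd: "pderiv_at k (R m) q = 0" if "k \<noteq> Inl j" "k \<noteq> Inr j" for k m
      unfolding R_def using nz that by (auto simp: power_add)
    show "dx (R m) q = R (m + 2) q" "dy (R m) q = R (m + 3) q" for m
      using assms by (subst R_pd; simp add: R_def)+
    show "dz i (R m) q = 0" "dw i (R m) q = 0" if "i \<noteq> d0" "i \<noteq> j" for i m
      by (rule R_pd, use that in auto)+
    show "dw j (R m) q = dz j (R (m + 1)) q" for m
      unfolding R_def using nz assms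
      by (auto simp: field_simps power2_eq_square)
    fix m :: nat assume m: "m \<noteq> 1"
    show "dx (T m) q = T (m + 2) q" "dy (T m) q = T (m + 3) q"
      "dz j (T m) q = R m q" "dw j (T m) q = R (m + 1) q"
      using assms m q by (auto simp: T_def R_def laurent_pderiv)
    show "dz i (T m) q = 0" "dw i (T m) q = 0" if "i \<noteq> d0" "i \<noteq> j" for i
      using that assms q by (auto simp: T_def laurent_pderiv)
  qed
qed

end

section \<open>Solutions in the variables of the columns 2e and 3e\<close>

context hole_chart begin

lemma holoD: "holo f \<Longrightarrow> p \<in> U \<Longrightarrow> cdiff f p" by (simp add: holo_def)

lemma holo_pderiv: "holo f \<Longrightarrow> holo (pderiv_at k f)"
  unfolding holo_def using cdiff_pderiv[OF open_U] by blast

lemma pd_cong: "p \<in> U \<Longrightarrow> (\<And>q. q \<in> U \<Longrightarrow> f q = g q) \<Longrightarrow> pderiv_at k f p = pderiv_at k g p"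
  using pderiv_at_cong[OF open_U] by blast

lemma pd_commute: "holo f \<Longrightarrow> p \<in> U \<Longrightarrow> pderiv_at k (pderiv_at l f) p = pderiv_at l (pderiv_at k f) p"
  using pderiv_commute[OF open_U] holoD by blast

text \<open>
  The candidates for solutions that do not involve the \<open>z\<^sub>j\<close> and \<open>w\<^sub>j\<close>: the cubic equation is the one to which all toric
  equations between the columns \<open>2e\<close> and \<open>3e\<close> reduce.
\<close>

definition airy_type :: "(complex ^ ('d + 'd) \<Rightarrow> complex) \<Rightarrow> bool" where
  "airy_type f \<longleftrightarrow> holo f \<and> (\<forall>p\<in>U.
     (\<forall>k. k \<noteq> Inl d0 \<longrightarrow> k \<noteq> Inr d0 \<longrightarrow> pderiv_at k f p = 0) \<and>
     dx (dx (dx f)) p = dy (dy f) p \<and>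
     2 * p $ Inl d0 * dx f p + 3 * p $ Inr d0 * dy f p = f p)"

lemma airy_typeD:
  assumes "airy_type f" "p \<in> U"
  shows "k \<noteq> Inl d0 \<Longrightarrow> k \<noteq> Inr d0 \<Longrightarrow> pderiv_at k f p = 0"
    "dx (dx (dx f)) p = dy (dy f) p"
    "2 * p $ Inl d0 * dx f p + 3 * p $ Inr d0 * dy f p = f p"
  using assms unfolding airy_type_def by blast+

lemma iter_pd_zero:
  assumes "\<And>q. q \<in> U \<Longrightarrow> f q = 0" "p \<in> U"
  shows "(pderiv_at k ^^ n) f p = 0"
proof -
  have "pderiv_at k (\<lambda>_. 0) = (\<lambda>_::complex ^ ('d + 'd). 0)" by auto
  then have "(pderiv_at k ^^ n) (\<lambda>_. 0) = (\<lambda>_::complex ^ ('d + 'd). 0)" by (induction n) auto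
  moreover have "(pderiv_at k ^^ n) f p = (pderiv_at k ^^ n) (\<lambda>_. 0) p"
    by (rule pderiv_iter_cong[OF open_U]) (use assms in auto)
  ultimately show ?thesis by simp
qed

text \<open>
  In degree \<open>m e\<close> the family consists of the derivative of order \<open>(m - 3 (m mod 2)) / 2\<close> in \<open>x\<close> and \<open>m mod 2\<close> in \<open>y\<close>: the
  cubic equation trades two derivatives in \<open>y\<close> for three in \<open>x\<close>.
\<close>

lemma airy_type_solution:
  assumes f: "airy_type f" and "j \<noteq> d0"
  shows "solution f"
proof (rule solutionI)
  show hf: "holo f" using f by (simp add: airy_type_def)
  note k = airy_typeD[OF f]
  show "2 * p $ Inl d0 * dx f p + 3 * p $ Inr d0 * dy f p
        + (\<Sum>j\<in>UNIV - {d0}. p $ Inr j * dw j f p) = f p" if "p \<in> U" for p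
    using k[OF that] by simp
  show "p $ Inl i * dz i f p + p $ Inr i * dw i f p = 0" if "p \<in> U" "i \<noteq> d0" for p i
    using k[OF that(1)] that(2) by simp
  fix p u assume p: "p \<in> U" and u: "u \<in> ker_int (hole_matrix d0)"
  define T where "T = (\<lambda>m. (dx ^^ ((m - 3 * (m mod 2)) div 2)) ((dy ^^ (m mod 2)) f))"
  have hit: "\<And>q. q \<in> U \<Longrightarrow> cdiff ((pderiv_at k ^^ n) g) q" if "holo g" for k n g
    using cdiff_pderiv_iter[OF open_U holoD[OF that]] .
  have T0: "pderiv_at k (T m) q = 0" if "k \<noteq> Inl d0" "k \<noteq> Inr d0" "q \<in> U" for k m q
  proof -
    have "pderiv_at k ((dy ^^ (m mod 2)) f) q = 0" if "q \<in> U" for q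
      using pderiv_iter_commute[OF open_U holoD[OF hf] that] iter_pd_zero[OF k(1)[OF _ \<open>k \<noteq> Inl d0\<close> \<open>k \<noteq> Inr d0\<close>] that] by simp
    then show ?thesis
      unfolding T_def using pderiv_iter_commute[OF open_U hit[OF hf] that(3)] iter_pd_zero that(3) by simp
  qed
  have TX: "dx (T m) q = T (m + 2) q" if "m \<noteq> 1" for m q
  proof -
    have "(m + 2 - 3 * ((m + 2) mod 2)) div 2 = Suc ((m - 3 * (m mod 2)) div 2)"
      using that by (cases "even m") (auto elim!: oddE)
    then show ?thesis unfolding T_def by simp
  qed
  have TY: "dy (T m) q = T (m + 3) q" if "m \<noteq> 1" "q \<in> U" for m q
  proof (cases "even m")
    case True
    then obtain n where n: "m = 2 * n" by auto
    have "dy ((dx ^^ n) f) q = (dx ^^ n) (dy f) q"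
      by (rule pderiv_iter_commute[OF open_U holoD[OF hf] that(2)])
    moreover have "T m = (dx ^^ n) f" by (simp add: T_def n)
    moreover have "T (m + 3) = (dx ^^ n) (dy f)"
    proof -
      have "(2 * n + 3) mod 2 = 1" by presburger
      then show ?thesis unfolding T_def n by simp
    qed
    ultimately show ?thesis by simp
  next
    case False
    then obtain l where l: "m = 2 * l + 1" by (rule oddE)
    with that(1) obtain n where "l = Suc n" by (cases l) auto
    then have n: "m = 2 * n + 3" using l by simp
    have Tm: "T m = (dx ^^ n) (dy f)"
    proof -
      have "(2 * n + 3) mod 2 = 1" by presburger
      then show ?thesis unfolding T_def n by simp
    qed
    have Tm3: "T (m + 3) = (dx ^^ (n + 3)) f"
      unfolding T_def n by (simp add: add.commute)
    have "dy (T m) q = (dx ^^ n) (dy (dy f)) q"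
      unfolding Tm by (rule pderiv_iter_commute[OF open_U holoD[OF holo_pderiv[OF hf]] that(2)])
    also have "\<dots> = (dx ^^ n) ((dx ^^ 3) f) q"
      by (rule pderiv_iter_cong[OF open_U _ that(2)]) (simp add: k(2) numeral_3_eq_3)
    finally show ?thesis unfolding Tm3 funpow_add by simp
  qed
  have "T 0 = f" by (simp add: T_def)
  then show "multi_pderiv (pos_part u) f p = multi_pderiv (neg_part u) f p"
    by (intro toric_tower[OF open_U assms(2), where T = T and R = "\<lambda>_ _. 0"])
       (use p u TX TY T0 assms(2) in simp_all)
qed

end

lemma det3_scale:
  "det3 (\<alpha> * a0) (\<beta> * a1) (\<gamma> * a2) (\<alpha> * b0) (\<beta> * b1) (\<gamma> * b2) (\<alpha> * c0) (\<beta> * c1) (\<gamma> * c2)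
    = \<alpha> * \<beta> * \<gamma> * det3 a0 a1 a2 b0 b1 b2 c0 c1 c2"
  by (simp add: det3_def algebra_simps)

text \<open>
  A continuous logarithm exists by simple connectedness.  It is complex differentiable because it differs
  locally by a constant from the principal branch.
\<close>

lemma cube_root_exists:
  fixes U :: "(complex ^ 'n::finite) set"
  assumes U: "open U" "simply_connected U" and f: "\<And>p. p \<in> U \<Longrightarrow> cdiff f p" "\<And>p. p \<in> U \<Longrightarrow> f p \<noteq> 0"
  obtains r where "\<And>p. p \<in> U \<Longrightarrow> cdiff r p" "\<And>p. p \<in> U \<Longrightarrow> r p ^ 3 = f p"
proof -
  have contf: "continuous_on U f" using f(1) cdiff_continuous by (auto intro: continuous_at_imp_continuous_on)
  have "\<exists>L. continuous_on U L \<and> (\<forall>p\<in>U. f p = exp (L p))"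
    by (rule continuous_logarithm_on_simply_connected[OF contf U(2) open_imp_locally_path_connected[OF U(1)] f(2)])
       blast+
  then obtain L where L: "continuous_on U L" "\<And>p. p \<in> U \<Longrightarrow> f p = exp (L p)" by blast
  have cL: "cdiff L p0" if p0: "p0 \<in> U" for p0
  proof -
    have "isCont L p0" using L(1) U(1) p0 by (simp add: continuous_on_eq_continuous_at)
    then have "(L \<longlongrightarrow> L p0) (nhds p0)" by (simp add: isCont_def tendsto_at_iff_tendsto_nhds)
    then have "\<forall>\<^sub>F p in nhds p0. dist (L p) (L p0) < pi" by (rule tendstoD[OF _ pi_gt_zero])
    moreover have "\<forall>\<^sub>F p in nhds p0. p \<in> U" using U(1) p0 by (simp add: eventually_nhds_in_open)
    ultimately have "\<forall>\<^sub>F p in nhds p0. p \<in> U \<and> dist (L p) (L p0) < pi" by eventually_elim auto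
    then obtain V where V: "open V" "p0 \<in> V" "\<And>p. p \<in> V \<Longrightarrow> p \<in> U \<and> dist (L p) (L p0) < pi"
      unfolding eventually_nhds by blast
    have eq: "L p0 + Ln (f p / f p0) = L p" if "p \<in> V" for p
    proof -
      have "\<bar>Im (L p - L p0)\<bar> < pi"
        using V(3)[OF that] abs_Im_le_cmod[of "L p - L p0"] by (simp add: dist_norm)
      then have "Ln (exp (L p - L p0)) = L p - L p0" by (intro Ln_exp) auto
      moreover have "exp (L p - L p0) = f p / f p0" using L(2) V(3)[OF that] p0 by (simp add: exp_diff)
      ultimately show ?thesis by simp
    qed
    have "cdiff (\<lambda>p. f p / f p0) p0" using f p0 by simp
    moreover have "(Ln has_field_derivative inverse (f p0 / f p0)) (at (f p0 / f p0))"
      using f(2)[OF p0] by (intro has_field_derivative_Ln) auto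
    ultimately have "cdiff (\<lambda>p. Ln (f p / f p0)) p0" by (rule cdiff_compose)
    then have "cdiff (\<lambda>p. L p0 + Ln (f p / f p0)) p0" by simp
    then show ?thesis by (rule cdiff_cong[OF _ V(1,2) eq])
  qed
  show ?thesis
  proof (rule that[of "\<lambda>p. exp (L p / 3)"])
    show "cdiff (\<lambda>p. exp (L p / 3)) p" if "p \<in> U" for p using cL[OF that] by simp
    show "exp (L p / 3) ^ 3 = f p" if "p \<in> U" for p
      using L(2)[OF that] exp_of_nat_mult[of 3 "L p / 3"] by simp
  qed
qed

context hole_chart begin

definition wronskian :: "(complex ^ ('d + 'd) \<Rightarrow> complex) \<Rightarrow> (complex ^ ('d + 'd) \<Rightarrow> complex)
    \<Rightarrow> (complex ^ ('d + 'd) \<Rightarrow> complex) \<Rightarrow> complex ^ ('d + 'd) \<Rightarrow> complex" where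
  "wronskian f g h p = det3
     (f p) (dx f p) (dx (dx f) p)
     (g p) (dx g p) (dx (dx g) p)
     (h p) (dx h p) (dx (dx h) p)"

text \<open>
  With \<open>r\<^sup>3 = y\<close> and \<open>v = x / r\<^sup>2\<close> the functions are \<open>r g (v)\<close>; their derivatives in \<open>x\<close> are \<open>g' (v) / r\<close> and \<open>g'' (v) / r\<^sup>3\<close>, so the
  Wronskian is that of the functions \<open>g\<close> divided by \<open>r\<^sup>3\<close>.
\<close>

lemma airy_type_basis:
  assumes "simply_connected U"
  obtains \<phi> :: "nat \<Rightarrow> complex ^ ('d + 'd) \<Rightarrow> complex" where "\<forall>a. airy_type (\<phi> a)"
    "\<forall>p\<in>U. wronskian (\<phi> 0) (\<phi> 1) (\<phi> 2) p \<noteq> 0"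
proof -
  obtain g g1 g2 :: "nat \<Rightarrow> complex \<Rightarrow> complex" where
    D: "\<And>a v. (g a has_field_derivative g1 a v) (at v)"
    "\<And>a v. (g1 a has_field_derivative g2 a v) (at v)"
    "\<And>a v. (g2 a has_field_derivative (4 * v\<^sup>2 * g2 a v + 6 * v * g1 a v - 2 * g a v) / 9) (at v)"
    and W: "\<And>v. det3 (g 0 v) (g1 0 v) (g2 0 v) (g 1 v) (g1 1 v) (g2 1 v) (g 2 v) (g1 2 v) (g2 2 v) \<noteq> 0"
    using airy_fundamental_system by metis
  obtain r where r: "\<And>p. p \<in> U \<Longrightarrow> cdiff r p" "\<And>p. p \<in> U \<Longrightarrow> r p ^ 3 = p $ Inr d0"
    using cube_root_exists[OF open_U assms, of "\<lambda>p. p $ Inr d0"] coord_nz by auto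
  have r_nz: "r p \<noteq> 0" if "p \<in> U" for p using r(2)[OF that] coord_nz[OF that, of "Inr d0"] by auto
  have r_pd: "pderiv_at k r p = (if k = Inr d0 then 1 / (3 * (r p)\<^sup>2) else 0)" if "p \<in> U" for k p
  proof -
    have "pderiv_at k (\<lambda>p. r p ^ 3) p = pderiv_at k (\<lambda>p. p $ Inr d0) p"
      by (rule pd_cong[OF that]) (use r in auto)
    then have "3 * (r p)\<^sup>2 * pderiv_at k r p = (if k = Inr d0 then 1 else 0)" using r(1)[OF that] by simp
    then show ?thesis using r_nz[OF that] by (auto simp: field_simps split: if_splits)
  qed
  define v where "v = (\<lambda>p. p $ Inl d0 / (r p)\<^sup>2)"
  have cv: "cdiff v p" if "p \<in> U" for p unfolding v_def using r(1)[OF that] r_nz[OF that] by simp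
  have x_eq: "p $ Inl d0 = v p * (r p)\<^sup>2" if "p \<in> U" for p using r_nz[OF that] by (simp add: v_def)
  have v_pd: "pderiv_at k v p = (if k = Inl d0 then 1 / (r p)\<^sup>2 else if k = Inr d0 then - 2 * v p / (3 * r p ^ 3) else 0)" if "p \<in> U" for k p
  proof -
    have *: "pderiv_at k v p = ((if k = Inl d0 then 1 else 0) * (r p)\<^sup>2 - p $ Inl d0 * (2 * r p * pderiv_at k r p)) / ((r p)\<^sup>2)\<^sup>2"
      unfolding v_def using r(1)[OF that] r_nz[OF that] by simp
    show ?thesis unfolding * r_pd[OF that] x_eq[OF that]
      using r_nz[OF that] by (auto simp: divide_simps power2_eq_square power3_eq_cube)
  qed
  have cg: "cdiff (\<lambda>p. g a (v p)) p" "cdiff (\<lambda>p. g1 a (v p)) p" "cdiff (\<lambda>p. g2 a (v p)) p" if "p \<in> U" for a p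
    using cdiff_compose[OF cv[OF that] D(1)] cdiff_compose[OF cv[OF that] D(2)] cdiff_compose[OF cv[OF that] D(3)] .
  have g_pd: "pderiv_at k (\<lambda>p. g a (v p)) p = g1 a (v p) * pderiv_at k v p"
    "pderiv_at k (\<lambda>p. g1 a (v p)) p = g2 a (v p) * pderiv_at k v p"
    "pderiv_at k (\<lambda>p. g2 a (v p)) p = (4 * (v p)\<^sup>2 * g2 a (v p) + 6 * v p * g1 a (v p) - 2 * g a (v p)) / 9 * pderiv_at k v p"
    if "p \<in> U" for a p k
    using pderiv_compose[OF cv[OF that] D(1)] pderiv_compose[OF cv[OF that] D(2)] pderiv_compose[OF cv[OF that] D(3)] .
  define \<phi> where "\<phi> = (\<lambda>a p. r p * g a (v p))"
  have \<phi>_p: "\<phi> a p = r p * g a (v p)" for a p by (simp add: \<phi>_def)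
  have c\<phi>: "holo (\<phi> a)" for a unfolding holo_def \<phi>_def using r(1) cg by simp
  have X1: "dx (\<phi> a) p = g1 a (v p) / r p" if "p \<in> U" for a p
    unfolding \<phi>_def using r(1)[OF that] cg[OF that] r_nz[OF that]
    by (simp add: g_pd[OF that] v_pd[OF that] r_pd[OF that] power2_eq_square)
  have Y1: "dy (\<phi> a) p = (g a (v p) - 2 * v p * g1 a (v p)) / (3 * (r p)\<^sup>2)" if "p \<in> U" for a p
    unfolding \<phi>_def using r(1)[OF that] cg[OF that] r_nz[OF that]
    by (simp add: g_pd[OF that] v_pd[OF that] r_pd[OF that] field_simps power2_eq_square power3_eq_cube)
  have K1: "pderiv_at k (\<phi> a) p = 0" if "p \<in> U" "k \<noteq> Inl d0" "k \<noteq> Inr d0" for k a p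
    unfolding \<phi>_def using r(1)[OF that(1)] cg[OF that(1)] that(2,3)
    by (simp add: g_pd[OF that(1)] v_pd[OF that(1)] r_pd[OF that(1)])
  have X2: "dx (dx (\<phi> a)) p = g2 a (v p) / r p ^ 3" if "p \<in> U" for a p
  proof -
    have "dx (dx (\<phi> a)) p = dx (\<lambda>p. g1 a (v p) / r p) p"
      by (rule pd_cong[OF that X1])
    then show ?thesis using r(1)[OF that] cg[OF that] r_nz[OF that]
      by (simp add: g_pd[OF that] v_pd[OF that] r_pd[OF that] field_simps power2_eq_square power3_eq_cube)
  qed
  let ?g3 = "\<lambda>a v. 4 * v\<^sup>2 * g2 a v + 6 * v * g1 a v - 2 * g a v"
  have X3: "dx (dx (dx (\<phi> a))) p
      = ?g3 a (v p) / (9 * r p ^ 5)" if "p \<in> U" for a p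
  proof -
    have "dx (dx (dx (\<phi> a))) p = dx (\<lambda>p. g2 a (v p) / r p ^ 3) p"
      by (rule pd_cong[OF that X2])
    also have "\<dots> = (?g3 a (v p) / 9 * (1 / (r p)\<^sup>2) * r p ^ 3) / (r p ^ 3)\<^sup>2"
      using r(1)[OF that] cg[OF that] r_nz[OF that]
      by (simp add: g_pd[OF that] v_pd[OF that] r_pd[OF that])
    also have "\<dots> = ?g3 a (v p) / (9 * r p ^ 5)"
      using r_nz[OF that] by (simp add: divide_simps flip: power_mult power_add)
    finally show ?thesis .
  qed
  have Y2: "dy (dy (\<phi> a)) p
      = ?g3 a (v p) / (9 * r p ^ 5)" if "p \<in> U" for a p
  proof -
    have "dy (dy (\<phi> a)) p = dy (\<lambda>p. (g a (v p) - 2 * v p * g1 a (v p)) / (3 * (r p)\<^sup>2)) p"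
      by (rule pd_cong[OF that Y1])
    also have "\<dots> = ((g1 a (v p) * dy v p - 2 * (dy v p * g1 a (v p) + v p * g2 a (v p) * dy v p)) * (3 * (r p)\<^sup>2)
         - (g a (v p) - 2 * v p * g1 a (v p)) * (6 * r p * dy r p)) / (3 * (r p)\<^sup>2)\<^sup>2"
      using r(1)[OF that] cg[OF that] r_nz[OF that] cv[OF that]
      by (simp add: g_pd[OF that] algebra_simps)
    also have "\<dots> = ?g3 a (v p) / (9 * r p ^ 5)"
      unfolding v_pd[OF that] r_pd[OF that] using r_nz[OF that]
      by (simp add: divide_simps flip: power_mult power_add) (simp add: algebra_simps eval_nat_numeral)
    finally show ?thesis .
  qed
  have "airy_type (\<phi> a)" for a
    unfolding airy_type_def
  proof (intro conjI ballI c\<phi> allI impI)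
    fix p assume p: "p \<in> U"
    show "pderiv_at k (\<phi> a) p = 0" if "k \<noteq> Inl d0" "k \<noteq> Inr d0" for k by (rule K1[OF p that])
    show "dx (dx (dx (\<phi> a))) p = dy (dy (\<phi> a)) p"
      by (simp only: X3[OF p] Y2[OF p])
    have y: "p $ Inr d0 = r p ^ 3" by (simp add: r(2)[OF p])
    show "2 * p $ Inl d0 * dx (\<phi> a) p + 3 * p $ Inr d0 * dy (\<phi> a) p = \<phi> a p"
      unfolding X1[OF p] Y1[OF p] x_eq[OF p] y using r_nz[OF p]
      by (simp add: \<phi>_def field_simps power2_eq_square power3_eq_cube)
  qed
  moreover have "wronskian (\<phi> 0) (\<phi> 1) (\<phi> 2) p \<noteq> 0" if "p \<in> U" for p
  proof -
    have "wronskian (\<phi> 0) (\<phi> 1) (\<phi> 2) p = r p * (1 / r p) * (1 / r p ^ 3) *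
       det3 (g 0 (v p)) (g1 0 (v p)) (g2 0 (v p)) (g 1 (v p)) (g1 1 (v p)) (g2 1 (v p)) (g 2 (v p)) (g1 2 (v p)) (g2 2 (v p))"
      unfolding wronskian_def X1[OF that] X2[OF that] \<phi>_p det3_scale[symmetric] by simp
    then show ?thesis using W[of "v p"] r_nz[OF that] by simp
  qed
  ultimately show ?thesis using that[of \<phi>] by blast
qed

end

section \<open>Relations satisfied by every solution\<close>

context hole_chart begin

text \<open>
  Derivatives in an explicitly given order are more convenient for single equations than multi-indices.
\<close>

lemma multi_pderiv_count_list:
  assumes "holo f" "p \<in> U"
  shows "multi_pderiv (count_list ks) f p = foldr pderiv_at ks f p"
  using assms(2)
proof (induction ks arbitrary: p)
  case Nil
  have "count_list [] = (\<lambda>_::'d + 'd. 0)" by auto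
  then show ?case by (simp only: multi_pderiv_0) simp
next
  case (Cons k ks)
  have "count_list (k # ks) = (count_list ks)(k := Suc (count_list ks k))" by auto
  then have "multi_pderiv (count_list (k # ks)) f p = pderiv_at k (multi_pderiv (count_list ks) f) p"
    by (simp only:) (rule multi_pderiv_Suc[OF open_U holoD[OF assms(1)] Cons.prems])
  also have "\<dots> = pderiv_at k (foldr pderiv_at ks f) p"
    by (rule pd_cong[OF Cons.prems Cons.IH])
  finally show ?case by (simp only: foldr.simps o_apply)
qed

lemma toric_relation:
  assumes f: "solution f" "p \<in> U" and disj: "set ks \<inter> set ls = {}"
    and deg: "\<And>i. (\<Sum>k\<leftarrow>ks. hole_matrix d0 $ i $ k) = (\<Sum>k\<leftarrow>ls. hole_matrix d0 $ i $ k)"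
  shows "foldr pderiv_at ks f p = foldr pderiv_at ls f p"
proof -
  define u :: "int ^ ('d + 'd)" where "u = (\<chi> k. int (count_list ks k) - int (count_list ls k))"
  have hf: "holo f" using f by (simp add: solution_def)
  have zero: "count_list ks k = 0 \<or> count_list ls k = 0" for k
    using disj by (metis count_list_0_iff disjoint_iff)
  have "pos_part u k = count_list ks k" "neg_part u k = count_list ls k" for k
    using zero[of k] by (auto simp: pos_part_def neg_part_def u_def)
  then have parts: "pos_part u = count_list ks" "neg_part u = count_list ls" by auto
  have count: "(\<Sum>k\<in>UNIV. c k * int (count_list xs k)) = (\<Sum>k\<leftarrow>xs. c k)" for c and xs :: "('d + 'd) list"
  proof (induction xs)
    case (Cons y ys)
    have "(\<Sum>k\<in>UNIV. c k * int (count_list (y # ys) k)) = (\<Sum>k\<in>UNIV. c k * int (count_list ys k) + (if k = y then c y else 0))"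
      by (intro sum.cong) (auto simp: algebra_simps)
    then show ?case using Cons by (simp add: sum.distrib)
  qed simp
  have "u \<in> ker_int (hole_matrix d0)"
    using deg by (simp add: ker_int_def vec_eq_iff matrix_vector_mult_def u_def right_diff_distrib sum_subtractf count)
  then have "multi_pderiv (pos_part u) f p = multi_pderiv (neg_part u) f p"
    using f unfolding solution_def solves_hypergeom_def by blast
  then show ?thesis unfolding parts using multi_pderiv_count_list[OF hf f(2)] by simp
qed

lemma toric_cubic:
  assumes "solution f" "p \<in> U"
  shows "dx (dx (dx f)) p = dy (dy f) p"
  using toric_relation[OF assms, of "[Inl d0, Inl d0, Inl d0]" "[Inr d0, Inr d0]"]
  by (simp add: hole_matrix_Inl hole_matrix_Inr)

lemma toric_quadrics:
  assumes "solution f" "p \<in> U" "j \<noteq> d0"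
  shows "dw j (dx f) p = dy (dz j f) p"
    and "dw j (dy f) p = dx (dx (dz j f)) p"
    and "dw j (dw j f) p = dx (dz j (dz j f)) p"
    and "i \<noteq> d0 \<Longrightarrow> i \<noteq> j \<Longrightarrow> dw i (dz j f) p = dz i (dw j f) p"
  using toric_relation[OF assms(1,2), of "[Inr j, Inl d0]" "[Inr d0, Inl j]"]
    toric_relation[OF assms(1,2), of "[Inr j, Inr d0]" "[Inl d0, Inl d0, Inl j]"]
    toric_relation[OF assms(1,2), of "[Inr j, Inr j]" "[Inl d0, Inl j, Inl j]"]
    toric_relation[OF assms(1,2), of "[Inr i, Inl j]" "[Inl i, Inr j]"] assms(3)
  by (auto simp: hole_matrix_Inl hole_matrix_Inr)

context
  fixes f and j :: 'd
  assumes f: "solution f" and j: "j \<noteq> d0"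
begin

lemma holo_f: "holo f" using f by (simp add: solution_def)

lemma holo_z_derivative: "holo (dz j f)" by (rule holo_pderiv[OF holo_f])

lemma w_derivative:
  assumes "q \<in> U" "i \<noteq> d0"
  shows "dw i f q = slope i q * dz i f q"
  using solution_euler(2)[OF f assms] coord_nz[OF assms(1), of "Inr i"]
  by (simp add: slope_def field_simps eq_neg_iff_add_eq_0)

lemma pd_w_derivative:
  assumes "q \<in> U" "i \<noteq> d0"
  shows "pderiv_at k (dw i f) q =
    slope i q * pderiv_at k (dz i f) q + pderiv_at k (slope i) q * dz i f q"
proof -
  have "pderiv_at k (dw i f) q = pderiv_at k (\<lambda>q. slope i q * dz i f q) q"
    by (rule pd_cong[OF assms(1) w_derivative]) (use assms(2) in auto)
  then show ?thesis using holoD[OF holo_pderiv[OF holo_f] assms(1)] coord_nz[OF assms(1), of "Inr i"] by simp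
qed

text \<open>
  The equation of the columns \<open>e\<^sub>i\<close>, \<open>e + e\<^sub>i\<close>, \<open>e\<^sub>j\<close>, \<open>e + e\<^sub>j\<close> says that \<open>s\<^sub>i - s\<^sub>j\<close> annihilates the mixed derivative.
  Differentiating once more in \<open>z\<^sub>i\<close> covers the points where \<open>s\<^sub>i = s\<^sub>j\<close>.
\<close>

lemma mixed_z_derivative:
  assumes q: "q \<in> U" and i: "i \<noteq> d0" "i \<noteq> j"
  shows "dz i (dz j f) q = 0"
proof -
  define m where "m = dz i (dz j f)"
  have hm: "holo m" unfolding m_def by (rule holo_pderiv[OF holo_z_derivative])
  have rel: "(slope i q - slope j q) * m q = 0" if "q \<in> U" for q
  proof -
    note nz = coord_nz[OF that, of "Inr i"] coord_nz[OF that, of "Inr j"]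
    have "dw i (dz j f) q = dz j (dw i f) q"
      by (rule pd_commute[OF holo_f that])
    also have "\<dots> = slope i q * m q"
      using pd_w_derivative[OF that i(1), of "Inl j"] i nz pd_commute[OF holo_f that] by (simp add: m_def)
    finally have "slope i q * m q = dz i (dw j f) q"
      using toric_quadrics(4)[OF f that j i] by simp
    also have "\<dots> = slope j q * m q"
      using pd_w_derivative[OF that j, of "Inl i"] i nz by (simp add: m_def)
    finally show ?thesis by (simp add: algebra_simps)
  qed
  note nz = coord_nz[OF q, of "Inr i"] coord_nz[OF q, of "Inr j"]
  have "dz i (\<lambda>q. (slope i q - slope j q) * m q) q = dz i (\<lambda>_. 0) q"
    by (rule pd_cong[OF q rel])
  then have "(slope i q - slope j q) * dz i m q - m q / q $ Inr i = 0"
    using nz i holoD[OF hm q] by simp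
  then have "m q = 0" using rel[OF q] nz by (cases "slope i q = slope j q") auto
  then show ?thesis by (simp add: m_def)
qed

text \<open>
  The first derivatives of \<open>p = \<partial>f/\<partial>z\<^sub>j\<close> are determined by those in \<open>x\<close> and \<open>z\<^sub>j\<close>.
\<close>

lemma z_derivative_pderiv:
  assumes q: "q \<in> U"
  shows "pderiv_at k (dz j f) q =
    (if k = Inl d0 \<or> k = Inl j then pderiv_at k (dz j f) q
     else if k = Inr d0 then slope j q * dx (dz j f) q
     else if k = Inr j then slope j q * dz j (dz j f) q - dz j f q / q $ Inr j
     else 0)"
proof -
  note nz = coord_nz[OF q, of "Inr j"]
  have Y: "dy (dz j f) q = slope j q * dx (dz j f) q"
    using toric_quadrics(1)[OF f q j] pd_commute[OF holo_f q] pd_w_derivative[OF q j, of "Inl d0"] j nz by simp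
  have W: "dw j (dz j f) q =
      slope j q * dz j (dz j f) q - dz j f q / q $ Inr j"
    using pd_commute[OF holo_f q] pd_w_derivative[OF q j, of "Inl j"] j nz by simp
  have Wi: "dw i (dz j f) q = 0" if "i \<noteq> d0" "i \<noteq> j" for i
    using pd_commute[OF holo_f q, of "Inr i" "Inl j"] pd_w_derivative[OF q that(1), of "Inl j"] that
      mixed_z_derivative[OF q that] pd_commute[OF holo_f q, of "Inl j" "Inl i"] coord_nz[OF q, of "Inr i"] by simp
  show ?thesis using Y W Wi mixed_z_derivative[OF q] by (cases k) auto
qed

text \<open>
  The first derivatives of \<open>\<partial>p/\<partial>x\<close> are expressed by \<open>p\<close>, \<open>\<partial>p/\<partial>x\<close> and \<open>\<partial>p/\<partial>z\<^sub>j\<close>, which closes the system.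
\<close>

lemma xz_derivative_pderiv:
  assumes q: "q \<in> U"
  defines "p \<equiv> dz j f q" and "p' \<equiv> dx (dz j f) q"
    and "r \<equiv> dz j (dz j f) q"
  shows "pderiv_at k (dx (dz j f)) q =
    (if k = Inl d0 then (slope j q)\<^sup>2 * p' else if k = Inr d0 then slope j q ^ 3 * p'
     else if k = Inl j then (slope j q)\<^sup>2 * r - 2 * slope j q * p / q $ Inr j
     else if k = Inr j then slope j q * ((slope j q)\<^sup>2 * r - 2 * slope j q * p / q $ Inr j) - p' / q $ Inr j
     else 0)"
proof -
  note nz = coord_nz[OF q, of "Inr j"]
  note cp = holoD[OF holo_z_derivative q] holoD[OF holo_pderiv[OF holo_z_derivative] q] holoD[OF holo_pderiv[OF holo_pderiv[OF holo_z_derivative]] q]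
  \<comment> \<open>each derivative of \<open>\<partial>p/\<partial>x\<close> is computed as the derivative in \<open>x\<close> of a known derivative of \<open>p\<close>\<close>
  have comm: "pderiv_at k (dx (dz j f)) q = dx (pderiv_at k (dz j f)) q" for k
    by (rule pd_commute[OF holo_z_derivative q])
  have XX: "dx (dx (dz j f)) q = (slope j q)\<^sup>2 * p'"
  proof -
    have "dx (dx (dz j f)) q = dy (dw j f) q"
      using toric_quadrics(2)[OF f q j] pd_commute[OF holo_f q, of "Inr j" "Inr d0"] by simp
    also have "\<dots> = slope j q * dy (dz j f) q"
      using pd_w_derivative[OF q j, of "Inr d0"] j nz by simp
    also have "dy (dz j f) q = slope j q * p'"
      using z_derivative_pderiv[OF q, of "Inr d0"] j by (simp add: p'_def)
    finally show ?thesis by (simp add: power2_eq_square)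
  qed
  have YX: "dy (dx (dz j f)) q = slope j q ^ 3 * p'"
  proof -
    have "dx (dy (dz j f)) q
        = dx (\<lambda>q. slope j q * dx (dz j f) q) q"
      by (rule pd_cong[OF q]) (simp add: z_derivative_pderiv[of _ "Inr d0"])
    then show ?thesis unfolding comm using cp nz j XX by (simp add: power2_eq_square power3_eq_cube)
  qed
  have ZX: "dz j (dx (dz j f)) q = (slope j q)\<^sup>2 * r - 2 * slope j q * p / q $ Inr j"
  proof -
    have "dz j (dx (dz j f)) q = dx (dz j (dz j f)) q"
      by (rule comm)
    also have "\<dots> = dw j (dw j f) q" by (rule toric_quadrics(3)[OF f q j, symmetric])
    also have "\<dots> = slope j q * dw j (dz j f) q - slope j q / q $ Inr j * p"
      using pd_w_derivative[OF q j, of "Inr j"] nz by (simp add: p_def)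
    also have "dw j (dz j f) q = slope j q * r - p / q $ Inr j"
      using z_derivative_pderiv[OF q, of "Inr j"] j by (simp add: p_def r_def)
    finally show ?thesis by (simp add: algebra_simps power2_eq_square)
  qed
  have WX: "dw j (dx (dz j f)) q =
      slope j q * ((slope j q)\<^sup>2 * r - 2 * slope j q * p / q $ Inr j) - p' / q $ Inr j"
  proof -
    have "dx (dw j (dz j f)) q
        = dx (\<lambda>q. slope j q * dz j (dz j f) q - dz j f q / q $ Inr j) q"
      by (rule pd_cong[OF q]) (use j in \<open>simp add: z_derivative_pderiv[of _ "Inr j"]\<close>)
    also have "\<dots> = slope j q * dx (dz j (dz j f)) q - p' / q $ Inr j"
      using cp nz j by (simp add: p'_def power2_eq_square)
    also have "dx (dz j (dz j f)) q = (slope j q)\<^sup>2 * r - 2 * slope j q * p / q $ Inr j"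
      using ZX unfolding comm .
    finally show ?thesis unfolding comm .
  qed
  have rest: "pderiv_at k (dx (dz j f)) q = 0"
    if "k \<noteq> Inl d0" "k \<noteq> Inr d0" "k \<noteq> Inl j" "k \<noteq> Inr j" for k
  proof -
    have "dx (pderiv_at k (dz j f)) q = dx (\<lambda>_. 0) q"
      by (rule pd_cong[OF q]) (use that in \<open>simp add: z_derivative_pderiv[of _ k]\<close>)
    then show ?thesis unfolding comm by simp
  qed
  show ?thesis using XX YX ZX WX rest by auto
qed

lemma euler_z_derivative:
  assumes q: "q \<in> U"
  shows "(2 * q $ Inl d0 + 3 * q $ Inr d0 * slope j q) * dx (dz j f) q
    = 2 * dz j f q - q $ Inr j * slope j q * dz j (dz j f) q"
proof -
  note cf = holoD[OF holo_pderiv[OF holo_f] q]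
  have "dz j (\<lambda>p. 2 * p $ Inl d0 * dx f p + 3 * p $ Inr d0 * dy f p
        + (\<Sum>i\<in>UNIV - {d0}. p $ Inr i * dw i f p)) q = dz j f q"
    by (rule pd_cong[OF q solution_euler(1)[OF f]])
  then have "2 * q $ Inl d0 * dz j (dx f) q + 3 * q $ Inr d0 * dz j (dy f) q
        + (\<Sum>i\<in>UNIV - {d0}. q $ Inr i * dz j (dw i f) q) = dz j f q"
    using cf j by simp
  moreover have "(\<Sum>i\<in>UNIV - {d0}. q $ Inr i * dz j (dw i f) q)
      = q $ Inr j * dz j (dw j f) q"
  proof (rule sum_only[OF j])
    fix i assume i: "i \<noteq> d0" "i \<noteq> j"
    have "dz j (dw i f) q = dw i (dz j f) q"
      by (rule pd_commute[OF holo_f q])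
    then show "q $ Inr i * dz j (dw i f) q = 0"
      using z_derivative_pderiv[OF q, of "Inr i"] i by simp
  qed
  ultimately have e: "2 * q $ Inl d0 * dz j (dx f) q + 3 * q $ Inr d0 * dz j (dy f) q
        + q $ Inr j * dz j (dw j f) q = dz j f q" by simp
  have c: "dz j (dx f) q = dx (dz j f) q"
    "dz j (dy f) q = slope j q * dx (dz j f) q"
    "dz j (dw j f) q
      = slope j q * dz j (dz j f) q - dz j f q / q $ Inr j"
    using pd_commute[OF holo_f q, of "Inl j" "Inl d0"]
      trans[OF pd_commute[OF holo_f q, of "Inl j" "Inr d0"] z_derivative_pderiv[OF q]]
      trans[OF pd_commute[OF holo_f q, of "Inl j" "Inr j"] z_derivative_pderiv[OF q]] j by simp_all
  show ?thesis using e coord_nz[OF q, of "Inr j"] unfolding c by (simp add: algebra_simps)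
qed

text \<open>
  For the combination \<open>a G + c V\<close> of the two solutions attached to \<open>j\<close> one computes
  \<open>\<partial>p/\<partial>x = - a exp (P) / w\<^sub>j\<close> and \<open>s\<^sub>j\<^sup>2 w\<^sub>j p = c - a exp (P)\<close>, where \<open>p = \<partial>/\<partial>z\<^sub>j (a G + c V)\<close> and
  \<open>P = x s\<^sub>j\<^sup>2 + y s\<^sub>j\<^sup>3\<close>.  Solving for \<open>a\<close> and \<open>c\<close> yields expressions that make sense for every solution, and the
  closed system shows that they are constant.
\<close>

lemma residue_constants:
  assumes "connected U"
  obtains a c where "\<forall>q\<in>U. dz j f q
    = a * dz j (endpoint_value d0 j) q + c * dz j (laurent j) q"
proof -
  define P where "P = (\<lambda>q. q $ Inl d0 * slope j q ^ 2 + q $ Inr d0 * slope j q ^ 3)"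
  \<comment> \<open>\<open>A\<close> and \<open>C\<close> recover the coefficients \<open>a\<close> and \<open>c\<close>\<close>
  define A where "A = (\<lambda>q. - (q $ Inr j * dx (dz j f) q * exp (- P q)))"
  define C where "C = (\<lambda>q. (slope j q)\<^sup>2 * q $ Inr j * dz j f q
      - q $ Inr j * dx (dz j f) q)"
  have cP: "cdiff P q" if "q \<in> U" for q using coord_nz[OF that, of "Inr j"] by (simp add: P_def)
  have cA: "cdiff A q" and cC: "cdiff C q" if "q \<in> U" for q
    using holoD[OF holo_z_derivative that] holoD[OF holo_pderiv[OF holo_z_derivative] that] cP[OF that] coord_nz[OF that, of "Inr j"]
    by (simp_all add: A_def C_def)
  have zero: "pderiv_at k A q = 0" "pderiv_at k C q = 0" if q: "q \<in> U" for q k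
  proof -
    define x y w s where "x = q $ Inl d0" and "y = q $ Inr d0" and "w = q $ Inr j" and "s = slope j q"
    define p p' r where "p = dz j f q" and "p' = dx (dz j f) q"
      and "r = dz j (dz j f) q"
    define t where "t = s\<^sup>2 * r - 2 * s * p / w"
    note nz = coord_nz[OF q, of "Inr j"]
    have w: "w \<noteq> 0" using nz by (simp add: w_def)
    note cp = holoD[OF holo_z_derivative q] holoD[OF holo_pderiv[OF holo_z_derivative] q]
    have wt: "w * t = s * (w * s * r - 2 * p)" using w by (simp add: t_def field_simps power2_eq_square)
    have "p' * (2 * x * s + 3 * y * s\<^sup>2) = s * ((2 * x + 3 * y * s) * p')"
      by (simp add: algebra_simps power2_eq_square)
    also have "(2 * x + 3 * y * s) * p' = 2 * p - w * s * r"
      unfolding x_def y_def s_def p'_def p_def r_def w_def by (rule euler_z_derivative[OF q])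
    also have "s * (2 * p - w * s * r) = - (w * t)" unfolding wt by (simp add: algebra_simps)
    finally have e: "p' * (2 * x * s + 3 * y * s\<^sup>2) = - (w * t)" .
    define h where "h = (2 * x * s + 3 * y * s\<^sup>2) / w"
    have t_eq: "t = - (p' * h)" using e w by (simp add: h_def)
    have P_pd: "pderiv_at k P q = (if k = Inl d0 then s\<^sup>2 else if k = Inr d0 then s ^ 3
        else if k = Inl j then - h else if k = Inr j then - s * h else 0)"
      unfolding P_def using nz j by (auto simp: h_def x_def y_def s_def w_def field_simps power2_eq_square)
    have p'_pd: "pderiv_at k (dx (dz j f)) q =
      (if k = Inl d0 then s\<^sup>2 * p' else if k = Inr d0 then s ^ 3 * p'
       else if k = Inl j then t else if k = Inr j then s * t - p' / w else 0)"
      unfolding xz_derivative_pderiv[OF q] by (simp add: s_def p'_def p_def r_def w_def t_def)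
    have p_pd: "pderiv_at k (dz j f) q =
      (if k = Inl d0 then p' else if k = Inr d0 then s * p'
       else if k = Inl j then r else if k = Inr j then s * r - p / w else 0)"
      by (subst z_derivative_pderiv[OF q]) (simp add: s_def p'_def p_def r_def w_def)
    have "pderiv_at k A q = - ((w * pderiv_at k (dx (dz j f)) q
        + (if k = Inr j then 1 else 0) * p') - w * p' * pderiv_at k P q) * exp (- P q)"
      unfolding A_def using cp cP[OF q] by (simp add: w_def p'_def algebra_simps)
    also have "\<dots> = 0"
      unfolding p'_pd P_pd t_eq using w j by (auto simp: algebra_simps)
    finally show "pderiv_at k A q = 0" .
    have "pderiv_at k C q = 2 * s * pderiv_at k (slope j) q * w * p + s\<^sup>2 * (if k = Inr j then 1 else 0) * p
        + s\<^sup>2 * w * pderiv_at k (dz j f) q - (if k = Inr j then 1 else 0) * p'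
        - w * pderiv_at k (dx (dz j f)) q"
      unfolding C_def using cp nz by (simp add: w_def p'_def s_def p_def algebra_simps)
    also have "pderiv_at k (slope j) q = (if k = Inl j then - 1 / w else if k = Inr j then - s / w else 0)"
      using nz by (simp add: w_def s_def)
    also have "2 * s * (if k = Inl j then - 1 / w else if k = Inr j then - s / w else 0) * w * p
        + s\<^sup>2 * (if k = Inr j then 1 else 0) * p
        + s\<^sup>2 * w * pderiv_at k (dz j f) q - (if k = Inr j then 1 else 0) * p'
        - w * pderiv_at k (dx (dz j f)) q = 0"
      unfolding p_pd p'_pd t_def using w j by (auto simp: field_simps power2_eq_square power3_eq_cube)
    finally show "pderiv_at k C q = 0" .
  qed
  obtain a where a: "\<And>q. q \<in> U \<Longrightarrow> A q = a"
    by (rule cdiff_zero_constant[OF open_U assms cA zero(1)]) blast+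
  obtain c where c: "\<And>q. q \<in> U \<Longrightarrow> C q = c"
    by (rule cdiff_zero_constant[OF open_U assms cC zero(2)]) blast+
  have "dz j f q = a * dz j (endpoint_value d0 j) q + c * dz j (laurent j) q"
    if q: "q \<in> U" for q
  proof -
    note nz = coord_nz[OF q, of "Inr j"] slope_nz[OF q j]
    have "a * exp (P q) = - (q $ Inr j * dx (dz j f) q)"
      unfolding a[OF q, symmetric] A_def by (simp add: exp_minus)
    then have "(slope j q)\<^sup>2 * q $ Inr j * dz j f q = c - a * exp (P q)"
      unfolding c[OF q, symmetric] C_def by simp
    then show ?thesis using nz j by (simp add: endpoint_value_pderiv[OF q j] laurent_pderiv[OF q j] P_def field_simps)
  qed
  then show ?thesis using that by blast
qed

end

end

section \<open>Completeness and linear independence\<close>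

context hole_chart begin

text \<open>
  The values of \<open>f\<close>, \<open>\<partial>f/\<partial>x\<close> and \<open>\<partial>\<^sup>2f/\<partial>x\<^sup>2\<close> satisfy a linear system of first order.
\<close>

lemma airy_type_pderivs:
  assumes f: "airy_type f" and q: "q \<in> U"
  defines "x \<equiv> q $ Inl d0" and "v \<equiv> 1 / (3 * q $ Inr d0)"
    and "f0 \<equiv> f q" and "f1 \<equiv> dx f q" and "f2 \<equiv> dx (dx f) q"
  defines "f3 \<equiv> (- 2 * f0 + 6 * x * f1 + 4 * x\<^sup>2 * f2) * v\<^sup>2"
  shows "pderiv_at k f q = (if k = Inl d0 then f1 else if k = Inr d0 then (f0 - 2 * x * f1) * v else 0)"
    and "pderiv_at k (dx f) q
      = (if k = Inl d0 then f2 else if k = Inr d0 then (- f1 - 2 * x * f2) * v else 0)"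
    and "pderiv_at k (dx (dx f)) q
      = (if k = Inl d0 then f3 else if k = Inr d0 then (- 3 * f2 - 2 * x * f3) * v else 0)"
proof -
  have hf: "holo f" using f by (simp add: airy_type_def)
  note c = holoD[OF hf] holoD[OF holo_pderiv[OF hf]] holoD[OF holo_pderiv[OF holo_pderiv[OF hf]]]
  have nz: "p $ Inr d0 \<noteq> 0" if "p \<in> U" for p using coord_nz[OF that, of "Inr d0"] by simp
  have Y0: "dy f p = (f p - 2 * p $ Inl d0 * dx f p) / (3 * p $ Inr d0)" if "p \<in> U" for p
    using airy_typeD(3)[OF f that] nz[OF that] by (simp add: field_simps)
  have div: "dx (\<lambda>p. N p / (3 * p $ Inr d0)) p = dx N p / (3 * p $ Inr d0)"
    if "p \<in> U" "cdiff N p" for N p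
    using that nz[OF that(1)] by (simp add: power2_eq_square)
  have Y1: "dy (dx f) p
      = (- dx f p - 2 * p $ Inl d0 * dx (dx f) p) / (3 * p $ Inr d0)"
    if "p \<in> U" for p
  proof -
    have "dy (dx f) p = dx (dy f) p"
      by (rule pd_commute[OF hf that])
    also have "\<dots> = dx (\<lambda>p. (f p - 2 * p $ Inl d0 * dx f p) / (3 * p $ Inr d0)) p"
      by (rule pd_cong[OF that Y0])
    also have "\<dots> = dx (\<lambda>p. f p - 2 * p $ Inl d0 * dx f p) p / (3 * p $ Inr d0)"
      by (rule div[OF that]) (use c that in simp)
    finally show ?thesis using c that by simp
  qed
  have Y2: "dy (dx (dx f)) p
      = (- 3 * dx (dx f) p
         - 2 * p $ Inl d0 * dx (dx (dx f)) p) / (3 * p $ Inr d0)"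
    if "p \<in> U" for p
  proof -
    have "dy (dx (dx f)) p = dx (dy (dx f)) p"
      by (rule pd_commute[OF holo_pderiv[OF hf] that])
    also have "\<dots> = dx (\<lambda>p. (- dx f p - 2 * p $ Inl d0 * dx (dx f) p) / (3 * p $ Inr d0)) p"
      by (rule pd_cong[OF that Y1])
    also have "\<dots> = dx (\<lambda>p. - dx f p - 2 * p $ Inl d0 * dx (dx f) p) p
        / (3 * p $ Inr d0)"
      by (rule div[OF that]) (use c that in simp)
    finally show ?thesis using c that by simp
  qed
  have X3: "dx (dx (dx f)) q = f3"
  proof -
    have "dx (dx (dx f)) q = dy (dy f) q"
      by (rule airy_typeD(2)[OF f q])
    also have "\<dots> = dy (\<lambda>p. (f p - 2 * p $ Inl d0 * dx f p) / (3 * p $ Inr d0)) q"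
      by (rule pd_cong[OF q Y0])
    also have "\<dots> = ((dy f q - 2 * x * dy (dx f) q) * (3 * q $ Inr d0)
        - (f0 - 2 * x * f1) * 3) / (3 * q $ Inr d0)\<^sup>2"
      using c q nz[OF q] by (simp add: x_def f0_def f1_def)
    also have "\<dots> = (dy f q - 2 * x * dy (dx f) q) * v - 3 * (f0 - 2 * x * f1) * v\<^sup>2"
      using nz[OF q] by (simp add: v_def divide_simps power2_eq_square)
    also have "\<dots> = f3"
    proof -
      have e: "dy f q = (f0 - 2 * x * f1) * v"
        "dy (dx f) q = (- f1 - 2 * x * f2) * v"
        using Y0[OF q] Y1[OF q] by (simp_all add: v_def x_def f0_def f1_def f2_def)
      show ?thesis unfolding e f3_def by (simp add: algebra_simps power2_eq_square)
    qed
    finally show ?thesis .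
  qed
  have other: "pderiv_at k f p = 0" if "p \<in> U" "k \<noteq> Inl d0" "k \<noteq> Inr d0" for p k by (rule airy_typeD(1)[OF f that])
  have other1: "pderiv_at k (dx f) p = 0" if "p \<in> U" "k \<noteq> Inl d0" "k \<noteq> Inr d0" for p k
  proof -
    have "dx (pderiv_at k f) p = dx (\<lambda>_. 0) p"
      by (rule pd_cong[OF that(1)]) (rule other[OF _ that(2,3)])
    then show ?thesis using pd_commute[OF hf that(1), of k] by simp
  qed
  have other2: "pderiv_at k (dx (dx f)) p = 0" if "p \<in> U" "k \<noteq> Inl d0" "k \<noteq> Inr d0" for p k
  proof -
    have "dx (pderiv_at k (dx f)) p = dx (\<lambda>_. 0) p"
      by (rule pd_cong[OF that(1)]) (rule other1[OF _ that(2,3)])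
    then show ?thesis using pd_commute[OF holo_pderiv[OF hf] that(1), of k] by simp
  qed
  show "pderiv_at k f q = (if k = Inl d0 then f1 else if k = Inr d0 then (f0 - 2 * x * f1) * v else 0)"
    using Y0[OF q] other[OF q] by (simp add: f0_def f1_def x_def v_def)
  show "pderiv_at k (dx f) q
      = (if k = Inl d0 then f2 else if k = Inr d0 then (- f1 - 2 * x * f2) * v else 0)"
    using Y1[OF q] other1[OF q] by (simp add: f1_def f2_def x_def v_def)
  show "pderiv_at k (dx (dx f)) q
      = (if k = Inl d0 then f3 else if k = Inr d0 then (- 3 * f2 - 2 * x * f3) * v else 0)"
    using Y2[OF q] other2[OF q] X3 by (simp add: f2_def x_def v_def)
qed

lemma wronskian_cdiff:
  assumes "airy_type f" "airy_type g" "airy_type h" "q \<in> U"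
  shows "cdiff (wronskian f g h) q"
proof -
  have "holo f" "holo g" "holo h" using assms by (simp_all add: airy_type_def)
  note c = holoD[OF _ assms(4)] holoD[OF holo_pderiv assms(4)] holoD[OF holo_pderiv[OF holo_pderiv] assms(4)]
  show ?thesis unfolding wronskian_def[abs_def] det3_def
    using c \<open>holo f\<close> \<open>holo g\<close> \<open>holo h\<close> by simp
qed

text \<open>
  Abel's identity: the logarithmic derivative of a Wronskian is the trace of the coefficient matrix, which
  does not depend on the three functions.
\<close>

lemma wronskian_pderiv:
  assumes "airy_type f" "airy_type g" "airy_type h" "q \<in> U"
  shows "pderiv_at k (wronskian f g h) q =
    (if k = Inl d0 then 4 * (q $ Inl d0)\<^sup>2 * (1 / (3 * q $ Inr d0))\<^sup>2
     else if k = Inr d0 then (- 3 - 8 * (q $ Inl d0) ^ 3 * (1 / (3 * q $ Inr d0))\<^sup>2) * (1 / (3 * q $ Inr d0)) else 0)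
    * wronskian f g h q"
proof -
  have "holo f" "holo g" "holo h" using assms by (simp_all add: airy_type_def)
  note c = holoD[OF _ assms(4)] holoD[OF holo_pderiv assms(4)] holoD[OF holo_pderiv[OF holo_pderiv] assms(4)]
  define v x where "v = 1 / (3 * q $ Inr d0)" and "x = q $ Inl d0"
  let ?X = "dx" and ?D = "\<lambda>u. pderiv_at k u q"
  have "?D (wronskian f g h) =
      det3 (?D f) (?X f q) (?X (?X f) q) (?D g) (?X g q) (?X (?X g) q) (?D h) (?X h q) (?X (?X h) q)
    + det3 (f q) (?D (?X f)) (?X (?X f) q) (g q) (?D (?X g)) (?X (?X g) q) (h q) (?D (?X h)) (?X (?X h) q)
    + det3 (f q) (?X f q) (?D (?X (?X f))) (g q) (?X g q) (?D (?X (?X g))) (h q) (?X h q) (?D (?X (?X h)))"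
    unfolding wronskian_def[abs_def] det3_def
    using c \<open>holo f\<close> \<open>holo g\<close> \<open>holo h\<close> by (simp add: algebra_simps)
  also have "\<dots> = (if k = Inl d0 then 4 * x\<^sup>2 * v\<^sup>2 else if k = Inr d0 then (- 3 - 8 * x ^ 3 * v\<^sup>2) * v else 0)
      * wronskian f g h q"
    unfolding airy_type_pderivs[OF assms(1,4), folded v_def x_def, of k] airy_type_pderivs[OF assms(2,4), folded v_def x_def, of k]
      airy_type_pderivs[OF assms(3,4), folded v_def x_def, of k] wronskian_def det3_def
    by (simp add: algebra_simps power2_eq_square power3_eq_cube)
  finally show ?thesis by (simp only: v_def x_def)
qed

lemma wronskian_ratio:
  assumes "connected U" "airy_type f" "airy_type g" "airy_type h" "airy_type f'" "airy_type g'" "airy_type h'"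
    and nz: "\<And>q. q \<in> U \<Longrightarrow> wronskian f' g' h' q \<noteq> 0"
  obtains c where "\<forall>q\<in>U. wronskian f g h q = c * wronskian f' g' h' q"
proof -
  define R where "R = (\<lambda>q. wronskian f g h q / wronskian f' g' h' q)"
  obtain c where c: "\<And>q. q \<in> U \<Longrightarrow> R q = c"
  proof (rule cdiff_zero_constant[OF open_U assms(1)])
    show "cdiff R q" if "q \<in> U" for q
      unfolding R_def using wronskian_cdiff[OF assms(2-4) that] wronskian_cdiff[OF assms(5-7) that] nz[OF that] by simp
    show "pderiv_at k R q = 0" if "q \<in> U" for q k
    proof -
      have "pderiv_at k R q = (pderiv_at k (wronskian f g h) q * wronskian f' g' h' q
          - wronskian f g h q * pderiv_at k (wronskian f' g' h') q) / (wronskian f' g' h' q)\<^sup>2"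
        unfolding R_def
        by (rule pderiv_divide[OF wronskian_cdiff[OF assms(2-4) that] wronskian_cdiff[OF assms(5-7) that] nz[OF that]])
      then show ?thesis
        unfolding wronskian_pderiv[OF assms(2-4) that] wronskian_pderiv[OF assms(5-7) that] by (simp only: mult_ac diff_self) simp
    qed
  qed blast+
  then have "\<forall>q\<in>U. wronskian f g h q = c * wronskian f' g' h' q"
    using nz by (auto simp: R_def field_simps)
  then show ?thesis using that by blast
qed

text \<open>
  Cramer's rule; the ratios of Wronskians in it are constant.
\<close>

lemma airy_type_span:
  assumes "connected U" and \<phi>: "\<And>a. airy_type (\<phi> a)" and nz: "\<And>q. q \<in> U \<Longrightarrow> wronskian (\<phi> 0) (\<phi> 1) (\<phi> 2) q \<noteq> 0"
    and f: "airy_type f"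
  obtains \<kappa> :: "nat \<Rightarrow> complex" where "\<forall>q\<in>U. f q = (\<Sum>a<3. \<kappa> a * \<phi> a q)"
proof -
  obtain c0 where c0: "\<forall>q\<in>U. wronskian f (\<phi> 1) (\<phi> 2) q = c0 * wronskian (\<phi> 0) (\<phi> 1) (\<phi> 2) q"
    by (rule wronskian_ratio[OF assms(1) f \<phi> \<phi> \<phi> \<phi> \<phi> nz])
  obtain c1 where c1: "\<forall>q\<in>U. wronskian (\<phi> 0) f (\<phi> 2) q = c1 * wronskian (\<phi> 0) (\<phi> 1) (\<phi> 2) q"
    by (rule wronskian_ratio[OF assms(1) \<phi> f \<phi> \<phi> \<phi> \<phi> nz])
  obtain c2 where c2: "\<forall>q\<in>U. wronskian (\<phi> 0) (\<phi> 1) f q = c2 * wronskian (\<phi> 0) (\<phi> 1) (\<phi> 2) q"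
    by (rule wronskian_ratio[OF assms(1) \<phi> \<phi> f \<phi> \<phi> \<phi> nz])
  have "f q = c0 * \<phi> 0 q + c1 * \<phi> 1 q + c2 * \<phi> 2 q" if q: "q \<in> U" for q
  proof -
    have "wronskian (\<phi> 0) (\<phi> 1) (\<phi> 2) q * f q = wronskian f (\<phi> 1) (\<phi> 2) q * \<phi> 0 q
        + wronskian (\<phi> 0) f (\<phi> 2) q * \<phi> 1 q + wronskian (\<phi> 0) (\<phi> 1) f q * \<phi> 2 q"
      unfolding wronskian_def det3_def by (simp add: algebra_simps)
    also have "\<dots> = wronskian (\<phi> 0) (\<phi> 1) (\<phi> 2) q * (c0 * \<phi> 0 q + c1 * \<phi> 1 q + c2 * \<phi> 2 q)"
      using c0 c1 c2 q by (simp add: algebra_simps)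
    finally show ?thesis using nz[OF q] by simp
  qed
  then have "\<forall>q\<in>U. f q = (\<Sum>a<3. (if a = 0 then c0 else if a = 1 then c1 else c2) * \<phi> a q)"
    by (simp add: eval_nat_numeral)
  then show ?thesis using that[of "\<lambda>a. if a = 0 then c0 else if a = 1 then c1 else c2"] by blast
qed

text \<open>
  The part of the system that is needed to recognise a function as one of \<open>airy_type\<close>.  Unlike the full
  system, it consists of few equations, so that stability under linear combinations is immediate.
\<close>

definition presolution :: "(complex ^ ('d + 'd) \<Rightarrow> complex) \<Rightarrow> bool" where
  "presolution f \<longleftrightarrow> holo f \<and> (\<forall>p\<in>U.
     dx (dx (dx f)) p = dy (dy f) p \<and>
     2 * p $ Inl d0 * dx f p + 3 * p $ Inr d0 * dy f p
        + (\<Sum>j\<in>UNIV - {d0}. p $ Inr j * dw j f p) = f p \<and>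
     (\<forall>i. i \<noteq> d0 \<longrightarrow> p $ Inl i * dz i f p + p $ Inr i * dw i f p = 0))"

lemma solution_presolution: "solution f \<Longrightarrow> presolution f"
  unfolding presolution_def using solution_euler toric_cubic by (auto simp: solution_def)

lemma holo_diff_mult: "holo f \<Longrightarrow> holo g \<Longrightarrow> holo (\<lambda>q. f q - c * g q)"
  by (simp add: holo_def)

lemma pd_diff_mult:
  "holo f \<Longrightarrow> holo g \<Longrightarrow> q \<in> U \<Longrightarrow> pderiv_at k (\<lambda>q. f q - c * g q) q = pderiv_at k f q - c * pderiv_at k g q"
  by (simp add: holo_def)

lemma pd2_diff_mult:
  assumes "holo f" "holo g" "q \<in> U"
  shows "pderiv_at l (pderiv_at k (\<lambda>q. f q - c * g q)) q
    = pderiv_at l (pderiv_at k f) q - c * pderiv_at l (pderiv_at k g) q"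
proof -
  have "pderiv_at l (pderiv_at k (\<lambda>q. f q - c * g q)) q = pderiv_at l (\<lambda>q. pderiv_at k f q - c * pderiv_at k g q) q"
    by (rule pd_cong[OF assms(3) pd_diff_mult[OF assms(1,2)]])
  then show ?thesis using pd_diff_mult[OF holo_pderiv[OF assms(1)] holo_pderiv[OF assms(2)] assms(3)] by simp
qed

lemma pd3_diff_mult:
  assumes "holo f" "holo g" "q \<in> U"
  shows "pderiv_at m (pderiv_at l (pderiv_at k (\<lambda>q. f q - c * g q))) q
    = pderiv_at m (pderiv_at l (pderiv_at k f)) q - c * pderiv_at m (pderiv_at l (pderiv_at k g)) q"
proof -
  have "pderiv_at m (pderiv_at l (pderiv_at k (\<lambda>q. f q - c * g q))) q
     = pderiv_at m (\<lambda>q. pderiv_at l (pderiv_at k f) q - c * pderiv_at l (pderiv_at k g) q) q"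
    by (rule pd_cong[OF assms(3) pd2_diff_mult[OF assms(1,2)]])
  then show ?thesis
    using pd_diff_mult[OF holo_pderiv[OF holo_pderiv[OF assms(1)]] holo_pderiv[OF holo_pderiv[OF assms(2)]] assms(3)] by simp
qed

lemma presolution_diff_mult:
  assumes f: "presolution f" and g: "presolution g"
  shows "presolution (\<lambda>q. f q - c * g q)"
proof -
  have h: "holo f" "holo g" using assms by (simp_all add: presolution_def)
  show ?thesis
    unfolding presolution_def
  proof (intro conjI ballI allI impI)
    show "holo (\<lambda>q. f q - c * g q)" by (rule holo_diff_mult[OF h])
    fix p assume p: "p \<in> U"
    note d = pd_diff_mult[OF h p] pd2_diff_mult[OF h p] pd3_diff_mult[OF h p]
    show "dx (dx (dx (\<lambda>q. f q - c * g q))) p =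
        dy (dy (\<lambda>q. f q - c * g q)) p"
      unfolding d using f g p by (simp add: presolution_def)
    have e: "2 * p $ Inl d0 * dx u p + 3 * p $ Inr d0 * dy u p
        + (\<Sum>j\<in>UNIV - {d0}. p $ Inr j * dw j u p) = u p" if "presolution u" for u
      using that p by (simp add: presolution_def)
    have s: "(\<Sum>j\<in>UNIV - {d0}. p $ Inr j * (dw j f p - c * dw j g p))
       = (\<Sum>j\<in>UNIV - {d0}. p $ Inr j * dw j f p) - c * (\<Sum>j\<in>UNIV - {d0}. p $ Inr j * dw j g p)"
      by (simp add: sum_subtractf sum_distrib_left algebra_simps)
    show "2 * p $ Inl d0 * dx (\<lambda>q. f q - c * g q) p + 3 * p $ Inr d0 * dy (\<lambda>q. f q - c * g q) p
        + (\<Sum>j\<in>UNIV - {d0}. p $ Inr j * dw j (\<lambda>q. f q - c * g q) p) = f p - c * g p"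
      unfolding d s e[OF f, symmetric] e[OF g, symmetric] by (simp add: algebra_simps)
    have e': "p $ Inl i * dz i u p + p $ Inr i * dw i u p = 0" if "presolution u" "i \<noteq> d0" for u i
      using that p by (simp add: presolution_def)
    show "p $ Inl i * dz i (\<lambda>q. f q - c * g q) p + p $ Inr i * dw i (\<lambda>q. f q - c * g q) p = 0"
      if "i \<noteq> d0" for i
    proof -
      have "p $ Inl i * (dz i f p - c * dz i g p) + p $ Inr i * (dw i f p - c * dw i g p)
        = (p $ Inl i * dz i f p + p $ Inr i * dw i f p)
          - c * (p $ Inl i * dz i g p + p $ Inr i * dw i g p)"
        by (simp add: algebra_simps)
      then show ?thesis unfolding d using e'[OF f that] e'[OF g that] by simp
    qed
  qed
qed

abbreviation "attached \<alpha> \<gamma> q \<equiv> (\<Sum>j\<in>UNIV - {d0}. \<alpha> j * endpoint_value d0 j q + \<gamma> j * laurent j q)"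

lemma residue_sum:
  assumes q: "q \<in> U"
  shows "cdiff (\<lambda>q. attached \<alpha> \<gamma> q) q"
    and "i \<noteq> d0 \<Longrightarrow> dz i (\<lambda>q. attached \<alpha> \<gamma> q) q
      = \<alpha> i * dz i (endpoint_value d0 i) q + \<gamma> i * dz i (laurent i) q"
proof -
  have summand: "cdiff (\<lambda>q. \<alpha> j * endpoint_value d0 j q + \<gamma> j * laurent j q) q"
     "pderiv_at k (\<lambda>q. \<alpha> j * endpoint_value d0 j q + \<gamma> j * laurent j q) q
       = \<alpha> j * pderiv_at k (endpoint_value d0 j) q + \<gamma> j * pderiv_at k (laurent j) q" if "j \<noteq> d0" for j k
    using endpoint_value_cdiff[OF q that] laurent_cdiff[OF q that] by simp_all
  show "cdiff (\<lambda>q. attached \<alpha> \<gamma> q) q"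
    by (rule cdiff_sum) (use summand in auto)
  assume i: "i \<noteq> d0"
  have "dz i (\<lambda>q. attached \<alpha> \<gamma> q) q
     = (\<Sum>j\<in>UNIV - {d0}. dz i (\<lambda>q. \<alpha> j * endpoint_value d0 j q + \<gamma> j * laurent j q) q)"
    by (rule pderiv_sum) (use summand in auto)
  also have "\<dots> = dz i (\<lambda>q. \<alpha> i * endpoint_value d0 i q + \<gamma> i * laurent i q) q"
    by (rule sum_only[OF i]) (use i in \<open>simp add: summand endpoint_value_pderiv[OF q] laurent_pderiv[OF q]\<close>)
  finally show "dz i (\<lambda>q. attached \<alpha> \<gamma> q) q
      = \<alpha> i * dz i (endpoint_value d0 i) q + \<gamma> i * dz i (laurent i) q"
    using summand(2)[OF i] by simp
qed

text \<open>
  Subtracting the multiples given by \<open>residue_constants\<close> removes the derivatives in all \<open>z\<^sub>j\<close>, and by homogeneity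
  those in all \<open>w\<^sub>j\<close>.
\<close>

lemma solution_decomposition:
  assumes "connected U" and \<phi>: "\<And>a. airy_type (\<phi> a)" and nz: "\<And>q. q \<in> U \<Longrightarrow> wronskian (\<phi> 0) (\<phi> 1) (\<phi> 2) q \<noteq> 0"
    and f: "solution f"
  obtains \<alpha> \<gamma> :: "'d \<Rightarrow> complex" and \<kappa> :: "nat \<Rightarrow> complex" where
    "\<forall>q\<in>U. f q = attached \<alpha> \<gamma> q + (\<Sum>a<3. \<kappa> a * \<phi> a q)"
proof -
  have "\<exists>a c. \<forall>q\<in>U. dz j f q = a * dz j (endpoint_value d0 j) q + c * dz j (laurent j) q"
    if "j \<noteq> d0" for j
    by (rule residue_constants[OF f that assms(1)]) blast
  then obtain \<alpha> \<gamma> where ag: "\<And>j q. j \<noteq> d0 \<Longrightarrow> q \<in> U \<Longrightarrow>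
      dz j f q = \<alpha> j * dz j (endpoint_value d0 j) q + \<gamma> j * dz j (laurent j) q"
    by metis
  define F where "F = (\<lambda>J q. f q - (\<Sum>j\<in>J. \<alpha> j * endpoint_value d0 j q + \<gamma> j * laurent j q))"
  have pre: "presolution (F J)" if "finite J" "d0 \<notin> J" for J
    using that
  proof (induction J rule: finite_induct)
    case empty
    then show ?case using solution_presolution[OF f] by (simp add: F_def)
  next
    case (insert j J)
    then have "j \<noteq> d0" "presolution (F J)" by auto
    then have "presolution (\<lambda>q. (F J q - \<alpha> j * endpoint_value d0 j q) - \<gamma> j * laurent j q)"
      by (intro presolution_diff_mult solution_presolution[OF endpoint_value_solution] solution_presolution[OF laurent_solution])
    moreover have "F (insert j J) = (\<lambda>q. (F J q - \<alpha> j * endpoint_value d0 j q) - \<gamma> j * laurent j q)"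
      using insert.hyps by (auto simp: F_def)
    ultimately show ?case by simp
  qed
  define f0 where "f0 = F (UNIV - {d0})"
  have p0: "presolution f0" unfolding f0_def by (rule pre) auto
  have hf: "holo f" using f by (simp add: solution_def)
  have Z: "dz i f0 q = 0" if i: "i \<noteq> d0" and q: "q \<in> U" for i q
  proof -
    have "dz i f0 q = dz i f q
        - dz i (\<lambda>q. attached \<alpha> \<gamma> q) q"
      unfolding f0_def F_def by (rule pderiv_diff[OF holoD[OF hf q] residue_sum(1)[OF q]])
    then show ?thesis unfolding residue_sum(2)[OF q i] using ag[OF i q] by simp
  qed
  have W: "dw i f0 q = 0" if i: "i \<noteq> d0" and q: "q \<in> U" for i q
  proof -
    have "q $ Inl i * dz i f0 q + q $ Inr i * dw i f0 q = 0"
      using p0 i q by (simp add: presolution_def)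
    then show ?thesis using Z[OF i q] coord_nz[OF q, of "Inr i"] by simp
  qed
  have "airy_type f0"
    unfolding airy_type_def
  proof (intro conjI ballI allI impI)
    show "holo f0" using p0 by (simp add: presolution_def)
    fix q assume q: "q \<in> U"
    show "pderiv_at k f0 q = 0" if "k \<noteq> Inl d0" "k \<noteq> Inr d0" for k
      using that Z[OF _ q] W[OF _ q] by (cases k) auto
    show "dx (dx (dx f0)) q = dy (dy f0) q"
      using p0 q by (simp add: presolution_def)
    have "2 * q $ Inl d0 * dx f0 q + 3 * q $ Inr d0 * dy f0 q
        + (\<Sum>j\<in>UNIV - {d0}. q $ Inr j * dw j f0 q) = f0 q" using p0 q by (simp add: presolution_def)
    then show "2 * q $ Inl d0 * dx f0 q + 3 * q $ Inr d0 * dy f0 q = f0 q"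
      using W[OF _ q] by simp
  qed
  obtain \<kappa> :: "nat \<Rightarrow> complex" where "\<forall>q\<in>U. f0 q = (\<Sum>a<3. \<kappa> a * \<phi> a q)"
    by (rule airy_type_span[OF assms(1) \<phi> nz \<open>airy_type f0\<close>])
  then have "\<forall>q\<in>U. f q = attached \<alpha> \<gamma> q + (\<Sum>a<3. \<kappa> a * \<phi> a q)"
    by (simp add: f0_def F_def algebra_simps)
  then show ?thesis using that by blast
qed

text \<open>
  The derivative in \<open>z\<^sub>i\<close> isolates the two solutions attached to \<open>i\<close>; the ratio of their derivatives, \<open>- exp (x s\<^sub>i\<^sup>2 + y s\<^sub>i\<^sup>3)\<close>, is
  not constant in \<open>x\<close>.  The remaining three functions are independent because their Wronskian does not vanish.
\<close>

lemma solutions_independent: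
  fixes \<phi> :: "nat \<Rightarrow> complex ^ ('d + 'd) \<Rightarrow> complex" and \<alpha> \<gamma> :: "'d \<Rightarrow> complex" and \<kappa> :: "nat \<Rightarrow> complex"
  assumes "U \<noteq> {}" and \<phi>: "\<And>a. airy_type (\<phi> a)" and nz: "\<And>q. q \<in> U \<Longrightarrow> wronskian (\<phi> 0) (\<phi> 1) (\<phi> 2) q \<noteq> 0"
    and zero: "\<forall>q\<in>U. attached \<alpha> \<gamma> q + (\<Sum>a<3. \<kappa> a * \<phi> a q) = 0"
  shows "j \<noteq> d0 \<Longrightarrow> \<alpha> j = 0" "j \<noteq> d0 \<Longrightarrow> \<gamma> j = 0" "a < 3 \<Longrightarrow> \<kappa> a = 0"
proof -
  obtain q0 where q0: "q0 \<in> U" using assms(1) by blast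
  have h\<phi>: "holo (\<phi> a)" for a using \<phi> by (simp add: airy_type_def)
  have ag: "\<alpha> i = 0 \<and> \<gamma> i = 0" if i: "i \<noteq> d0" for i
  proof -
    define E where "E = (\<lambda>q. exp (q $ Inl d0 * slope i q ^ 2 + q $ Inr d0 * slope i q ^ 3))"
    have rel: "\<alpha> i * E q = \<gamma> i" if q: "q \<in> U" for q
    proof -
      have "dz i (\<lambda>q. attached \<alpha> \<gamma> q + (\<Sum>a<3. \<kappa> a * \<phi> a q)) q
          = dz i (\<lambda>_. 0) q"
        by (rule pd_cong[OF q]) (use zero in auto)
      moreover have "cdiff (\<lambda>q. \<Sum>a<3. \<kappa> a * \<phi> a q) q" "dz i (\<lambda>q. \<Sum>a<3. \<kappa> a * \<phi> a q) q = 0"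
        using holoD[OF h\<phi> q] i airy_typeD(1)[OF \<phi> q, of "Inl i"] by simp_all
      ultimately have "\<alpha> i * dz i (endpoint_value d0 i) q + \<gamma> i * dz i (laurent i) q = 0"
        using pderiv_add[OF residue_sum(1)[OF q]] residue_sum(2)[OF q i] by simp
      then show ?thesis using i slope_nz[OF q i] coord_nz[OF q, of "Inr i"]
        by (simp add: endpoint_value_pderiv[OF q] laurent_pderiv[OF q] E_def field_simps)
    qed
    have "dx (\<lambda>q. \<alpha> i * E q) q0 = dx (\<lambda>_. \<gamma> i) q0"
      by (rule pd_cong[OF q0 rel])
    then have "\<alpha> i = 0"
      using coord_nz[OF q0, of "Inr i"] slope_nz[OF q0 i] i by (simp add: E_def)
    then show ?thesis using rel[OF q0] by simp
  qed
  show "j \<noteq> d0 \<Longrightarrow> \<alpha> j = 0" "j \<noteq> d0 \<Longrightarrow> \<gamma> j = 0" using ag by blast+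
  have "attached \<alpha> \<gamma> q = 0" for q
    using ag by (intro sum.neutral) auto
  then have z0: "\<kappa> 0 * \<phi> 0 q + \<kappa> 1 * \<phi> 1 q + \<kappa> 2 * \<phi> 2 q = 0" if "q \<in> U" for q
    using zero that by (simp add: eval_nat_numeral)
  have z1: "\<kappa> 0 * dx (\<phi> 0) q + \<kappa> 1 * dx (\<phi> 1) q + \<kappa> 2 * dx (\<phi> 2) q = 0"
    if "q \<in> U" for q
  proof -
    have "dx (\<lambda>q. \<kappa> 0 * \<phi> 0 q + \<kappa> 1 * \<phi> 1 q + \<kappa> 2 * \<phi> 2 q) q = dx (\<lambda>_. 0) q"
      by (rule pd_cong[OF that z0])
    then show ?thesis using holoD[OF h\<phi> that] by simp
  qed
  have z2: "\<kappa> 0 * dx (dx (\<phi> 0)) q + \<kappa> 1 * dx (dx (\<phi> 1)) q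
      + \<kappa> 2 * dx (dx (\<phi> 2)) q = 0"
    if "q \<in> U" for q
  proof -
    have "dx (\<lambda>q. \<kappa> 0 * dx (\<phi> 0) q + \<kappa> 1 * dx (\<phi> 1) q
        + \<kappa> 2 * dx (\<phi> 2) q) q = dx (\<lambda>_. 0) q"
      by (rule pd_cong[OF that z1])
    then show ?thesis using holoD[OF holo_pderiv[OF h\<phi>] that] by simp
  qed
  have det: "k = 0" if "k * a0 + r0 = 0" "k * a1 + r1 = 0" "k * a2 + r2 = 0"
     "det3 a0 a1 a2 b0 b1 b2 c0 c1 c2 \<noteq> 0" "det3 r0 r1 r2 b0 b1 b2 c0 c1 c2 = 0" for k a0 a1 a2 r0 r1 r2 b0 b1 b2 c0 c1 c2
  proof -
    have "r0 = - (k * a0)" "r1 = - (k * a1)" "r2 = - (k * a2)" using that(1-3) by (simp_all add: eq_neg_iff_add_eq_0 add.commute)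
    then have "det3 r0 r1 r2 b0 b1 b2 c0 c1 c2 = - k * det3 a0 a1 a2 b0 b1 b2 c0 c1 c2"
      by (simp add: det3_def algebra_simps)
    then show ?thesis using that(4,5) by simp
  qed
  note w = nz[OF q0, unfolded wronskian_def]
  have w1: "det3 (\<phi> 1 q0) (dx (\<phi> 1) q0) (dx (dx (\<phi> 1)) q0)
     (\<phi> 0 q0) (dx (\<phi> 0) q0) (dx (dx (\<phi> 0)) q0)
     (\<phi> 2 q0) (dx (\<phi> 2) q0) (dx (dx (\<phi> 2)) q0) \<noteq> 0"
   and w2: "det3 (\<phi> 2 q0) (dx (\<phi> 2) q0) (dx (dx (\<phi> 2)) q0)
     (\<phi> 0 q0) (dx (\<phi> 0) q0) (dx (dx (\<phi> 0)) q0)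
     (\<phi> 1 q0) (dx (\<phi> 1) q0) (dx (dx (\<phi> 1)) q0) \<noteq> 0"
    using w by (simp_all add: det3_def algebra_simps)
  have "\<kappa> 0 = 0"
    by (rule det[OF _ _ _ w, of _ "\<kappa> 1 * \<phi> 1 q0 + \<kappa> 2 * \<phi> 2 q0"
         "\<kappa> 1 * dx (\<phi> 1) q0 + \<kappa> 2 * dx (\<phi> 2) q0"
         "\<kappa> 1 * dx (dx (\<phi> 1)) q0 + \<kappa> 2 * dx (dx (\<phi> 2)) q0"])
       (use z0[OF q0] z1[OF q0] z2[OF q0] in \<open>simp_all add: add.assoc det3_def algebra_simps\<close>)
  moreover have "\<kappa> 1 = 0"
    by (rule det[OF _ _ _ w1, of _ "\<kappa> 0 * \<phi> 0 q0 + \<kappa> 2 * \<phi> 2 q0"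
         "\<kappa> 0 * dx (\<phi> 0) q0 + \<kappa> 2 * dx (\<phi> 2) q0"
         "\<kappa> 0 * dx (dx (\<phi> 0)) q0 + \<kappa> 2 * dx (dx (\<phi> 2)) q0"])
       (use z0[OF q0] z1[OF q0] z2[OF q0] in \<open>simp_all add: add.assoc det3_def algebra_simps\<close>)
  moreover have "\<kappa> 2 = 0"
    by (rule det[OF _ _ _ w2, of _ "\<kappa> 0 * \<phi> 0 q0 + \<kappa> 1 * \<phi> 1 q0"
         "\<kappa> 0 * dx (\<phi> 0) q0 + \<kappa> 1 * dx (\<phi> 1) q0"
         "\<kappa> 0 * dx (dx (\<phi> 0)) q0 + \<kappa> 1 * dx (dx (\<phi> 1)) q0"])
       (use z0[OF q0] z1[OF q0] z2[OF q0] in \<open>simp_all add: add.assoc det3_def algebra_simps\<close>)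
  moreover have "a = 0 \<or> a = 1 \<or> a = 2" if "a < 3" using that by auto
  ultimately show "a < 3 \<Longrightarrow> \<kappa> a = 0" by metis
qed

end

section \<open>Dimension of the solution spaces and rank\<close>

lemma sum_fun_apply: "(\<Sum>i\<in>K. f i) x = (\<Sum>i\<in>K. (f i x :: complex))"
  by (induction K rule: infinite_finite_induct) auto

lemma dim_indexed_basis:
  fixes b :: "'i \<Rightarrow> 'a \<Rightarrow> complex"
  assumes K: "finite K" and mem: "\<And>i. i \<in> K \<Longrightarrow> b i \<in> V"
    and indep: "\<And>c. \<forall>x. (\<Sum>i\<in>K. c i * b i x) = 0 \<Longrightarrow> \<forall>i\<in>K. c i = 0"
    and span: "\<And>f. f \<in> V \<Longrightarrow> \<exists>c. \<forall>x. f x = (\<Sum>i\<in>K. c i * b i x)"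
  shows "(\<exists>B. finite B \<and> V \<subseteq> cfun.span B) \<and> cfun.dim V = card K"
proof -
  have inj: "inj_on b K"
  proof (rule inj_onI, rule ccontr)
    fix i j assume ij: "i \<in> K" "j \<in> K" "b i = b j" "i \<noteq> j"
    define c :: "'i \<Rightarrow> complex" where "c = (\<lambda>k. if k = i then 1 else if k = j then - 1 else 0)"
    have "(\<Sum>k\<in>K. c k * b k x) = 0" for x
    proof -
      have "(\<Sum>k\<in>K. c k * b k x) = (\<Sum>k\<in>K. (if k = i then b i x else 0) - (if k = j then b j x else 0))"
        using ij(4) by (intro sum.cong) (auto simp: c_def)
      also have "\<dots> = 0" using ij K by (simp add: sum_subtractf)
      finally show ?thesis .
    qed
    then have "c i = 0" using indep ij(1) by blast
    then show False by (simp add: c_def)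
  qed
  have sub: "V \<subseteq> cfun.span (b ` K)"
  proof
    fix f assume "f \<in> V"
    then obtain c where "\<forall>x. f x = (\<Sum>i\<in>K. c i * b i x)" using span by blast
    then have "f = (\<Sum>i\<in>K. (\<lambda>x. c i * b i x))" by (auto simp: sum_fun_apply)
    moreover have "(\<Sum>i\<in>K. (\<lambda>x. c i * b i x)) \<in> cfun.span (b ` K)"
      by (intro cfun.span_sum cfun.span_scale cfun.span_base) auto
    ultimately show "f \<in> cfun.span (b ` K)" by simp
  qed
  have "cfun.independent (b ` K)"
  proof (rule cfun.independent_if_scalars_zero)
    show "finite (b ` K)" using K by simp
    fix c v assume z: "(\<Sum>v\<in>b ` K. (\<lambda>x. c v * v x)) = 0" and "v \<in> b ` K"
    then obtain i where i: "i \<in> K" "v = b i" by blast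
    have "(\<Sum>i\<in>K. c (b i) * b i x) = 0" for x
    proof -
      have "(\<Sum>i\<in>K. c (b i) * b i x) = (\<Sum>v\<in>b ` K. (\<lambda>x. c v * v x)) x"
        by (simp add: sum_fun_apply sum.reindex[OF inj])
      then show ?thesis unfolding z by simp
    qed
    then show "c v = 0" using indep[of "\<lambda>i. c (b i)"] i by blast
  qed
  then have "cfun.dim V = card K"
    using mem by (intro cfun.dim_unique[OF _ sub]) (auto simp: card_image[OF inj])
  then show ?thesis using sub K by blast
qed

lemma multi_pderiv_cong:
  assumes "open U" "\<And>x. x \<in> U \<Longrightarrow> f x = g x" "x \<in> U"
  shows "multi_pderiv u f x = multi_pderiv u g x"
proof -
  have "foldr (\<lambda>j. pderiv_at j ^^ u j) js f x = foldr (\<lambda>j. pderiv_at j ^^ u j) js g x" for js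
    using assms(3)
  proof (induction js arbitrary: x)
    case (Cons j js)
    then show ?case using pderiv_iter_cong[OF assms(1) Cons.IH Cons.prems] by simp
  qed (use assms(2) in auto)
  then show ?thesis by (simp add: multi_pderiv_def)
qed

context hole_chart begin

abbreviation "solutions \<equiv> solution_space (hole_matrix d0) (axis d0 1) U"

definition zero_extension :: "(complex ^ ('d + 'd) \<Rightarrow> complex) \<Rightarrow> complex ^ ('d + 'd) \<Rightarrow> complex" where
  "zero_extension f p = (if p \<in> U then f p else 0)"

lemma solution_cong:
  assumes "solution f" "\<And>p. p \<in> U \<Longrightarrow> f p = g p"
  shows "solution g"
proof -
  have "cdiff g p" if "p \<in> U" for p
    using assms(1) by (intro cdiff_cong[OF _ open_U that assms(2)]) (use that in \<open>auto simp: solution_def holo_def\<close>)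
  moreover have "pderiv_at k f p = pderiv_at k g p" if "p \<in> U" for k p
    by (rule pd_cong[OF that assms(2)])
  moreover have "multi_pderiv u f p = multi_pderiv u g p" if "p \<in> U" for u p
    by (rule multi_pderiv_cong[OF open_U assms(2) that])
  ultimately show ?thesis using assms unfolding solution_def solves_hypergeom_def holo_def by auto
qed

lemma solution_space_iff:
  "f \<in> solutions \<longleftrightarrow> solution f \<and> (\<forall>p. p \<notin> U \<longrightarrow> f p = 0)"
  by (auto simp: solution_space_def solution_def holo_def multi_holomorphic_on_iff)

lemma zero_extension_mem: "solution f \<Longrightarrow> zero_extension f \<in> solutions"
  unfolding solution_space_iff using solution_cong[of f "zero_extension f"] by (auto simp: zero_extension_def)

lemma solution_space_dim:
  assumes U: "simply_connected U" "U \<noteq> {}" and "j0 \<noteq> d0"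
  shows "(\<exists>B. finite B \<and> solutions \<subseteq> cfun.span B) \<and>
    cfun.dim (solutions) = 2 * CARD('d) + 1"
proof -
  have conn: "connected U" using U(1) by (rule simply_connected_imp_connected)
  obtain \<phi> :: "nat \<Rightarrow> complex ^ ('d + 'd) \<Rightarrow> complex" where "\<forall>a. airy_type (\<phi> a)"
    "\<forall>p\<in>U. wronskian (\<phi> 0) (\<phi> 1) (\<phi> 2) p \<noteq> 0"
    by (rule airy_type_basis[OF U(1)])
  then have \<phi>: "\<And>a. airy_type (\<phi> a)" and nz: "\<And>p. p \<in> U \<Longrightarrow> wronskian (\<phi> 0) (\<phi> 1) (\<phi> 2) p \<noteq> 0"
    by blast+
  define D where "D = UNIV - {d0}"
  define K where "K = D <+> (D <+> {..<3::nat})"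
  define b where "b = (\<lambda>i. case i of Inl j \<Rightarrow> zero_extension (endpoint_value d0 j)
     | Inr (Inl j) \<Rightarrow> zero_extension (laurent j) | Inr (Inr a) \<Rightarrow> zero_extension (\<phi> a))"
  have fin: "finite D" by (simp add: D_def)
  have cardD: "card D = CARD('d) - 1" by (simp add: D_def)
  have "CARD('d) \<ge> 1" by (simp add: Suc_leI)
  then have card: "card K = 2 * CARD('d) + 1"
    unfolding K_def using fin cardD by (simp add: card_Plus)
  have sum_K: "(\<Sum>i\<in>K. c i * b i p) = (if p \<in> U then (\<Sum>j\<in>UNIV - {d0}. c (Inl j) * endpoint_value d0 j p + c (Inr (Inl j)) * laurent j p)
      + (\<Sum>a<3. c (Inr (Inr a)) * \<phi> a p) else 0)" for c p
    unfolding K_def D_def[symmetric] using fin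
    by (simp add: sum.Plus b_def zero_extension_def sum.distrib)
  have "(\<exists>B. finite B \<and> solutions \<subseteq> cfun.span B) \<and>
    cfun.dim (solutions) = card K"
  proof (rule dim_indexed_basis[where b = b])
    show "finite K" using fin by (simp add: K_def)
    have mem: "j \<noteq> d0 \<Longrightarrow> zero_extension (endpoint_value d0 j) \<in> solutions"
      "j \<noteq> d0 \<Longrightarrow> zero_extension (laurent j) \<in> solutions"
      "zero_extension (\<phi> a) \<in> solutions" for j a
      by (rule zero_extension_mem, rule endpoint_value_solution, assumption)
        (rule zero_extension_mem, rule laurent_solution, assumption, rule zero_extension_mem, rule airy_type_solution[OF \<phi> assms(3)])
    show "b i \<in> solutions" if iK: "i \<in> K" for i
    proof -
      consider j where "i = Inl j" "j \<noteq> d0" | j where "i = Inr (Inl j)" "j \<noteq> d0" | a where "i = Inr (Inr a)"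
        using iK by (auto simp: K_def D_def)
      then show ?thesis
      proof cases
        case 1
        then show ?thesis using mem(1)[OF 1(2)] by (simp only: b_def sum.case)
      next
        case 2
        then show ?thesis using mem(2)[OF 2(2)] by (simp only: b_def sum.case)
      next
        case 3
        then show ?thesis using mem(3) by (simp only: b_def sum.case)
      qed
    qed
    show "\<forall>i\<in>K. c i = 0" if z: "\<forall>x. (\<Sum>i\<in>K. c i * b i x) = 0" for c
    proof -
      have z': "\<forall>q\<in>U. (\<Sum>j\<in>UNIV - {d0}. c (Inl j) * endpoint_value d0 j q + c (Inr (Inl j)) * laurent j q)
          + (\<Sum>a<3. c (Inr (Inr a)) * \<phi> a q) = 0"
      proof
        fix q assume q: "q \<in> U"
        have "(\<Sum>i\<in>K. c i * b i q) = 0" using z by blast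
        then show "(\<Sum>j\<in>UNIV - {d0}. c (Inl j) * endpoint_value d0 j q + c (Inr (Inl j)) * laurent j q)
          + (\<Sum>a<3. c (Inr (Inr a)) * \<phi> a q) = 0" unfolding sum_K if_P[OF q] .
      qed
      note i = solutions_independent[where \<alpha> = "\<lambda>j. c (Inl j)" and \<gamma> = "\<lambda>j. c (Inr (Inl j))" and \<kappa> = "\<lambda>a. c (Inr (Inr a))",
        OF U(2) \<phi> nz z']
      show ?thesis using i by (auto simp: K_def D_def)
    qed
    show "\<exists>c. \<forall>x. f x = (\<Sum>i\<in>K. c i * b i x)" if f: "f \<in> solutions" for f
    proof -
      have "solution f" and f0: "\<And>p. p \<notin> U \<Longrightarrow> f p = 0" using f unfolding solution_space_iff by auto
      obtain \<alpha> \<gamma> :: "'d \<Rightarrow> complex" and \<kappa> :: "nat \<Rightarrow> complex" where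
        "\<forall>q\<in>U. f q = (\<Sum>j\<in>UNIV - {d0}. \<alpha> j * endpoint_value d0 j q + \<gamma> j * laurent j q) + (\<Sum>a<3. \<kappa> a * \<phi> a q)"
        by (rule solution_decomposition[OF conn \<phi> nz \<open>solution f\<close>])
      then have "f x = (\<Sum>i\<in>K. (case i of Inl j \<Rightarrow> \<alpha> j | Inr (Inl j) \<Rightarrow> \<gamma> j | Inr (Inr a) \<Rightarrow> \<kappa> a) * b i x)" for x
        unfolding sum_K using f0 by simp
      then show ?thesis by blast
    qed
  qed
  then show ?thesis unfolding card .
qed

end

lemma nonzero_polynomial_continuous:
  assumes "nonzero_polynomial h"
  shows "continuous_on UNIV h"
proof -
  obtain M c where "h = (\<lambda>x. \<Sum>m\<in>M. c m * (\<Prod>i\<in>UNIV. x $ i ^ m i))"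
    using assms by (auto simp: nonzero_polynomial_def)
  then show ?thesis by (auto intro!: continuous_intros)
qed

lemma polynomial_on_line:
  fixes h :: "complex ^ 'n::finite \<Rightarrow> complex"
  assumes "nonzero_polynomial h"
  obtains P where "\<And>t. poly P t = h (x + t *s v)"
proof -
  obtain M c where h: "h = (\<lambda>x. \<Sum>m\<in>M. c m * (\<Prod>i\<in>UNIV. x $ i ^ m i))"
    using assms by (auto simp: nonzero_polynomial_def)
  have "poly (\<Sum>m\<in>M. smult (c m) (\<Prod>i\<in>UNIV. [:x $ i, v $ i:] ^ m i)) t = h (x + t *s v)" for t
    by (simp add: h poly_sum poly_prod poly_power)
  then show ?thesis using that by blast
qed

text \<open>
  On the line through a point where \<open>h\<close> is nonzero and one where \<open>h'\<close> is nonzero, both restrict to nonzero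
  polynomials in one variable, which have finitely many roots.
\<close>

lemma nonzero_polynomials_common_point:
  fixes h h' :: "complex ^ 'n::finite \<Rightarrow> complex"
  assumes "nonzero_polynomial h" "nonzero_polynomial h'"
  obtains x where "h x \<noteq> 0" "h' x \<noteq> 0"
proof -
  obtain x y where x: "h x \<noteq> 0" and y: "h' y \<noteq> 0" using assms by (auto simp: nonzero_polynomial_def)
  obtain P where P: "\<And>t. poly P t = h (x + t *s (y - x))" using polynomial_on_line[OF assms(1)] by blast
  obtain Q where Q: "\<And>t. poly Q t = h' (x + t *s (y - x))" using polynomial_on_line[OF assms(2)] by blast
  have "poly P 0 \<noteq> 0" using x by (simp add: P)
  moreover have "x + 1 *s (y - x) = y" by simp
  then have "poly Q 1 \<noteq> 0" using y by (simp only: Q) simp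
  ultimately have "P * Q \<noteq> 0" by auto
  then have "finite {t. poly (P * Q) t = 0}" by (rule poly_roots_finite)
  then obtain t where "poly (P * Q) t \<noteq> 0"
    using ex_new_if_finite[OF infinite_UNIV_char_0] by blast
  then show ?thesis using that[of "x + t *s (y - x)"] by (simp add: P Q)
qed

text \<open>
  The value does not depend on the polynomial: for two polynomials a small ball avoids the zeros of both.
\<close>

lemma hypergeom_rank_eqI:
  fixes A :: "int ^ 'n::finite ^ 'd::finite"
  assumes h: "nonzero_polynomial h"
    and r: "\<And>U. open U \<Longrightarrow> U \<noteq> {} \<Longrightarrow> simply_connected U \<Longrightarrow> U \<subseteq> {x. h x \<noteq> 0} \<Longrightarrow>
      (\<exists>B. finite B \<and> solution_space A \<beta> U \<subseteq> cfun.span B) \<and> cfun.dim (solution_space A \<beta> U) = r"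
  shows "hypergeom_rank A \<beta> = r"
  unfolding hypergeom_rank_def
proof (rule the_equality)
  show "\<exists>h. nonzero_polynomial h \<and> (\<forall>U. open U \<and> U \<noteq> {} \<and> simply_connected U \<and> U \<subseteq> {x. h x \<noteq> 0} \<longrightarrow>
     (\<exists>B. finite B \<and> solution_space A \<beta> U \<subseteq> cfun.span B) \<and> cfun.dim (solution_space A \<beta> U) = r)"
    using h r by blast
  fix r' assume "\<exists>h. nonzero_polynomial h \<and> (\<forall>U. open U \<and> U \<noteq> {} \<and> simply_connected U \<and> U \<subseteq> {x. h x \<noteq> 0} \<longrightarrow>
     (\<exists>B. finite B \<and> solution_space A \<beta> U \<subseteq> cfun.span B) \<and> cfun.dim (solution_space A \<beta> U) = r')"
  then obtain h' where h': "nonzero_polynomial h'"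
    and r': "\<And>U. open U \<Longrightarrow> U \<noteq> {} \<Longrightarrow> simply_connected U \<Longrightarrow> U \<subseteq> {x. h' x \<noteq> 0} \<Longrightarrow> cfun.dim (solution_space A \<beta> U) = r'"
    by blast
  obtain x where x: "h x \<noteq> 0" "h' x \<noteq> 0" using nonzero_polynomials_common_point[OF h h'] .
  have "open ({x. h x \<noteq> 0} \<inter> {x. h' x \<noteq> 0})"
    using nonzero_polynomial_continuous[OF h] nonzero_polynomial_continuous[OF h']
    by (intro open_Int open_Collect_neq) (auto intro: continuous_intros)
  then obtain e where e: "e > 0" "ball x e \<subseteq> {x. h x \<noteq> 0} \<inter> {x. h' x \<noteq> 0}"
    using x openE by blast
  have "simply_connected (ball x e)" by (rule convex_imp_simply_connected) simp
  then show "r' = r" using r[of "ball x e"] r'[of "ball x e"] e by auto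
qed

text \<open>
  The product of all variables other than \<open>x\<close> serves as the polynomial.
\<close>

lemma hypergeom_rank_hole_matrix:
  fixes d0 j0 :: "'d::finite"
  assumes "j0 \<noteq> d0"
  shows "hypergeom_rank (hole_matrix d0) (axis d0 1) = 2 * CARD('d) + 1"
proof (rule hypergeom_rank_eqI)
  define m :: "'d + 'd \<Rightarrow> nat" where "m = (\<lambda>k. if k = Inl d0 then 0 else 1)"
  let ?h = "\<lambda>x :: complex ^ ('d + 'd). \<Sum>m\<in>{m}. 1 * (\<Prod>i\<in>UNIV. x $ i ^ m i)"
  show "nonzero_polynomial ?h"
    unfolding nonzero_polynomial_def
    by (intro conjI exI[of _ "{m}"] exI[of _ "\<lambda>_. 1"] exI[of _ "\<chi> i. 1"]) auto
  fix U assume U: "open U" "U \<noteq> {}" "simply_connected U" "U \<subseteq> {x. ?h x \<noteq> 0}"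
  interpret hole_chart d0 U
  proof
    show "open U" by fact
    show "p $ k \<noteq> 0" if "p \<in> U" "k \<noteq> Inl d0" for p k
      using U(4) that by (auto simp: m_def dest!: subsetD split: if_splits)
  qed
  show "(\<exists>B. finite B \<and> solution_space (hole_matrix d0) (axis d0 1) U \<subseteq> cfun.span B) \<and>
    cfun.dim (solution_space (hole_matrix d0) (axis d0 1) U) = 2 * CARD('d) + 1"
    by (rule solution_space_dim[OF U(3,2) assms])
qed

lemma rank_hole_matrix: "rank (map_matrix real_of_int (hole_matrix d0 :: int ^ ('d + 'd) ^ 'd::finite)) = CARD('d)"
proof -
  have "\<exists>x. y = map_matrix real_of_int (hole_matrix d0) *v x" for y :: "real ^ 'd"
  proof
    let ?x = "(\<chi> k. case k of Inl j \<Rightarrow> (if j = d0 then y $ j / 2 else y $ j) | Inr _ \<Rightarrow> 0) :: real ^ ('d + 'd)"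
    have "(map_matrix real_of_int (hole_matrix d0) *v ?x) $ i = y $ i" for i
    proof -
      let ?g = "\<lambda>k. real_of_int (hole_matrix d0 $ i $ k) * ?x $ k"
      have "(map_matrix real_of_int (hole_matrix d0) *v ?x) $ i = sum ?g UNIV"
        by (simp add: matrix_vector_mult_def map_matrix_def)
      also have "\<dots> = (\<Sum>j\<in>UNIV. ?g (Inl j)) + (\<Sum>j\<in>UNIV. ?g (Inr j))"
        by (subst UNIV_Plus_UNIV[symmetric], subst sum.Plus) (auto simp: o_def)
      also have "(\<Sum>j\<in>UNIV. ?g (Inl j)) = ?g (Inl i)"
        by (subst sum.remove[of _ i]) (auto simp: hole_matrix_Inl intro!: sum.neutral)
      finally show ?thesis by (simp add: hole_matrix_Inl)
    qed
    then show "y = map_matrix real_of_int (hole_matrix d0) *v ?x" by (simp add: vec_eq_iff)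
  qed
  then show ?thesis unfolding full_rank_surjective surj_def by blast
qed

theorem theorem1p3:
  assumes "CARD('d::finite) \<ge> 2"
  shows "\<exists>(A :: int ^ ('d + 'd) ^ 'd) (\<beta> :: complex ^ 'd).
           rank (map_matrix real_of_int A) = CARD('d) \<and>
           real (hypergeom_rank A \<beta>) - simplicial_volume A \<ge> real CARD('d) - 1"
proof -
  obtain d0 j0 :: 'd where "j0 \<noteq> d0"
    using assms card_2_iff' [of "UNIV :: 'd set"] by (metis UNIV_I card_le_Suc0_iff_eq finite numeral_2_eq_2 not_less_eq_eq)
  then have "real (hypergeom_rank (hole_matrix d0) (axis d0 1)) = 2 * real CARD('d) + 1"
    by (simp add: hypergeom_rank_hole_matrix)
  then show ?thesis
    using rank_hole_matrix[of d0] simplicial_volume_hole_matrix_le[of d0]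
    by (intro exI[of _ "hole_matrix d0"] exI[of _ "axis d0 1"]) auto
qed

end
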